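(* Let $k\geq 2$ and let $(\Sigma_k,\sigma)$ be the full one-sided shift on $k$ symbols. Suppose $\varphi:\Sigma_k\to\mathbb{R}$ is continuous and $I_\varphi(\sigma)\neq\emptyset$. Then for any $a\in\operatorname{Int}(L_\varphi(\sigma))$ and each $i\in\{1,\dots,6\}$, the set $\{x\in Rec(\Sigma_k)\setminus BR(\Sigma_k): x \text{ satisfies Case }(i')\}$ contains an uncountable DC1-scrambled subset contained in $I_\varphi(\sigma)$, an uncountable DC1-scrambled subset contained in $R_\varphi(a)$, and an uncountable DC1-scrambled subset contained in $R_\varphi$.
   Context: $\Sigma_k=\{0,1,\dots,k-1\}^{\mathbb{N}}$ with metric $d(x,y)=\sum_{n\ge1}\delta(x_n,y_n)/2^n$ ($\delta(a,b)=0$ if $a=b$, $1$ otherwise) and shift $\sigma$. $N(x,U)=\{n\ge1:\sigma^n(x)\in U\}$. For $S\subseteq\mathbb{N}$: $\overline d,\underline d$ are upper/lower asymptotic densities and $B^*,B_*$ are Banach upper/lower densities (limsup/liminf of $|S\cap I|/|I|$ over intervals $I$ of consecutive integers with $|I|\to\infty$). $x\in Rec$ if $N(x,B_\varepsilon(x))\ne\emptyset$ for all $\varepsilon>0$; $x\in BR$ if $B^*(N(x,B_\varepsilon(x)))>0$ for all $\varepsilon>0$. For $\xi\in\{\overline d,\underline d,B^*,B_*\}$, $\omega_\xi(x)=\{y:\xi(N(x,B_\varepsilon(y)))>0\ \forall\varepsilon>0\}$; $\omega_\sigma(x)$ is the $\omega$-limit set. Cases: (1') $\omega_{B_*}\subsetneq\omega_{\underline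 d}=\omega_{\overline d}=\omega_{B^*}\subsetneq\omega_\sigma$; (2') $\omega_{B_*}\subsetneq\omega_{\underline d}=\omega_{\overline d}\subsetneq\omega_{B^*}\subsetneq\omega_\sigma$; (3') $\omega_{B_*}=\omega_{\underline d}\subsetneq\omega_{\overline d}=\omega_{B^*}\subsetneq\omega_\sigma$; (4') $\omega_{B_*}\subsetneq\omega_{\underline d}\subsetneq\omega_{\overline d}=\omega_{B^*}\subsetneq\omega_\sigma$; (5') $\omega_{B_*}=\omega_{\underline d}\subsetneq\omega_{\overline d}\subsetneq\omega_{B^*}\subsetneq\omega_\sigma$; (6') $\omega_{B_*}\subsetneq\omega_{\underline d}\subsetneq\omega_{\overline d}\subsetneq\omega_{B^*}\subsetneq\omega_\sigma$ (all sets evaluated at $x$). DC1 pair: $\liminf_n\frac1n|\{0\le i<n:d(\sigma^ix,\sigma^iy)<s\}|=0$ for some $s>0$ and $\limsup_n\frac1n|\{0\le i<n:d(\sigma^ix,\sigma^iy)<t\}|=1$ for all $t>0$; a DC1-scrambled set has at least two points and every pair of distinct points is DC1. $I_\varphi(\sigma)$ is the set of $x$ for which $\frac1n\sum_{i=0}^{n-1}\varphi(\sigma^ix)$ diverges; $L_\varphi(\sigma)=[\inf_\mu\int\varphi\,d\mu,\sup_\mu\int\varphi\,d\mu]$ over $\sigma$-invariant Borel probability measures $\mu$, $\operatorname{Int}(L_\varphi(\sigma))$ its open interior interval; $R_\varphi(a)=\{x:\lim_n\frac1n\sum_{i=0}^{n-1}\varphi(\sigma^ix)=a\}$ and $R_\varphi=\bigcup_{a\in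 L_\varphi(\sigma)}R_\varphi(a)$. *)

theory Defs
  imports "HOL-Probability.Probability" "HOL-Library.Liminf_Limsup"
begin

text \<open>Points of the full shift are represented as functions nat => nat; the value
  x n stands for the coordinate x_(n+1) of the paper (coordinates indexed from 1).\<close>

definition Sigma_k :: "nat \<Rightarrow> (nat \<Rightarrow> nat) set" where
  "Sigma_k k = {x. \<forall>n. x n < k}"

definition shift :: "(nat \<Rightarrow> nat) \<Rightarrow> (nat \<Rightarrow> nat)" where
  "shift x = (\<lambda>n. x (Suc n))"

definition sdist :: "(nat \<Rightarrow> nat) \<Rightarrow> (nat \<Rightarrow> nat) \<Rightarrow> real" where
  "sdist x y = (\<Sum>n. (if x n = y n then 0 else 1) / 2 ^ Suc n)"

definition sball :: "nat \<Rightarrow> (nat \<Rightarrow> nat) \<Rightarrow> real \<Rightarrow> (nat \<Rightarrow> nat) set" where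
  "sball k y e = {z \<in> Sigma_k k. sdist y z < e}"

definition s_open :: "nat \<Rightarrow> (nat \<Rightarrow> nat) set \<Rightarrow> bool" where
  "s_open k U \<longleftrightarrow> U \<subseteq> Sigma_k k \<and> (\<forall>x\<in>U. \<exists>e>0. sball k x e \<subseteq> U)"

definition s_continuous :: "nat \<Rightarrow> ((nat \<Rightarrow> nat) \<Rightarrow> real) \<Rightarrow> bool" where
  "s_continuous k f \<longleftrightarrow> (\<forall>x\<in>Sigma_k k. \<forall>e>0. \<exists>\<delta>>0. \<forall>y\<in>Sigma_k k.
      sdist x y < \<delta> \<longrightarrow> \<bar>f y - f x\<bar> < e)"

definition borel_k :: "nat \<Rightarrow> (nat \<Rightarrow> nat) measure" where
  "borel_k k = sigma (Sigma_k k) {U. s_open k U}"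

definition inv_measures :: "nat \<Rightarrow> (nat \<Rightarrow> nat) measure set" where
  "inv_measures k = {\<mu>. sets \<mu> = sets (borel_k k) \<and> prob_space \<mu> \<and>
      shift \<in> measurable \<mu> \<mu> \<and> distr \<mu> \<mu> shift = \<mu>}"

definition Lmin :: "nat \<Rightarrow> ((nat \<Rightarrow> nat) \<Rightarrow> real) \<Rightarrow> real" where
  "Lmin k \<phi> = Inf ((\<lambda>\<mu>. integral\<^sup>L \<mu> \<phi>) ` inv_measures k)"

definition Lmax :: "nat \<Rightarrow> ((nat \<Rightarrow> nat) \<Rightarrow> real) \<Rightarrow> real" where
  "Lmax k \<phi> = Sup ((\<lambda>\<mu>. integral\<^sup>L \<mu> \<phi>) ` inv_measures k)"

definition birkhoff_avg :: "((nat \<Rightarrow> nat) \<Rightarrow> real) \<Rightarrow> (nat \<Rightarrow> nat) \<Rightarrow> nat \<Rightarrow> real" where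
  "birkhoff_avg \<phi> x n = (\<Sum>i<n. \<phi> ((shift ^^ i) x)) / real n"

definition I_phi :: "nat \<Rightarrow> ((nat \<Rightarrow> nat) \<Rightarrow> real) \<Rightarrow> (nat \<Rightarrow> nat) set" where
  "I_phi k \<phi> = {x \<in> Sigma_k k. \<not> convergent (birkhoff_avg \<phi> x)}"

definition R_phi_at :: "nat \<Rightarrow> ((nat \<Rightarrow> nat) \<Rightarrow> real) \<Rightarrow> real \<Rightarrow> (nat \<Rightarrow> nat) set" where
  "R_phi_at k \<phi> a = {x \<in> Sigma_k k. birkhoff_avg \<phi> x \<longlonglongrightarrow> a}"

definition R_phi :: "nat \<Rightarrow> ((nat \<Rightarrow> nat) \<Rightarrow> real) \<Rightarrow> (nat \<Rightarrow> nat) set" where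
  "R_phi k \<phi> = (\<Union>a\<in>{Lmin k \<phi>..Lmax k \<phi>}. R_phi_at k \<phi> a)"

definition upper_dens :: "nat set \<Rightarrow> ereal" where
  "upper_dens S = limsup (\<lambda>n. ereal (real (card (S \<inter> {1..n})) / real n))"

definition lower_dens :: "nat set \<Rightarrow> ereal" where
  "lower_dens S = liminf (\<lambda>n. ereal (real (card (S \<inter> {1..n})) / real n))"

definition banach_upper :: "nat set \<Rightarrow> real" where
  "banach_upper S = (INF N. SUP p\<in>{(m, n). m \<ge> 1 \<and> n \<ge> max N 1}.
      real (card (S \<inter> {fst p..<fst p + snd p})) / real (snd p))"

definition banach_lower :: "nat set \<Rightarrow> real" where
  "banach_lower S = (SUP N. INF p\<in>{(m, n). m \<ge> 1 \<and> n \<ge> max N 1}.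
      real (card (S \<inter> {fst p..<fst p + snd p})) / real (snd p))"

definition Nset :: "(nat \<Rightarrow> nat) \<Rightarrow> (nat \<Rightarrow> nat) set \<Rightarrow> nat set" where
  "Nset x U = {n. n \<ge> 1 \<and> (shift ^^ n) x \<in> U}"

definition Rec :: "nat \<Rightarrow> (nat \<Rightarrow> nat) set" where
  "Rec k = {x \<in> Sigma_k k. \<forall>e>0. Nset x (sball k x e) \<noteq> {}}"

definition BR :: "nat \<Rightarrow> (nat \<Rightarrow> nat) set" where
  "BR k = {x \<in> Sigma_k k. \<forall>e>0. banach_upper (Nset x (sball k x e)) > 0}"

definition omega_ud :: "nat \<Rightarrow> (nat \<Rightarrow> nat) \<Rightarrow> (nat \<Rightarrow> nat) set" where
  "omega_ud k x = {y \<in> Sigma_k k. \<forall>e>0. upper_dens (Nset x (sball k y e)) > 0}"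

definition omega_ld :: "nat \<Rightarrow> (nat \<Rightarrow> nat) \<Rightarrow> (nat \<Rightarrow> nat) set" where
  "omega_ld k x = {y \<in> Sigma_k k. \<forall>e>0. lower_dens (Nset x (sball k y e)) > 0}"

definition omega_Bu :: "nat \<Rightarrow> (nat \<Rightarrow> nat) \<Rightarrow> (nat \<Rightarrow> nat) set" where
  "omega_Bu k x = {y \<in> Sigma_k k. \<forall>e>0. banach_upper (Nset x (sball k y e)) > 0}"

definition omega_Bl :: "nat \<Rightarrow> (nat \<Rightarrow> nat) \<Rightarrow> (nat \<Rightarrow> nat) set" where
  "omega_Bl k x = {y \<in> Sigma_k k. \<forall>e>0. banach_lower (Nset x (sball k y e)) > 0}"

definition omega_lim :: "nat \<Rightarrow> (nat \<Rightarrow> nat) \<Rightarrow> (nat \<Rightarrow> nat) set" where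
  "omega_lim k x = {y \<in> Sigma_k k. \<forall>e>0. \<forall>N. \<exists>n\<ge>N. sdist ((shift ^^ n) x) y < e}"

definition case_prop :: "nat \<Rightarrow> nat \<Rightarrow> (nat \<Rightarrow> nat) \<Rightarrow> bool" where
  "case_prop k i x = (let Bl = omega_Bl k x; ld = omega_ld k x; ud = omega_ud k x;
      Bu = omega_Bu k x; w = omega_lim k x in
    (if i = 1 then Bl \<subset> ld \<and> ld = ud \<and> ud = Bu \<and> Bu \<subset> w
     else if i = 2 then Bl \<subset> ld \<and> ld = ud \<and> ud \<subset> Bu \<and> Bu \<subset> w
     else if i = 3 then Bl = ld \<and> ld \<subset> ud \<and> ud = Bu \<and> Bu \<subset> w
     else if i = 4 then Bl \<subset> ld \<and> ld \<subset> ud \<and> ud = Bu \<and> Bu \<subset> w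
     else if i = 5 then Bl = ld \<and> ld \<subset> ud \<and> ud \<subset> Bu \<and> Bu \<subset> w
     else if i = 6 then Bl \<subset> ld \<and> ld \<subset> ud \<and> ud \<subset> Bu \<and> Bu \<subset> w
     else False))"

definition close_freq :: "(nat \<Rightarrow> nat) \<Rightarrow> (nat \<Rightarrow> nat) \<Rightarrow> real \<Rightarrow> nat \<Rightarrow> ereal" where
  "close_freq x y s n = ereal (real (card {i. i < n \<and> sdist ((shift ^^ i) x) ((shift ^^ i) y) < s}) / real n)"

definition DC1_pair :: "(nat \<Rightarrow> nat) \<Rightarrow> (nat \<Rightarrow> nat) \<Rightarrow> bool" where
  "DC1_pair x y \<longleftrightarrow> (\<exists>s>0. liminf (close_freq x y s) = 0) \<and>
      (\<forall>t>0. limsup (close_freq x y t) = 1)"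

definition DC1_scrambled :: "(nat \<Rightarrow> nat) set \<Rightarrow> bool" where
  "DC1_scrambled S \<longleftrightarrow> (\<exists>x\<in>S. \<exists>y\<in>S. x \<noteq> y) \<and>
      (\<forall>x\<in>S. \<forall>y\<in>S. x \<noteq> y \<longrightarrow> DC1_pair x y)"

end

(* The points are built from long runs of finitely many pairwise disjoint periodic orbits, two with
   Birkhoff averages below the target and two above. Positions are grouped into the blocks [m^2, (m+1)^2). A block
   consists of a run of a low orbit followed by a run of a high orbit, in proportions that give any prescribed average,
   and the pair of orbits depends on the parity of a superexponentially growing epoch. Which orbits occur in both, in
   one or in none of the two regimes decides the relation between the lower and upper density limit sets; an optional
   fifth orbit, appearing in rare but arbitrarily long runs, separates the upper Banach density limit set from the upper
   density one. The point starts with a word that no run contains, and each prefix is copied very sparsely into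
   later blocks: this makes the point recurrent but not Banach recurrent. Shifting the runs of an epoch by one position
   or not, according to an infinite 0-1 code, gives uncountably many points that are pairwise DC1: two of them agree on
   almost all of infinitely many epochs and are uniformly apart on almost all of infinitely many others. *)

theory Submission
  imports Defs "HOL-Library.Discrete_Functions" "HOL-Real_Asymp.Real_Asymp"
begin

subsection \<open>Densities and limit sets\<close>

text \<open>Each return of a prefix repeats the initial word, and a copied prefix contains earlier
  copies. Upper Banach density tests windows at every position, so estimates on prefixes do not
  suffice: the crux is that a window of length n, wherever it lies, contains only O(sqrt n) places
  where the point fails to look periodic (\<open>card_defects_le\<close>). Hence
  \<open>omega_Bu\<close> consists of chosen periodic orbits only, and each case reduces to which
  orbits are used in which regime. Blocks between squares have lengths tending to infinity, so run
  boundaries are negligible, and long windows fit inside the run of the other orbit, which keeps the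
  low orbit out of \<open>omega_Bl\<close>. Yet the block at position N has length of order sqrt N
  only, so prefix averages do not notice where inside a block they stop. All orbits share one period
  \<open>q\<close>, so \<open>q\<close> consecutive symbols determine a run. Epochs dwarf their
  predecessors because regime averages and the DC1 frequencies 0 and 1 are all read off at ends of
  epochs.\<close>

lemma shift_funpow: "(shift ^^ n) x = (\<lambda>i. x (n + i))"
  by (induction n) (auto simp: shift_def)

lemma shift_funpow_Sigma: "x \<in> Sigma_k k \<Longrightarrow> (\<lambda>i. x (n + i)) \<in> Sigma_k k"
  by (auto simp: Sigma_k_def)

lemma summable_half_pow: "summable (\<lambda>n. 1 / 2 ^ Suc n :: real)"
  using summable_mult[OF summable_geometric[of "1/2::real"], of "1/2"]
  by (simp add: power_divide)

lemma sdist_summable: "summable (\<lambda>n. (if x n = y n then 0 else 1) / 2 ^ Suc n :: real)"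
  by (rule summable_comparison_test'[OF summable_half_pow, of 0]) auto

lemma sdist_le_of_agree:
  assumes "\<And>i. i < L \<Longrightarrow> x i = y i"
  shows "sdist x y \<le> 1 / 2 ^ L"
proof -
  let ?f = "\<lambda>n. (if x n = y n then 0 else 1) / 2 ^ Suc n :: real"
  have "sdist x y = (\<Sum>n. ?f (n + L)) + (\<Sum>n<L. ?f n)"
    unfolding sdist_def by (rule suminf_split_initial_segment[OF sdist_summable])
  also have "(\<Sum>n<L. ?f n) = 0"
    using assms by (intro sum.neutral) auto
  also have "(\<Sum>n. ?f (n + L)) \<le> (\<Sum>n. 1 / 2 ^ L * (1 / 2 ^ Suc n))"
  proof (rule suminf_le)
    show "?f (n + L) \<le> 1 / 2 ^ L * (1 / 2 ^ Suc n)" for n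
      by (auto simp: power_add field_simps)
    show "summable (\<lambda>n. ?f (n + L))"
      using summable_ignore_initial_segment[OF sdist_summable] .
    show "summable (\<lambda>n. 1 / 2 ^ L * (1 / 2 ^ Suc n) :: real)"
      by (rule summable_mult[OF summable_half_pow])
  qed
  also have "(\<Sum>n. 1 / 2 ^ L * (1 / 2 ^ Suc n)) = (1 / 2 ^ L :: real) * 1"
    using sums_mult[OF power_half_series, of "1 / 2 ^ L"]
    by (simp add: sums_iff power_divide)
  finally show ?thesis by simp
qed

lemma agree_of_sdist_less:
  assumes "sdist x y < 1 / 2 ^ L" "i < L"
  shows "x i = y i"
proof (rule ccontr)
  assume ne: "x i \<noteq> y i"
  let ?f = "\<lambda>n. (if x n = y n then 0 else 1) / 2 ^ Suc n :: real"
  have "(\<Sum>n\<in>{i}. ?f n) \<le> sdist x y"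
    unfolding sdist_def by (rule sum_le_suminf[OF sdist_summable]) auto
  with ne have "1 / 2 ^ Suc i \<le> sdist x y" by simp
  moreover have "(1::real) / 2 ^ L \<le> 1 / 2 ^ Suc i"
    using assms(2) by (intro divide_left_mono power_increasing) auto
  ultimately show False using assms(1) by linarith
qed

lemma ex_half_pow_less: "0 < (e::real) \<Longrightarrow> \<exists>L. 1 / 2 ^ L < e"
  using real_arch_pow_inv[of e "1/2"] by (auto simp: power_divide)

section \<open>Occurrences of prefixes in place of metric balls\<close>

definition occ :: "(nat \<Rightarrow> nat) \<Rightarrow> (nat \<Rightarrow> nat) \<Rightarrow> nat \<Rightarrow> nat set" where
  "occ x y L = {n. n \<ge> 1 \<and> (\<forall>i<L. x (n + i) = y i)}"

lemma Nset_subset_occ: "Nset x (sball k y (1 / 2 ^ L)) \<subseteq> occ x y L"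
proof
  fix n assume "n \<in> Nset x (sball k y (1 / 2 ^ L))"
  then have n: "n \<ge> 1" "sdist y (\<lambda>i. x (n + i)) < 1 / 2 ^ L"
    by (auto simp: Nset_def sball_def shift_funpow)
  show "n \<in> occ x y L"
    using n(1) agree_of_sdist_less[OF n(2)] by (auto simp: occ_def)
qed

lemma occ_subset_Nset:
  assumes "x \<in> Sigma_k k" "1 / 2 ^ L < e"
  shows "occ x y L \<subseteq> Nset x (sball k y e)"
proof
  fix n assume n: "n \<in> occ x y L"
  then have "sdist y (\<lambda>i. x (n + i)) \<le> 1 / 2 ^ L"
    by (intro sdist_le_of_agree) (auto simp: occ_def)
  with n assms show "n \<in> Nset x (sball k y e)"
    by (auto simp: Nset_def sball_def shift_funpow occ_def shift_funpow_Sigma)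
qed

text \<open>Balls and cylinders are nested in each other, so monotonicity of \<open>\<xi>\<close> is
  all that is used. The value type is left open because the asymptotic densities are extended reals
  while the Banach densities are reals.\<close>

lemma pos_Nset_iff_pos_occ:
  fixes \<xi> :: "nat set \<Rightarrow> 'b::{linorder,zero}"
  assumes "x \<in> Sigma_k k" and mono: "\<And>S T. S \<subseteq> T \<Longrightarrow> \<xi> S \<le> \<xi> T"
  shows "(\<forall>e>0. 0 < \<xi> (Nset x (sball k y e))) \<longleftrightarrow> (\<forall>L. 0 < \<xi> (occ x y L))"
proof safe
  fix L assume *: "\<forall>e>0. 0 < \<xi> (Nset x (sball k y e))"
  then have "0 < \<xi> (Nset x (sball k y (1 / 2 ^ L)))" by simp
  then show "0 < \<xi> (occ x y L)" using mono[OF Nset_subset_occ] by (rule less_le_trans)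
next
  fix e :: real assume *: "\<forall>L. 0 < \<xi> (occ x y L)" and "0 < e"
  then obtain L where "1 / 2 ^ L < e" using ex_half_pow_less by blast
  then show "0 < \<xi> (Nset x (sball k y e))"
    using * mono[OF occ_subset_Nset[OF assms(1)]] less_le_trans by blast
qed

section \<open>Banach densities in epsilon-N form and comparison of the four densities\<close>

lemma window_ratio_le_1: "real (card (S \<inter> {m..<m + n})) / real n \<le> 1"
proof -
  have "card (S \<inter> {m..<m + n}) \<le> card {m..<m + n}" by (rule card_mono) auto
  then show ?thesis by (auto simp: divide_le_eq)
qed

text \<open>Infima and suprema of reals are meaningful only for bounded families. The ratios lie
  between 0 and 1; this lemma and its three companions settle that, so that later arguments only
  handle thresholds and window lengths.\<close>

lemma banach_upper_lessD:
  fixes c :: real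
  assumes "banach_upper S < c"
  shows "\<exists>N. \<forall>m\<ge>1. \<forall>n\<ge>max N 1. card (S \<inter> {m..<m + n}) \<le> c * n"
proof -
  let ?r = "\<lambda>p. real (card (S \<inter> {fst p..<fst p + snd p})) / real (snd p)"
  have r1: "?r p \<le> 1" for p by (rule window_ratio_le_1)
  have bdd: "bdd_above (?r ` A)" for A using r1 by (intro bdd_aboveI2[where M = 1]) auto
  have b0: "0 \<le> (SUP p\<in>{(m, n). m \<ge> 1 \<and> n \<ge> max N 1}. ?r p)" for N
    by (rule cSUP_upper2[OF bdd, of "(1, max N 1)"]) auto
  have "bdd_below (range (\<lambda>N. SUP p\<in>{(m, n). m \<ge> 1 \<and> n \<ge> max N 1}. ?r p))"
    using b0 by (intro bdd_belowI2[where m = 0]) auto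
  with assms obtain N where N: "(SUP p\<in>{(m, n). m \<ge> 1 \<and> n \<ge> max N 1}. ?r p) < c"
    unfolding banach_upper_def by (subst (asm) cINF_less_iff) auto
  have "card (S \<inter> {m..<m + n}) \<le> c * n" if "m \<ge> 1" "n \<ge> max N 1" for m n
  proof -
    have "?r (m, n) \<le> (SUP p\<in>{(m, n). m \<ge> 1 \<and> n \<ge> max N 1}. ?r p)"
      by (rule cSUP_upper[OF _ bdd]) (use that in auto)
    with N have "?r (m, n) < c" by linarith
    then show ?thesis using that by (auto simp: divide_less_eq)
  qed
  then show ?thesis by blast
qed

lemma banach_upper_leI:
  fixes c :: real
  assumes "\<And>m n. m \<ge> 1 \<Longrightarrow> n \<ge> max N 1 \<Longrightarrow> card (S \<inter> {m..<m + n}) \<le> c * n"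
  shows "banach_upper S \<le> c"
proof -
  let ?r = "\<lambda>p. real (card (S \<inter> {fst p..<fst p + snd p})) / real (snd p)"
  have r1: "?r p \<le> 1" for p by (rule window_ratio_le_1)
  have bdd: "bdd_above (?r ` A)" for A using r1 by (intro bdd_aboveI2[where M = 1]) auto
  have b0: "0 \<le> (SUP p\<in>{(m, n). m \<ge> 1 \<and> n \<ge> max N 1}. ?r p)" for N
    by (rule cSUP_upper2[OF bdd, of "(1, max N 1)"]) auto
  have "bdd_below (range (\<lambda>N. SUP p\<in>{(m, n). m \<ge> 1 \<and> n \<ge> max N 1}. ?r p))"
    using b0 by (intro bdd_belowI2[where m = 0]) auto
  then have "banach_upper S \<le> (SUP p\<in>{(m, n). m \<ge> 1 \<and> n \<ge> max N 1}. ?r p)"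
    unfolding banach_upper_def by (rule cINF_lower) auto
  also have "\<dots> \<le> c"
  proof (rule cSUP_least)
    have "(1, max N 1) \<in> {(m::nat, n). m \<ge> 1 \<and> n \<ge> max N 1}" by auto
    then show "{(m::nat, n). m \<ge> 1 \<and> n \<ge> max N 1} \<noteq> {}" by blast
    show "?r p \<le> c" if "p \<in> {(m, n). m \<ge> 1 \<and> n \<ge> max N 1}" for p
      using that assms[of "fst p" "snd p"] by (auto simp: divide_le_eq)
  qed
  finally show ?thesis .
qed

lemma banach_lower_lessD:
  fixes c :: real
  assumes "c < banach_lower S"
  shows "\<exists>N. \<forall>m\<ge>1. \<forall>n\<ge>max N 1. c * n \<le> card (S \<inter> {m..<m + n})"
proof -
  let ?r = "\<lambda>p. real (card (S \<inter> {fst p..<fst p + snd p})) / real (snd p)"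
  have r1: "?r p \<le> 1" for p by (rule window_ratio_le_1)
  have bdd: "bdd_below (?r ` A)" for A by (intro bdd_belowI2[where m = 0]) auto
  have b0: "(INF p\<in>{(m, n). m \<ge> 1 \<and> n \<ge> max N 1}. ?r p) \<le> 1" for N
    by (rule cINF_lower2[OF bdd, of "(1, max N 1)"]) (use r1[of "(1, max N 1)"] in auto)
  have "bdd_above (range (\<lambda>N. INF p\<in>{(m, n). m \<ge> 1 \<and> n \<ge> max N 1}. ?r p))"
    using b0 by (intro bdd_aboveI2[where M = 1]) auto
  with assms obtain N where N: "c < (INF p\<in>{(m, n). m \<ge> 1 \<and> n \<ge> max N 1}. ?r p)"
    unfolding banach_lower_def by (subst (asm) less_cSUP_iff) auto
  have "c * n \<le> card (S \<inter> {m..<m + n})" if "m \<ge> 1" "n \<ge> max N 1" for m n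
  proof -
    have "(INF p\<in>{(m, n). m \<ge> 1 \<and> n \<ge> max N 1}. ?r p) \<le> ?r (m, n)"
      by (rule cINF_lower[OF bdd]) (use that in auto)
    with N have "c < ?r (m, n)" by linarith
    then show ?thesis using that by (auto simp: less_divide_eq)
  qed
  then show ?thesis by blast
qed

lemma banach_lower_geI:
  fixes c :: real
  assumes "\<And>m n. m \<ge> 1 \<Longrightarrow> n \<ge> max N 1 \<Longrightarrow> c * n \<le> card (S \<inter> {m..<m + n})"
  shows "c \<le> banach_lower S"
proof -
  let ?r = "\<lambda>p. real (card (S \<inter> {fst p..<fst p + snd p})) / real (snd p)"
  have r1: "?r p \<le> 1" for p by (rule window_ratio_le_1)
  have bdd: "bdd_below (?r ` A)" for A by (intro bdd_belowI2[where m = 0]) auto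
  have b0: "(INF p\<in>{(m, n). m \<ge> 1 \<and> n \<ge> max N 1}. ?r p) \<le> 1" for N
    by (rule cINF_lower2[OF bdd, of "(1, max N 1)"]) (use r1[of "(1, max N 1)"] in auto)
  have "bdd_above (range (\<lambda>N. INF p\<in>{(m, n). m \<ge> 1 \<and> n \<ge> max N 1}. ?r p))"
    using b0 by (intro bdd_aboveI2[where M = 1]) auto
  then have "(INF p\<in>{(m, n). m \<ge> 1 \<and> n \<ge> max N 1}. ?r p) \<le> banach_lower S"
    unfolding banach_lower_def by (intro cSUP_upper) auto
  moreover have "c \<le> (INF p\<in>{(m, n). m \<ge> 1 \<and> n \<ge> max N 1}. ?r p)"
  proof (rule cINF_greatest)
    have "(1, max N 1) \<in> {(m::nat, n). m \<ge> 1 \<and> n \<ge> max N 1}" by auto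
    then show "{(m::nat, n). m \<ge> 1 \<and> n \<ge> max N 1} \<noteq> {}" by blast
    show "c \<le> ?r p" if "p \<in> {(m, n). m \<ge> 1 \<and> n \<ge> max N 1}" for p
      using that assms[of "fst p" "snd p"] by (auto simp: le_divide_eq)
  qed
  ultimately show ?thesis by linarith
qed

lemma card_window_mono: "S \<subseteq> T \<Longrightarrow> card (S \<inter> {m..<m + n}) \<le> card (T \<inter> {m..<m + n :: nat})"
  by (rule card_mono) auto

lemma banach_upper_mono:
  assumes "S \<subseteq> T" shows "banach_upper S \<le> banach_upper T"
proof (rule dense_ge)
  fix c assume "banach_upper T < c"
  then obtain N where N: "\<forall>m\<ge>1. \<forall>n\<ge>max N 1. card (T \<inter> {m..<m + n}) \<le> c * n"
    using banach_upper_lessD by blast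
  show "banach_upper S \<le> c"
  proof (rule banach_upper_leI)
    fix m n assume "m \<ge> (1::nat)" "n \<ge> max N 1"
    then have "card (T \<inter> {m..<m + n}) \<le> c * n" using N by blast
    then show "card (S \<inter> {m..<m + n}) \<le> c * n"
      using card_window_mono[OF assms, of m n] by linarith
  qed
qed

lemma banach_lower_mono:
  assumes "S \<subseteq> T" shows "banach_lower S \<le> banach_lower T"
proof (rule dense_le)
  fix c assume "c < banach_lower S"
  then obtain N where N: "\<forall>m\<ge>1. \<forall>n\<ge>max N 1. c * n \<le> card (S \<inter> {m..<m + n})"
    using banach_lower_lessD by blast
  show "c \<le> banach_lower T"
  proof (rule banach_lower_geI)
    fix m n assume "m \<ge> (1::nat)" "n \<ge> max N 1"
    then have "c * n \<le> card (S \<inter> {m..<m + n})" using N by blast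
    then show "c * n \<le> card (T \<inter> {m..<m + n})"
      using card_window_mono[OF assms, of m n] by linarith
  qed
qed

lemma upper_dens_mono: "S \<subseteq> T \<Longrightarrow> upper_dens S \<le> upper_dens T"
  unfolding upper_dens_def
  by (intro Limsup_mono always_eventually allI)
     (auto intro!: divide_right_mono card_mono)

lemma lower_dens_mono: "S \<subseteq> T \<Longrightarrow> lower_dens S \<le> lower_dens T"
  unfolding lower_dens_def
  by (intro Liminf_mono always_eventually allI)
     (auto intro!: divide_right_mono card_mono)

lemma lower_dens_le_upper_dens: "lower_dens S \<le> upper_dens S"
  unfolding lower_dens_def upper_dens_def by (rule Liminf_le_Limsup) simp

lemma upper_dens_le_banach_upper: "upper_dens S \<le> ereal (banach_upper S)"
proof (rule ereal_le_epsilon2)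
  fix e :: real assume "0 < e"
  then obtain N where N: "\<forall>m\<ge>1. \<forall>n\<ge>max N 1. card (S \<inter> {m..<m + n}) \<le> (banach_upper S + e) * n"
    using banach_upper_lessD[of S "banach_upper S + e"] by auto
  have "upper_dens S \<le> ereal (banach_upper S + e)" unfolding upper_dens_def
  proof (rule Limsup_bounded, rule eventually_sequentiallyI[of "max N 1"])
    fix n assume n: "max N 1 \<le> n"
    then have "card (S \<inter> {1..<1 + n}) \<le> (banach_upper S + e) * n" using N by blast
    moreover have "{1..<1 + n} = {1..n}" by auto
    ultimately show "ereal (card (S \<inter> {1..n}) / n) \<le> ereal (banach_upper S + e)"
      using n by (simp add: divide_le_eq)
  qed
  then show "upper_dens S \<le> ereal (banach_upper S) + ereal e" by simp
qed

lemma banach_lower_le_lower_dens: "ereal (banach_lower S) \<le> lower_dens S"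
proof (rule ereal_le_epsilon2)
  fix e :: real assume "0 < e"
  then obtain N where N: "\<forall>m\<ge>1. \<forall>n\<ge>max N 1. (banach_lower S - e) * n \<le> card (S \<inter> {m..<m + n})"
    using banach_lower_lessD[of "banach_lower S - e" S] by auto
  have "ereal (banach_lower S - e) \<le> lower_dens S"
    unfolding lower_dens_def
  proof (rule Liminf_bounded, rule eventually_sequentiallyI[of "max N 1"])
    fix n assume n: "max N 1 \<le> n"
    then have "(banach_lower S - e) * n \<le> card (S \<inter> {1..<1 + n})" using N by blast
    moreover have "{1..<1 + n} = {1..n}" by auto
    ultimately show "ereal (banach_lower S - e) \<le> ereal (card (S \<inter> {1..n}) / n)"
      using n by (simp add: le_divide_eq)
  qed
  then have "ereal (banach_lower S - e) + ereal e \<le> lower_dens S + ereal e"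
    by (rule add_right_mono)
  then show "ereal (banach_lower S) \<le> lower_dens S + ereal e" by simp
qed

text \<open>\<open>K\<close> does not depend on the position \<open>m\<close> of the window, so it
  is absorbed once the window is long; half of \<open>c\<close> is reserved for that.\<close>

lemma banach_upper_le_0I:
  assumes "\<And>\<epsilon>::real. \<epsilon> > 0 \<Longrightarrow> \<exists>K. \<forall>m n. card (S \<inter> {m..<m + n}) \<le> \<epsilon> * n + K"
  shows "banach_upper S \<le> 0"
proof (rule dense_ge)
  fix c :: real assume c: "0 < c"
  then obtain K where K: "\<And>m n. card (S \<inter> {m..<m + n}) \<le> c / 2 * n + K"
    using assms[of "c / 2"] by auto
  obtain N where N: "K / (c / 2) \<le> real N" using real_arch_simple by blast
  show "banach_upper S \<le> c"
  proof (rule banach_upper_leI)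
    fix m n assume n: "n \<ge> max N 1"
    then have "K / (c / 2) \<le> real n" using N by linarith
    then have "K \<le> c / 2 * n" using c by (simp add: field_simps)
    then show "card (S \<inter> {m..<m + n}) \<le> c * n" using K[of m n] by (simp add: field_simps)
  qed
qed

lemma infinite_of_banach_upper_pos:
  assumes "0 < banach_upper S" shows "infinite S"
proof
  assume fin: "finite S"
  have "real (card (S \<inter> {m..<m + n})) \<le> \<epsilon> * n + card S" if "\<epsilon> > 0" for \<epsilon> :: real and m n
  proof -
    have "card (S \<inter> {m..<m + n}) \<le> card S" by (rule card_mono[OF fin]) auto
    then show ?thesis using that by (simp add: add_increasing)
  qed
  then have "banach_upper S \<le> 0"
    by (intro banach_upper_le_0I exI[of _ "real (card S)"] allI)
  with assms show False by simp
qed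

lemma omega_ud_iff: "x \<in> Sigma_k k \<Longrightarrow> y \<in> omega_ud k x \<longleftrightarrow> y \<in> Sigma_k k \<and> (\<forall>L. 0 < upper_dens (occ x y L))"
  using pos_Nset_iff_pos_occ[where \<xi> = upper_dens, OF _ upper_dens_mono, of x k y] by (simp add: omega_ud_def)

lemma omega_ld_iff: "x \<in> Sigma_k k \<Longrightarrow> y \<in> omega_ld k x \<longleftrightarrow> y \<in> Sigma_k k \<and> (\<forall>L. 0 < lower_dens (occ x y L))"
  using pos_Nset_iff_pos_occ[where \<xi> = lower_dens, OF _ lower_dens_mono, of x k y] by (simp add: omega_ld_def)

lemma omega_Bu_iff: "x \<in> Sigma_k k \<Longrightarrow> y \<in> omega_Bu k x \<longleftrightarrow> y \<in> Sigma_k k \<and> (\<forall>L. 0 < banach_upper (occ x y L))"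
  using pos_Nset_iff_pos_occ[where \<xi> = banach_upper, OF _ banach_upper_mono, of x k y] by (simp add: omega_Bu_def)

lemma omega_Bl_iff: "x \<in> Sigma_k k \<Longrightarrow> y \<in> omega_Bl k x \<longleftrightarrow> y \<in> Sigma_k k \<and> (\<forall>L. 0 < banach_lower (occ x y L))"
  using pos_Nset_iff_pos_occ[where \<xi> = banach_lower, OF _ banach_lower_mono, of x k y] by (simp add: omega_Bl_def)

lemma BR_iff: "x \<in> BR k \<longleftrightarrow> x \<in> Sigma_k k \<and> x \<in> omega_Bu k x"
  by (auto simp: BR_def omega_Bu_def)

lemma omega_Bl_subset_ld: "omega_Bl k x \<subseteq> omega_ld k x"
proof
  fix y assume y: "y \<in> omega_Bl k x"
  have "0 < lower_dens (Nset x (sball k y e))" if "0 < e" for e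
  proof -
    have "0 < ereal (banach_lower (Nset x (sball k y e)))"
      using y that by (simp add: omega_Bl_def)
    then show ?thesis using banach_lower_le_lower_dens by (rule less_le_trans)
  qed
  then show "y \<in> omega_ld k x" using y by (simp add: omega_ld_def omega_Bl_def)
qed

lemma omega_ld_subset_ud: "omega_ld k x \<subseteq> omega_ud k x"
proof
  fix y assume y: "y \<in> omega_ld k x"
  have "0 < upper_dens (Nset x (sball k y e))" if "0 < e" for e
    using y that lower_dens_le_upper_dens[of "Nset x (sball k y e)"] less_le_trans
    unfolding omega_ld_def by blast
  then show "y \<in> omega_ud k x" using y by (simp add: omega_ud_def omega_ld_def)
qed

lemma omega_ud_subset_Bu: "omega_ud k x \<subseteq> omega_Bu k x"
proof
  fix y assume y: "y \<in> omega_ud k x"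
  have "0 < banach_upper (Nset x (sball k y e))" if "0 < e" for e
  proof -
    have "0 < upper_dens (Nset x (sball k y e))" using y that by (simp add: omega_ud_def)
    then have "0 < ereal (banach_upper (Nset x (sball k y e)))"
      using upper_dens_le_banach_upper by (rule less_le_trans)
    then show ?thesis by simp
  qed
  then show "y \<in> omega_Bu k x" using y by (simp add: omega_Bu_def omega_ud_def)
qed

lemma omega_lim_iff:
  assumes "x \<in> Sigma_k k"
  shows "y \<in> omega_lim k x \<longleftrightarrow> y \<in> Sigma_k k \<and> (\<forall>L. infinite (occ x y L))"
proof safe
  assume y: "y \<in> omega_lim k x"
  then show "y \<in> Sigma_k k" by (simp add: omega_lim_def)
  fix L assume fin: "finite (occ x y L)"
  then obtain N where N: "\<And>n. n \<in> occ x y L \<Longrightarrow> n \<le> N" by (meson finite_nat_set_iff_bounded_le)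
  have "(1::real) / 2 ^ L > 0" by simp
  then obtain n where n: "n \<ge> Suc N" "sdist ((shift ^^ n) x) y < 1 / 2 ^ L"
    using y unfolding omega_lim_def by blast
  then have "n \<in> occ x y L"
    using agree_of_sdist_less[OF n(2)] by (auto simp: occ_def shift_funpow)
  then show False using N n by fastforce
next
  assume y: "y \<in> Sigma_k k" "\<forall>L. infinite (occ x y L)"
  show "y \<in> omega_lim k x" unfolding omega_lim_def
  proof (intro CollectI conjI y(1) allI impI)
    fix e :: real and N :: nat assume "e > 0"
    then obtain L where L: "1 / 2 ^ L < e" using ex_half_pow_less by blast
    obtain n where n: "n \<in> occ x y L" "n \<ge> N"
      using y(2) by (meson infinite_nat_iff_unbounded_le)
    then have "sdist ((shift ^^ n) x) y \<le> 1 / 2 ^ L"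
      by (intro sdist_le_of_agree) (auto simp: occ_def shift_funpow)
    with n L show "\<exists>n\<ge>N. sdist ((shift ^^ n) x) y < e" by force
  qed
qed

lemma omega_Bu_subset_lim: "x \<in> Sigma_k k \<Longrightarrow> omega_Bu k x \<subseteq> omega_lim k x"
  using infinite_of_banach_upper_pos by (auto simp: omega_Bu_iff omega_lim_iff)

lemma Rec_iff: "x \<in> Rec k \<longleftrightarrow> x \<in> Sigma_k k \<and> (\<forall>L. occ x x L \<noteq> {})"
proof safe
  assume x: "x \<in> Rec k"
  then show "x \<in> Sigma_k k" by (simp add: Rec_def)
  fix L assume e: "occ x x L = {}"
  have "Nset x (sball k x (1 / 2 ^ L)) \<noteq> {}" using x by (simp add: Rec_def)
  then show False using e Nset_subset_occ[of x k x L] by auto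
next
  assume x: "x \<in> Sigma_k k" "\<forall>L. occ x x L \<noteq> {}"
  show "x \<in> Rec k" unfolding Rec_def
  proof (intro CollectI conjI x(1) allI impI)
    fix e :: real assume "e > 0"
    then obtain L where L: "1 / 2 ^ L < e" using ex_half_pow_less by blast
    then show "Nset x (sball k x e) \<noteq> {}" using occ_subset_Nset[OF x(1) L, of x] x(2) by blast
  qed
qed

subsection \<open>Square blocks and epochs\<close>

lemma floor_sqrt_eq_iff: "floor_sqrt j = m \<longleftrightarrow> j \<in> {m\<^sup>2..<(Suc m)\<^sup>2}"
  using floor_sqrt_unique[of m j] floor_sqrt_power2_le[of j] Suc_floor_sqrt_power2_gt[of j] by auto

lemma card_sqrt_block: "card {m\<^sup>2..<(Suc m)\<^sup>2} = 2 * m + 1"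
  by (simp add: power2_eq_square)

lemma lessThan_square_UN: "{..<r\<^sup>2} = (\<Union>m<r. {m\<^sup>2..<(Suc m)\<^sup>2})"
proof safe
  fix j :: nat assume j: "j < r\<^sup>2"
  have "floor_sqrt j < r"
    using j floor_sqrt_power2_le[of j] by (meson le_less_trans not_less power_mono zero_le)
  moreover have "j \<in> {(floor_sqrt j)\<^sup>2..<(Suc (floor_sqrt j))\<^sup>2}"
    using floor_sqrt_eq_iff by blast
  ultimately show "j \<in> (\<Union>m<r. {m\<^sup>2..<(Suc m)\<^sup>2})" by blast
next
  fix m j assume "m < r" "j \<in> {m\<^sup>2..<(Suc m)\<^sup>2}"
  moreover have "(Suc m)\<^sup>2 \<le> r\<^sup>2" using \<open>m < r\<close> by (intro power_mono) auto
  ultimately show "j < r\<^sup>2" by (meson atLeastLessThan_iff less_le_trans)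
qed

lemma disjoint_sqrt_blocks: "m \<noteq> m' \<Longrightarrow> {m\<^sup>2..<(Suc m)\<^sup>2} \<inter> {m'\<^sup>2..<(Suc m')\<^sup>2} = {}"
  unfolding disjoint_iff floor_sqrt_eq_iff[symmetric] by blast

lemma sum_sqrt_blocks:
  fixes f :: "nat \<Rightarrow> 'a::comm_monoid_add"
  shows "(\<Sum>j<r\<^sup>2. f j) = (\<Sum>m<r. \<Sum>j\<in>{m\<^sup>2..<(Suc m)\<^sup>2}. f j)"
  unfolding lessThan_square_UN
  by (rule sum.UNION_disjoint) (simp, simp, intro ballI impI disjoint_sqrt_blocks)

lemma sum_sqrt_blocks':
  fixes f :: "nat \<Rightarrow> 'a::comm_monoid_add"
  shows "(\<Sum>j<N. f j) =
    (\<Sum>m<floor_sqrt N. \<Sum>j\<in>{m\<^sup>2..<(Suc m)\<^sup>2}. f j) + (\<Sum>j\<in>{(floor_sqrt N)\<^sup>2..<N}. f j)"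
proof -
  have "{..<N} = {..<(floor_sqrt N)\<^sup>2} \<union> {(floor_sqrt N)\<^sup>2..<N}"
    using floor_sqrt_power2_le[of N] le_less_trans by (auto simp: not_less intro: less_le_trans)
  then show ?thesis by (simp add: sum.union_disjoint ivl_disj_int sum_sqrt_blocks[symmetric])
qed

text \<open>A geometric series: the last block dominates. Blocks with a power of two as index thus
  cover only O(sqrt N) of the first N positions. The indices \<open>4 ^ n\<close> (copies) and
  \<open>2 * 4 ^ n\<close> (sparse orbit) are all of this kind, so density arguments may discard
  both at once.\<close>

lemma sum_two_powers_le: "(\<Sum>m | m < r \<and> m \<in> range ((^) 2). 2 * m + 1) \<le> 6 * (r::nat)"
proof (cases "r = 0")
  case False
  define S where "S = floor_log r"
  have sub: "{m. m < r \<and> m \<in> range ((^) 2)} \<subseteq> (^) 2 ` {..S}"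
  proof safe
    fix s :: nat assume "2 ^ s < r"
    then have "floor_log (2 ^ s) \<le> S" unfolding S_def by (intro floor_log_le_iff) auto
    then show "2 ^ s \<in> (^) 2 ` {..S}" by auto
  qed
  have "(\<Sum>m | m < r \<and> m \<in> range ((^) 2). 2 * m + 1) \<le> (\<Sum>m\<in>(^) 2 ` {..S}. 2 * m + 1)"
    using sub by (intro sum_mono2) auto
  also have "\<dots> = (\<Sum>s\<le>S. 2 * 2 ^ s + 1)"
    by (subst sum.reindex) (auto simp: inj_on_def)
  also have "\<dots> \<le> (\<Sum>s\<le>S. 3 * 2 ^ s)" by (intro sum_mono) auto
  also have "\<dots> = 3 * (\<Sum>s\<le>S. 2 ^ s)" by (simp add: sum_distrib_left)
  also have "(\<Sum>s\<le>S. 2 ^ s) = 2 ^ Suc S - (1::nat)"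
    using sum_power2[of "Suc S"] by (simp add: lessThan_Suc_atMost atLeast0LessThan)
  also have "3 * (2 ^ Suc S - 1) \<le> 6 * (2 ^ S :: nat)" by simp
  also have "\<dots> \<le> 6 * r" using floor_log_exp2_le[of r] False by (simp add: S_def)
  finally show ?thesis .
qed simp

text \<open>A window of length n meets at most about sqrt n blocks wherever it lies, because blocks
  only get longer to the right. The bound being independent of the position is what Banach density
  needs.\<close>

lemma card_Int_le_of_blocks:
  assumes K: "\<And>m. card (B \<inter> {m\<^sup>2..<(Suc m)\<^sup>2}) \<le> K" and "a \<le> b"
  shows "card (B \<inter> {a..<b}) \<le> K * (sqrt (b - a) + 2)"
proof -
  define u v where "u = floor_sqrt a" and "v = floor_sqrt b"
  have uv: "u \<le> v" unfolding u_def v_def using assms(2) by (rule mono_floor_sqrt')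
  have u: "a < (Suc u)\<^sup>2" and v: "v\<^sup>2 \<le> b" unfolding u_def v_def
    by (simp_all add: Suc_floor_sqrt_power2_gt)
  have "B \<inter> {a..<b} \<subseteq> (\<Union>m\<in>{u..v}. B \<inter> {m\<^sup>2..<(Suc m)\<^sup>2})"
  proof
    fix j assume j: "j \<in> B \<inter> {a..<b}"
    then have "floor_sqrt j \<in> {u..v}" by (auto simp: u_def v_def intro: mono_floor_sqrt')
    moreover have "j \<in> {(floor_sqrt j)\<^sup>2..<(Suc (floor_sqrt j))\<^sup>2}"
      using floor_sqrt_eq_iff by blast
    ultimately show "j \<in> (\<Union>m\<in>{u..v}. B \<inter> {m\<^sup>2..<(Suc m)\<^sup>2})" using j by blast
  qed
  then have "card (B \<inter> {a..<b}) \<le> card (\<Union>m\<in>{u..v}. B \<inter> {m\<^sup>2..<(Suc m)\<^sup>2})"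
    by (intro card_mono) auto
  also have "\<dots> \<le> (\<Sum>m\<in>{u..v}. card (B \<inter> {m\<^sup>2..<(Suc m)\<^sup>2}))" by (rule card_UN_le) simp
  also have "\<dots> \<le> (\<Sum>m\<in>{u..v}. K)" by (intro sum_mono K)
  also have "\<dots> = K * (v - u + 1)" using uv by (simp add: Suc_diff_le)
  finally have 1: "card (B \<inter> {a..<b}) \<le> K * (v - u + 1)" .
  have "real (v - u) \<le> sqrt (b - a) + 1"
  proof (cases "v \<le> Suc u")
    case True
    then have "real (v - u) \<le> 1" by auto
    then show ?thesis by (smt (verit) of_nat_0_le_iff real_sqrt_ge_zero)
  next
    case False
    then obtain d where d: "v = Suc u + d" by (metis le_add_diff_inverse nat_le_linear)
    \<comment> \<open>The \<open>d\<close> blocks from \<open>Suc u\<close> up to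
      \<open>v - 1\<close> lie inside the window, and their lengths are at least the first
      \<open>d\<close> odd numbers, whose sum is the square of \<open>d\<close>.\<close>
    have "(Suc u)\<^sup>2 + d\<^sup>2 \<le> v\<^sup>2" unfolding d by (simp add: power2_eq_square algebra_simps)
    then have "d\<^sup>2 \<le> b - a" using u v by linarith
    then have "real d \<le> sqrt (b - a)"
      by (intro real_le_rsqrt) (metis of_nat_le_iff of_nat_power)
    then show ?thesis using d by simp
  qed
  then have "real K * (real (v - u) + 1) \<le> K * (sqrt (b - a) + 2)"
    by (intro mult_left_mono) auto
  moreover have "real (card (B \<inter> {a..<b})) \<le> real K * (real (v - u) + 1)"
    using 1 by (metis of_nat_1 of_nat_add of_nat_le_iff of_nat_mult)
  ultimately show ?thesis using assms(2) by (simp add: of_nat_diff)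
qed

lemma card_two_power_blocks_le:
  fixes N :: nat
  shows
  "card {j. j < N \<and> floor_sqrt j \<in> range ((^) 2)} \<le> 6 * (sqrt N + 1)"
proof -
  define r where "r = Suc (floor_sqrt N)"
  let ?A = "{m. m < r \<and> m \<in> range ((^) 2)}"
  have "{j. j < N \<and> floor_sqrt j \<in> range ((^) 2)} \<subseteq> (\<Union>m\<in>?A. {m\<^sup>2..<(Suc m)\<^sup>2})"
  proof safe
    fix j s assume j: "j < N" "floor_sqrt j = 2 ^ s"
    then have "floor_sqrt j < r" using mono_floor_sqrt'[of j N] by (simp add: r_def)
    moreover have "j \<in> {(floor_sqrt j)\<^sup>2..<(Suc (floor_sqrt j))\<^sup>2}"
      using floor_sqrt_eq_iff by blast
    ultimately show "j \<in> (\<Union>m\<in>?A. {m\<^sup>2..<(Suc m)\<^sup>2})" using j by (intro UN_I[of "2 ^ s"]) auto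
  qed
  then have "card {j. j < N \<and> floor_sqrt j \<in> range ((^) 2)} \<le> card (\<Union>m\<in>?A. {m\<^sup>2..<(Suc m)\<^sup>2})"
    by (intro card_mono) auto
  also have "\<dots> \<le> (\<Sum>m\<in>?A. card {m\<^sup>2..<(Suc m)\<^sup>2})" by (rule card_UN_le) simp
  also have "\<dots> = (\<Sum>m\<in>?A. 2 * m + 1)" unfolding card_sqrt_block ..
  also have "\<dots> \<le> 6 * r" by (rule sum_two_powers_le)
  finally have "real (card {j. j < N \<and> floor_sqrt j \<in> range ((^) 2)}) \<le> 6 * r"
    by (metis of_nat_le_iff of_nat_mult of_nat_numeral)
  moreover have "real (floor_sqrt N) \<le> sqrt N"
    by (intro real_le_rsqrt) (metis floor_sqrt_power2_le of_nat_le_iff of_nat_power)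
  ultimately show ?thesis by (simp add: r_def)
qed

section \<open>Cesaro averages of sequences controlled block by block\<close>

definition avg :: "(nat \<Rightarrow> real) \<Rightarrow> nat \<Rightarrow> real" where
  "avg s n = (\<Sum>j<n. s j) / real n"

text \<open>Three contributions escape the block hypothesis: finitely many initial blocks
  (constant), the power-of-two blocks and the unfinished last block (both of order sqrt N). All
  vanish after division by N.\<close>

lemma avg_tendsto_0_of_blocks:
  assumes B: "\<And>j. \<bar>s j\<bar> \<le> B"
    and blk: "\<And>\<epsilon>::real. \<epsilon> > 0 \<Longrightarrow> \<exists>M. \<forall>m\<ge>M. m \<notin> range ((^) 2) \<longrightarrow>
      \<bar>\<Sum>j\<in>{m\<^sup>2..<(Suc m)\<^sup>2}. s j\<bar> \<le> \<epsilon> * (2 * real m + 1)"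
  shows "avg s \<longlonglongrightarrow> 0"
proof (rule LIMSEQ_I)
  fix \<epsilon> :: real assume e: "\<epsilon> > 0"
  have B0: "0 \<le> B" using B[of 0] by linarith
  obtain M where M: "\<And>m. m \<ge> M \<Longrightarrow> m \<notin> range ((^) 2) \<Longrightarrow>
      \<bar>\<Sum>j\<in>{m\<^sup>2..<(Suc m)\<^sup>2}. s j\<bar> \<le> \<epsilon> / 2 * (2 * real m + 1)"
    using blk[OF half_gt_zero[OF e]] by blast
  have absb: "\<bar>\<Sum>j\<in>A. s j\<bar> \<le> B * card A" for A
    by (rule order_trans[OF sum_abs]) (use sum_bounded_above[of A "\<lambda>j. \<bar>s j\<bar>" B] B in \<open>simp add: mult.commute\<close>)
  have blockb: "\<bar>\<Sum>j\<in>{m\<^sup>2..<(Suc m)\<^sup>2}. s j\<bar> \<le> \<epsilon> / 2 * (2 * real m + 1) +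
      ((if m < M then B * (2 * real m + 1) else 0) + (if m \<in> range ((^) 2) then B * (2 * real m + 1) else 0))" for m
  proof -
    have "\<bar>\<Sum>j\<in>{m\<^sup>2..<(Suc m)\<^sup>2}. s j\<bar> \<le> B * (2 * real m + 1)"
      using absb[of "{m\<^sup>2..<(Suc m)\<^sup>2}"] by (simp only: card_sqrt_block) (simp add: add.commute)
    moreover have "0 \<le> \<epsilon> / 2 * (2 * real m + 1)" "0 \<le> B * (2 * real m + 1)" using e B0 by auto
    ultimately show ?thesis using M[of m] by (auto simp: not_less)
  qed
  have sq: "(\<Sum>m<r. 2 * real m + 1) = (real r)\<^sup>2" for r
    by (induction r) (auto simp: power2_eq_square algebra_simps)
  have bound: "\<bar>\<Sum>j<N. s j\<bar> \<le> \<epsilon> / 2 * N + B * (real M)\<^sup>2 + B * (8 * sqrt N + 1)" for N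
  proof -
    define r where "r = floor_sqrt N"
    have rN: "real r \<le> sqrt N" unfolding r_def
      by (intro real_le_rsqrt) (metis floor_sqrt_power2_le of_nat_le_iff of_nat_power)
    then have rN2: "(real r)\<^sup>2 \<le> N" by (metis floor_sqrt_power2_le of_nat_le_iff of_nat_power r_def)
    have "\<bar>\<Sum>j<N. s j\<bar> \<le> (\<Sum>m<r. \<bar>\<Sum>j\<in>{m\<^sup>2..<(Suc m)\<^sup>2}. s j\<bar>) + \<bar>\<Sum>j\<in>{r\<^sup>2..<N}. s j\<bar>"
      unfolding sum_sqrt_blocks'[of s N] r_def[symmetric]
      using sum_abs[of "\<lambda>m. \<Sum>j\<in>{m\<^sup>2..<(Suc m)\<^sup>2}. s j" "{..<r}"] by linarith
    also have "\<bar>\<Sum>j\<in>{r\<^sup>2..<N}. s j\<bar> \<le> B * (2 * sqrt N + 1)"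
    proof -
      have "N - r\<^sup>2 \<le> 2 * r + 1"
        using Suc_floor_sqrt_power2_gt[of N] unfolding r_def[symmetric]
        by (simp add: power2_eq_square)
      then have "real (N - r\<^sup>2) \<le> 2 * sqrt N + 1" using rN by linarith
      then have "B * real (N - r\<^sup>2) \<le> B * (2 * sqrt N + 1)" using B0 by (intro mult_left_mono)
      then show ?thesis using absb[of "{r\<^sup>2..<N}"] by simp
    qed
    also have "(\<Sum>m<r. \<bar>\<Sum>j\<in>{m\<^sup>2..<(Suc m)\<^sup>2}. s j\<bar>) \<le> (\<Sum>m<r. \<epsilon> / 2 * (2 * real m + 1) +
      ((if m < M then B * (2 * real m + 1) else 0) + (if m \<in> range ((^) 2) then B * (2 * real m + 1) else 0)))"
      by (intro sum_mono blockb)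
    also have "\<dots> = (\<Sum>m<r. \<epsilon> / 2 * (2 * real m + 1)) + ((\<Sum>m<r. if m < M then B * (2 * real m + 1) else 0) +
        (\<Sum>m<r. if m \<in> range ((^) 2) then B * (2 * real m + 1) else 0))"
      by (simp only: sum.distrib)
    also have "(\<Sum>m<r. \<epsilon> / 2 * (2 * real m + 1)) = \<epsilon> / 2 * (real r)\<^sup>2"
      by (simp only: sq[symmetric] sum_distrib_left)
    also have "(\<Sum>m<r. if m < M then B * (2 * real m + 1) else 0) \<le> B * (real M)\<^sup>2"
    proof -
      have "(\<Sum>m<r. if m < M then B * (2 * real m + 1) else 0) = (\<Sum>m | m < r \<and> m < M. B * (2 * real m + 1))"
        by (subst sum.inter_filter[symmetric]) (auto intro!: sum.cong)
      also have "\<dots> \<le> (\<Sum>m<M. B * (2 * real m + 1))" using B0 by (intro sum_mono2) auto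
      also have "\<dots> = B * (real M)\<^sup>2"
        by (simp only: sq[symmetric] sum_distrib_left)
      finally show ?thesis .
    qed
    also have "(\<Sum>m<r. if m \<in> range ((^) 2) then B * (2 * real m + 1) else 0) \<le> B * (6 * sqrt N)"
    proof -
      have "(\<Sum>m<r. if m \<in> range ((^) 2) then B * (2 * real m + 1) else 0) =
          (\<Sum>m | m < r \<and> m \<in> range ((^) 2). B * (2 * real m + 1))"
        by (subst sum.inter_filter[symmetric]) (auto intro!: sum.cong)
      also have "\<dots> = B * real (\<Sum>m | m < r \<and> m \<in> range ((^) 2). 2 * m + 1)"
        unfolding sum_distrib_left of_nat_sum by (rule sum.cong) (simp_all add: add.commute)
      also have "\<dots> \<le> B * real (6 * r)"
        by (intro mult_left_mono B0) (metis of_nat_le_iff sum_two_powers_le)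
      also have "\<dots> \<le> B * (6 * sqrt N)" using rN B0 by (intro mult_left_mono) auto
      finally show ?thesis .
    qed
    also have "\<epsilon> / 2 * (real r)\<^sup>2 \<le> \<epsilon> / 2 * N" using rN2 e by (intro mult_left_mono) auto
    finally show ?thesis by (simp add: algebra_simps)
  qed
  define h where "h = (\<lambda>N. \<epsilon> / 2 + B * (real M)\<^sup>2 / real N + B * (8 * sqrt N + 1) / real N)"
  have "h \<longlonglongrightarrow> \<epsilon> / 2 + 0 + 0"
    unfolding h_def by (intro tendsto_intros) real_asymp+
  then have "eventually (\<lambda>N. h N < \<epsilon>) sequentially"
    using e order_tendstoD(2)[of h "\<epsilon> / 2" sequentially \<epsilon>] by simp
  then have "eventually (\<lambda>N. \<bar>avg s N\<bar> < \<epsilon>) sequentially"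
    using eventually_ge_at_top[of 1]
  proof eventually_elim
    case (elim N)
    have "\<bar>avg s N\<bar> \<le> h N"
      using bound[of N] elim(2) by (simp add: avg_def h_def field_simps)
    then show ?case using elim(1) by linarith
  qed
  then show "\<exists>no. \<forall>n\<ge>no. norm (avg s n - 0) < \<epsilon>"
    by (simp add: eventually_sequentially)
qed

text \<open>Epoch \<open>e\<close> consists of the block indices \<open>2 ^ e\<^sup>2 \<le> m < 2 ^ (e + 1)\<^sup>2\<close>, so that each epoch dwarfs all earlier ones.\<close>

definition epoch :: "nat \<Rightarrow> nat" where
  "epoch m = floor_sqrt (floor_log m)"

text \<open>Measured in positions: the outer square turns the first block index of the epoch into
  the first position of that block.\<close>

definition epoch_start :: "nat \<Rightarrow> nat" where
  "epoch_start e = (2 ^ e\<^sup>2)\<^sup>2"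

lemma epoch_start_Suc: "epoch_start (Suc e) = epoch_start e * 4 ^ (2 * e + 1)"
proof -
  have "(2::nat) ^ (Suc e)\<^sup>2 = 2 ^ e\<^sup>2 * 2 ^ (2 * e + 1)"
    by (simp add: power_add[symmetric] power2_eq_square)
  then show ?thesis
    by (simp add: epoch_start_def power_mult_distrib power_mult[symmetric] mult.commute[of _ 2] power_mult)
qed

lemma epoch_start_pos: "epoch_start e > 0" by (simp add: epoch_start_def)

lemma epoch_start_mono: "epoch_start e \<le> epoch_start (Suc e)"
  by (simp add: epoch_start_Suc)

lemma le_epoch_start: "e \<le> epoch_start e"
proof -
  have "e \<le> e\<^sup>2" by (simp add: power2_eq_square)
  also have "\<dots> \<le> 2 ^ e\<^sup>2" by (rule less_imp_le[OF less_exp])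
  also have "(2::nat) ^ e\<^sup>2 \<le> (2 ^ e\<^sup>2)\<^sup>2" by (simp add: power2_eq_square)
  finally show ?thesis by (simp add: epoch_start_def)
qed

lemma epoch_eq:
  assumes "epoch_start e \<le> j" "j < epoch_start (Suc e)"
  shows "epoch (floor_sqrt j) = e"
proof -
  let ?m = "floor_sqrt j"
  have 1: "2 ^ e\<^sup>2 \<le> ?m" using assms(1) by (simp add: epoch_start_def le_floor_sqrt_iff)
  have 2: "?m < 2 ^ (Suc e)\<^sup>2"
    using assms(2) by (metis epoch_start_def le_floor_sqrt_iff not_less)
  have "e\<^sup>2 \<le> floor_log ?m" using floor_log_le_iff[OF 1] by simp
  moreover have "floor_log ?m < (Suc e)\<^sup>2"
  proof (rule ccontr)
    assume "\<not> floor_log ?m < (Suc e)\<^sup>2"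
    then have "(2::nat) ^ (Suc e)\<^sup>2 \<le> 2 ^ floor_log ?m" by (intro power_increasing) auto
    also have "\<dots> \<le> ?m" using 1 by (intro floor_log_exp2_le) (metis gr0I le_zero_eq power_not_zero zero_neq_numeral)
    finally show False using 2 by simp
  qed
  ultimately show ?thesis unfolding epoch_def by (intro floor_sqrt_unique)
qed

lemma epoch_ratio_tendsto: "(\<lambda>e. real (epoch_start e) / real (epoch_start (Suc e))) \<longlonglongrightarrow> 0"
proof -
  have "real (epoch_start e) / real (epoch_start (Suc e)) = 1 / (4 ^ (2 * e + 1))" for e
    using epoch_start_pos[of e] by (simp add: epoch_start_Suc)
  moreover have "(\<lambda>e. 1 / (4 ^ (2 * e + 1)) :: real) \<longlonglongrightarrow> 0" by real_asymp
  ultimately show ?thesis by simp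
qed

lemma avg_epoch_ge:
  assumes "N \<ge> 1" "\<And>r. c \<le> b r"
  shows "c \<le> avg (\<lambda>j. b (even (epoch (floor_sqrt j)))) N"
proof -
  have "(\<Sum>j<N. c) \<le> (\<Sum>j<N. b (even (epoch (floor_sqrt j))))" by (intro sum_mono assms)
  then show ?thesis using assms(1) by (simp add: avg_def le_divide_eq mult.commute)
qed

text \<open>Only positions before epoch \<open>e\<close> can carry the other value, each with error
  at most the gap between the two values.\<close>

lemma avg_epoch_end:
  fixes b :: "bool \<Rightarrow> real"
  shows "\<bar>avg (\<lambda>j. b (even (epoch (floor_sqrt j)))) (epoch_start (Suc e)) - b (even e)\<bar> \<le>
    \<bar>b True - b False\<bar> * (epoch_start e / epoch_start (Suc e))"
proof -
  let ?N = "epoch_start (Suc e)" and ?M = "epoch_start e"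
  let ?f = "\<lambda>j. b (even (epoch (floor_sqrt j)))"
  have N: "real ?N > 0" using epoch_start_pos by simp
  have "(\<Sum>j<?N. ?f j - b (even e)) = (\<Sum>j<?M. ?f j - b (even e))"
    using epoch_start_mono[of e] epoch_eq[of e] by (intro sum.mono_neutral_right) (auto simp: not_less)
  also have "\<bar>\<dots>\<bar> \<le> (\<Sum>j<?M. \<bar>?f j - b (even e)\<bar>)" by (rule sum_abs)
  also have "\<dots> \<le> (\<Sum>j<?M. \<bar>b True - b False\<bar>)"
  proof (rule sum_mono)
    show "\<bar>?f j - b (even e)\<bar> \<le> \<bar>b True - b False\<bar>" for j
      by (cases "even (epoch (floor_sqrt j))"; cases "even e") auto
  qed
  finally have "\<bar>(\<Sum>j<?N. ?f j) - ?N * b (even e)\<bar> \<le> ?M * \<bar>b True - b False\<bar>"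
    by (simp add: sum_subtractf)
  moreover have "avg ?f ?N - b (even e) = ((\<Sum>j<?N. ?f j) - ?N * b (even e)) / ?N"
    using N by (simp add: avg_def field_simps)
  moreover have "\<bar>((\<Sum>j<?N. ?f j) - ?N * b (even e)) / ?N\<bar> = \<bar>(\<Sum>j<?N. ?f j) - ?N * b (even e)\<bar> / ?N"
    by simp
  ultimately show ?thesis using N by (simp add: divide_right_mono mult.commute)
qed

lemma frequently_avg_epoch_close:
  fixes b :: "bool \<Rightarrow> real"
  assumes "\<epsilon> > 0"
  shows "\<exists>n\<ge>N. \<bar>avg (\<lambda>j. b (even (epoch (floor_sqrt j)))) n - b r\<bar> < \<epsilon>"
proof -
  have "(\<lambda>e. \<bar>b True - b False\<bar> * (epoch_start e / epoch_start (Suc e))) \<longlonglongrightarrow> \<bar>b True - b False\<bar> * 0"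
    by (intro tendsto_intros epoch_ratio_tendsto)
  then have "eventually (\<lambda>e. \<bar>b True - b False\<bar> * (epoch_start e / epoch_start (Suc e)) < \<epsilon>) sequentially"
    using assms by (intro order_tendstoD) auto
  then obtain E where E: "\<And>e. e \<ge> E \<Longrightarrow> \<bar>b True - b False\<bar> * (epoch_start e / epoch_start (Suc e)) < \<epsilon>"
    by (auto simp: eventually_sequentially)
  define e where "e = (if r then 2 * (E + N) else 2 * (E + N) + 1)"
  have "e \<ge> E" "N \<le> Suc e" "even e = r" by (auto simp: e_def)
  then have "N \<le> epoch_start (Suc e)" using le_epoch_start[of "Suc e"] by linarith
  then show ?thesis using avg_epoch_end[of b e] E[OF \<open>e \<ge> E\<close>] \<open>even e = r\<close>
    by (intro exI[of _ "epoch_start (Suc e)"]) auto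
qed

subsection \<open>The construction\<close>

lemma sum_periodic_shift:
  fixes f :: "nat \<Rightarrow> real"
  assumes "\<And>i. f (i + q) = f i"
  shows "(\<Sum>j\<in>{u..<u + q}. f j) = (\<Sum>j<q. f j)"
proof (induction u)
  case (Suc u)
  have "(\<Sum>j\<in>{u..<u + q}. f j) + f (u + q) = f u + (\<Sum>j\<in>{Suc u..<Suc u + q}. f j)"
    using sum.atLeastLessThan_Suc[of u "u + q" f] sum.atLeast_Suc_lessThan[of u "Suc u + q" f]
    by simp
  then show ?case using Suc assms[of u] by simp
qed (simp add: atLeast0LessThan)

text \<open>Full periods contribute the mean exactly; the remainder of fewer than \<open>q\<close>
  terms and its missing mean cost at most \<open>B * q\<close> each.\<close>

lemma sum_periodic_interval:
  fixes f :: "nat \<Rightarrow> real"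
  assumes per: "\<And>i. f (i + q) = f i" and B: "\<And>i. \<bar>f i\<bar> \<le> B" and "q > 0"
  shows "\<bar>(\<Sum>j\<in>{u..<u + n}. f j) - n * ((\<Sum>j<q. f j) / q)\<bar> \<le> 2 * B * q"
proof -
  define M where "M = (\<Sum>j<q. f j) / q"
  have B0: "0 \<le> B" using B[of 0] by linarith
  have absb: "\<bar>\<Sum>j\<in>A. f j\<bar> \<le> B * card A" for A
    by (rule order_trans[OF sum_abs]) (use sum_bounded_above[of A "\<lambda>j. \<bar>f j\<bar>" B] B in \<open>simp add: mult.commute\<close>)
  have M: "\<bar>M\<bar> \<le> B" using absb[of "{..<q}"] assms(3) by (simp add: M_def divide_le_eq)
  have full: "(\<Sum>j\<in>{u..<u + d * q}. f j) = d * q * M" for d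
  proof (induction d)
    case (Suc d)
    have "(\<Sum>j\<in>{u..<u + Suc d * q}. f j) = (\<Sum>j\<in>{u..<u + d * q}. f j) + (\<Sum>j\<in>{u + d * q..<u + d * q + q}. f j)"
      by (subst sum.atLeastLessThan_concat) (auto simp: algebra_simps)
    then show ?case using Suc sum_periodic_shift[of f q "u + d * q", OF per] assms(3)
      by (simp add: M_def algebra_simps add_divide_distrib)
  qed simp
  define d r where "d = n div q" and "r = n mod q"
  have n: "n = d * q + r" and r: "r < q" using assms(3) by (auto simp: d_def r_def)
  have "(\<Sum>j\<in>{u..<u + n}. f j) = (\<Sum>j\<in>{u..<u + d * q}. f j) + (\<Sum>j\<in>{u + d * q..<u + d * q + r}. f j)"
    unfolding n by (subst sum.atLeastLessThan_concat) (auto simp: algebra_simps)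
  then have "(\<Sum>j\<in>{u..<u + n}. f j) - n * M = (\<Sum>j\<in>{u + d * q..<u + d * q + r}. f j) - r * M"
    unfolding full n by (simp add: algebra_simps)
  also have "\<bar>\<dots>\<bar> \<le> B * r + r * B"
    using absb[of "{u + d * q..<u + d * q + r}"] mult_left_mono[OF M, of r]
      abs_triangle_ineq4[of "\<Sum>j\<in>{u + d * q..<u + d * q + r}. f j" "r * M"]
    unfolding abs_mult by (simp add: mult.commute[of "real r"])
  also have "\<dots> \<le> 2 * B * q" using r B0 mult_left_mono[of r q B] by (simp add: algebra_simps)
  finally show ?thesis by (simp add: M_def)
qed

lemma multiple_in_window:
  assumes "(q::nat) > 0" shows "t \<le> card {j \<in> {a..<a + q * t}. q dvd j}"
proof -
  \<comment> \<open>Ceiling of \<open>a / q\<close>, so that \<open>q * b\<close> is the first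
    multiple in the window.\<close>
  define b where "b = (a + q - 1) div q"
  have b: "a \<le> q * b" "q * b < a + q"
  proof -
    have "q * b + (a + q - 1) mod q = a + q - 1" unfolding b_def by simp
    moreover have "(a + q - 1) mod q < q" using assms by simp
    ultimately show "a \<le> q * b" "q * b < a + q" using assms by linarith+
  qed
  have "q * (b + s) \<in> {a..<a + q * t}" if "s < t" for s
  proof -
    have "q * Suc s \<le> q * t" using that by (intro mult_le_mono) auto
    then show ?thesis using b by (auto simp: algebra_simps)
  qed
  then have "(\<lambda>s. q * (b + s)) ` {..<t} \<subseteq> {j \<in> {a..<a + q * t}. q dvd j}" by auto
  moreover have "inj_on (\<lambda>s. q * (b + s)) {..<t}" using assms by (auto simp: inj_on_def)
  ultimately have "card ((\<lambda>s. q * (b + s)) ` {..<t}) = t"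
    and "card ((\<lambda>s. q * (b + s)) ` {..<t}) \<le> card {j \<in> {a..<a + q * t}. q dvd j}"
    by (simp add: card_image, intro card_mono) auto
  then show ?thesis by simp
qed

text \<open>The block with index \<open>m = 4 ^ n\<close> (where \<open>n > q\<close>) starts with a copy of the first \<open>m\<close> symbols of the whole sequence;
  \<open>tau\<close> traces a position back through such copies to one that is not copied.\<close>

function tau :: "nat \<Rightarrow> nat \<Rightarrow> nat" where
  "tau q j = (if (\<exists>n>q. floor_sqrt j = 4 ^ n) \<and> j - (floor_sqrt j)\<^sup>2 < floor_sqrt j
    then tau q (j - (floor_sqrt j)\<^sup>2) else j)"
  by auto
termination
proof (relation "Wellfounded.measure snd", goal_cases)
  case (2 q j)
  then have "floor_sqrt j > 0" by (metis gr0I power_not_zero zero_neq_numeral)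
  then have "(floor_sqrt j)\<^sup>2 > 0" "j > 0" by simp_all
  then have "j - (floor_sqrt j)\<^sup>2 < j" by simp
  then show ?case by simp
qed simp

declare tau.simps [simp del]

text \<open>\<open>16 ^ n\<close> is the first position of the block with index
  \<open>4 ^ n\<close>. Less than half of that block is overwritten.\<close>

definition copied :: "nat \<Rightarrow> nat set" where
  "copied q = (\<Union>n\<in>{q<..}. {16 ^ n..<16 ^ n + 4 ^ n})"

lemma sixteen_power: "(16::nat) ^ n = (4 ^ n)\<^sup>2"
  by (simp add: power_mult[symmetric] power2_eq_square power_mult_distrib[symmetric])

lemma floor_sqrt_copied: "j \<in> {16 ^ n..<16 ^ n + 4 ^ n} \<Longrightarrow> floor_sqrt j = 4 ^ n"
  unfolding floor_sqrt_eq_iff sixteen_power by (auto simp: power2_eq_square)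

text \<open>One unfolding of \<open>tau\<close> suffices even if \<open>i\<close> is itself copied:
  both sides then continue identically, so copies reproduce earlier copies literally.\<close>

lemma tau_copy:
  assumes "n > q" "i < 4 ^ n" shows "tau q (16 ^ n + i) = tau q i"
proof -
  have "floor_sqrt (16 ^ n + i) = 4 ^ n" using assms(2) by (intro floor_sqrt_copied) auto
  then show ?thesis using assms by (subst tau.simps) (auto simp: sixteen_power[symmetric])
qed

lemma tau_not_copied:
  assumes "j \<notin> copied q" shows "tau q j = j"
proof -
  have False if "n > q" "floor_sqrt j = 4 ^ n" "j - (floor_sqrt j)\<^sup>2 < floor_sqrt j" for n
  proof -
    have "(floor_sqrt j)\<^sup>2 \<le> j" by simp
    then have "j \<in> {16 ^ n..<16 ^ n + 4 ^ n}" using that by (auto simp: sixteen_power)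
    then show False using assms that(1) by (auto simp: copied_def)
  qed
  then show ?thesis by (subst tau.simps) auto
qed

lemma four_power_eq: "(4::nat) ^ n = 2 ^ (2 * n)"
  by (simp add: power_mult)

lemma not_copied_of_block: "floor_sqrt j \<notin> range ((^) 4) \<Longrightarrow> j \<notin> copied q"
  unfolding copied_def using floor_sqrt_copied by blast

text \<open>The bound \<open>n > q\<close> in \<open>copied\<close> keeps the copies away from the
  initial word of length \<open>q + 1\<close>.\<close>

lemma copied_le: assumes "j \<in> copied q" shows "q < j"
proof -
  obtain n where n: "n > q" "16 ^ n \<le> j" using assms by (auto simp: copied_def)
  have "n < 16 ^ n" by (rule less_le_trans[OF less_exp[of n]]) (simp add: power_mono)
  then show ?thesis using n by linarith
qed

text \<open>Colours index sequences \<open>P c\<close> with the common period \<open>q\<close>;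
  \<open>cols\<close> holds the colours in use. The argument \<open>True\<close> of
  \<open>lo\<close>, \<open>hi\<close> and \<open>lam\<close> stands for even epochs,
  \<open>False\<close> for odd ones: colour of the low run, colour of the high run, and share of a
  block given to the low run. \<open>sp\<close> is the optional orbit of the rare runs.\<close>

locale shift_construction =
  fixes k q :: nat and P :: "nat \<Rightarrow> nat \<Rightarrow> nat" and cols :: "nat set"
    and lo hi :: "bool \<Rightarrow> nat" and lam :: "bool \<Rightarrow> real" and sp :: "nat option"
  assumes k2: "k \<ge> 2" and q_pos: "q > 0"
    and P_less: "P c i < k" and P_periodic: "P c (i + q) = P c i"
    and lam: "0 < lam r" "lam r < 1"
    and lo_cols: "lo r \<in> cols" and hi_cols: "hi r \<in> cols" and sp_cols: "sp = Some c \<Longrightarrow> c \<in> cols"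
begin

definition ell :: "bool \<Rightarrow> nat \<Rightarrow> nat" where
  "ell r m = nat \<lfloor>lam r * (2 * real m + 1)\<rfloor>"

lemma ell_real: "\<bar>real (ell r m) - lam r * (2 * real m + 1)\<bar> \<le> 1"
proof -
  have "0 \<le> lam r * (2 * real m + 1)" using lam[of r] by simp
  then show ?thesis unfolding ell_def by linarith
qed

lemma ell_le: "ell r m \<le> 2 * m + 1"
proof -
  have "lam r * (2 * real m + 1) \<le> 1 * (2 * real m + 1)"
    using lam[of r] by (intro mult_right_mono) auto
  then have "\<lfloor>lam r * (2 * real m + 1)\<rfloor> \<le> \<lfloor>real_of_int (2 * int m + 1)\<rfloor>"
    by (intro floor_mono) simp
  then have "\<lfloor>lam r * (2 * real m + 1)\<rfloor> \<le> 2 * int m + 1" by (simp only: floor_of_int)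
  then show ?thesis unfolding ell_def by linarith
qed

text \<open>The initial word \<open>0\<dots>01\<close> of length \<open>q + 1\<close> is not a factor of any \<open>q\<close>-periodic sequence, which is
  what keeps the point from being Banach recurrent. The blocks \<open>m = 2 * 4 ^ n\<close> realise an orbit of zero
  density but positive upper Banach density.\<close>

definition base :: "(nat \<Rightarrow> nat) \<Rightarrow> nat \<Rightarrow> nat" where
  "base \<theta> j = (let m = floor_sqrt j; e = epoch m; r = even e in
     if j \<le> q then (if j < q then 0 else 1)
     else if sp \<noteq> None \<and> (\<exists>n. m = 2 * 4 ^ n) then P (the sp) j
     else if j < m\<^sup>2 + ell r m then P (lo r) (j + \<theta> e) else P (hi r) (j + \<theta> e))"

definition pt :: "(nat \<Rightarrow> nat) \<Rightarrow> nat \<Rightarrow> nat" where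
  "pt \<theta> j = base \<theta> (tau q j)"

lemma base_Sigma: "base \<theta> \<in> Sigma_k k"
  using k2 P_less by (auto simp: Sigma_k_def base_def Let_def)

lemma pt_Sigma: "pt \<theta> \<in> Sigma_k k"
  using base_Sigma by (auto simp: Sigma_k_def pt_def)

lemma pt_not_copied: "j \<notin> copied q \<Longrightarrow> pt \<theta> j = base \<theta> j"
  by (simp add: pt_def tau_not_copied)

lemma pt_copy: "n > q \<Longrightarrow> i < 4 ^ n \<Longrightarrow> pt \<theta> (16 ^ n + i) = pt \<theta> i"
  by (simp add: pt_def tau_copy)

lemma pt_start: "j \<le> q \<Longrightarrow> pt \<theta> j = (if j < q then 0 else 1)"
  using copied_le[of j q] by (subst pt_not_copied) (force, simp add: base_def)

lemma base_run_lo: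
  assumes "m > q" "sp = None \<or> (\<forall>n. m \<noteq> 2 * 4 ^ n)" "m\<^sup>2 \<le> j" "j < m\<^sup>2 + ell (even (epoch m)) m"
  shows "base \<theta> j = P (lo (even (epoch m))) (j + \<theta> (epoch m))"
proof -
  have "floor_sqrt j = m"
    using assms ell_le[of "even (epoch m)" m] unfolding floor_sqrt_eq_iff by (auto simp: power2_eq_square)
  moreover have "m \<le> m\<^sup>2" by (simp add: power2_eq_square)
  ultimately show ?thesis using assms by (auto simp: base_def Let_def)
qed

lemma base_run_hi:
  assumes "m > q" "sp = None \<or> (\<forall>n. m \<noteq> 2 * 4 ^ n)" "m\<^sup>2 + ell (even (epoch m)) m \<le> j" "j < (Suc m)\<^sup>2"
  shows "base \<theta> j = P (hi (even (epoch m))) (j + \<theta> (epoch m))"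
proof -
  have "floor_sqrt j = m" using assms unfolding floor_sqrt_eq_iff by auto
  moreover have "m \<le> m\<^sup>2" by (simp add: power2_eq_square)
  ultimately show ?thesis using assms by (auto simp: base_def Let_def)
qed

lemma base_sparse:
  assumes "m > q" "sp = Some c" "\<exists>n. m = 2 * 4 ^ n" "m\<^sup>2 \<le> j" "j < (Suc m)\<^sup>2"
  shows "base \<theta> j = P c j"
proof -
  have "floor_sqrt j = m" using assms unfolding floor_sqrt_eq_iff by auto
  moreover have "m \<le> m\<^sup>2" by (simp add: power2_eq_square)
  then have "\<not> j \<le> q" using assms(1,4) by linarith
  moreover have "sp \<noteq> None" "the sp = c" using assms(2) by simp_all
  ultimately show ?thesis using assms(3) by (simp add: base_def Let_def)
qed

lemma not_two_power_imp:
  fixes m :: nat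
  assumes "m \<notin> range ((^) 2)"
  shows "m \<noteq> 2 * 4 ^ n" "m \<notin> range ((^) 4)"
proof -
  have "2 * 4 ^ n = (2::nat) ^ (2 * n + 1)" by (simp add: power_mult)
  then show "m \<noteq> 2 * 4 ^ n" using assms by (metis rangeI)
  show "m \<notin> range ((^) 4)"
  proof
    assume "m \<in> range ((^) 4)"
    then obtain n where "m = 2 ^ (2 * n)" using four_power_eq by auto
    then show False using assms by blast
  qed
qed

lemma pt_run_lo:
  assumes "m > q" "m \<notin> range ((^) 2)" "m\<^sup>2 \<le> j" "j < m\<^sup>2 + ell (even (epoch m)) m"
  shows "pt \<theta> j = P (lo (even (epoch m))) (j + \<theta> (epoch m))"
proof -
  have "floor_sqrt j = m"
    using assms ell_le[of "even (epoch m)" m] unfolding floor_sqrt_eq_iff by (auto simp: power2_eq_square)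
  then show ?thesis
    using not_copied_of_block[of j q] base_run_lo[of m j \<theta>] assms not_two_power_imp[OF assms(2)]
    by (simp add: pt_not_copied)
qed

lemma pt_run_hi:
  assumes "m > q" "m \<notin> range ((^) 2)" "m\<^sup>2 + ell (even (epoch m)) m \<le> j" "j < (Suc m)\<^sup>2"
  shows "pt \<theta> j = P (hi (even (epoch m))) (j + \<theta> (epoch m))"
proof -
  have "floor_sqrt j = m" using assms unfolding floor_sqrt_eq_iff by auto
  then show ?thesis
    using not_copied_of_block[of j q] base_run_hi[of m j \<theta>] assms not_two_power_imp[OF assms(2)]
    by (simp add: pt_not_copied)
qed

text \<open>Positions whose window of length \<open>L\<close> may cross the boundary of a run.\<close>

definition badw :: "nat \<Rightarrow> nat set" where
  "badw L = {j. floor_sqrt j \<le> q \<or> (Suc (floor_sqrt j))\<^sup>2 < j + L \<or>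
     (let m = floor_sqrt j; b = m\<^sup>2 + ell (even (epoch m)) m in j < b \<and> b < j + L)}"

text \<open>At most \<open>L\<close> windows cross each of the two run ends of a block;
  \<open>2 * q + 1\<close> is the length of the longest block that is declared bad as a
  whole.\<close>

lemma card_badw_block: "card (badw L \<inter> {m\<^sup>2..<(Suc m)\<^sup>2}) \<le> 2 * L + 2 * q + 1"
proof (cases "m \<le> q")
  case True
  have "card (badw L \<inter> {m\<^sup>2..<(Suc m)\<^sup>2}) \<le> card {m\<^sup>2..<(Suc m)\<^sup>2}" by (rule card_mono) auto
  then show ?thesis unfolding card_sqrt_block using True by linarith
next
  case False
  define b where "b = m\<^sup>2 + ell (even (epoch m)) m"
  have "badw L \<inter> {m\<^sup>2..<(Suc m)\<^sup>2} \<subseteq> {(Suc m)\<^sup>2 - L..<(Suc m)\<^sup>2} \<union> {b - L..<b}"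
  proof
    fix j assume j: "j \<in> badw L \<inter> {m\<^sup>2..<(Suc m)\<^sup>2}"
    then have "floor_sqrt j = m" using floor_sqrt_eq_iff by blast
    then show "j \<in> {(Suc m)\<^sup>2 - L..<(Suc m)\<^sup>2} \<union> {b - L..<b}"
      using j False by (auto simp: badw_def b_def Let_def)
  qed
  then have "card (badw L \<inter> {m\<^sup>2..<(Suc m)\<^sup>2}) \<le> card ({(Suc m)\<^sup>2 - L..<(Suc m)\<^sup>2} \<union> {b - L..<b})"
    by (intro card_mono) auto
  also have "\<dots> \<le> card {(Suc m)\<^sup>2 - L..<(Suc m)\<^sup>2} + card {b - L..<b}" by (rule card_Un_le)
  also have "\<dots> \<le> 2 * L" by simp
  finally show ?thesis by linarith
qed

lemma card_badw_le:
  assumes "a \<le> b"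
  shows "card (badw L \<inter> {a..<b}) \<le> (2 * L + 2 * q + 1) * (sqrt (real b - real a) + 2)"
  using card_Int_le_of_blocks[OF card_badw_block assms, of L] by simp

lemma card_badw_two_powers_le:
  fixes N :: nat
  shows
  "card {j. j < N \<and> (j \<in> badw L \<or> floor_sqrt j \<in> range ((^) 2))} \<le> (4 * L + 4 * q + 8) * (sqrt N + 1)"
proof -
  have "{j. j < N \<and> (j \<in> badw L \<or> floor_sqrt j \<in> range ((^) 2))} \<subseteq>
    (badw L \<inter> {0..<N}) \<union> {j. j < N \<and> floor_sqrt j \<in> range ((^) 2)}" by auto
  then have "card {j. j < N \<and> (j \<in> badw L \<or> floor_sqrt j \<in> range ((^) 2))} \<le>
    card ((badw L \<inter> {0..<N}) \<union> {j. j < N \<and> floor_sqrt j \<in> range ((^) 2)})" by (intro card_mono) auto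
  also have "\<dots> \<le> card (badw L \<inter> {0..<N}) + card {j. j < N \<and> floor_sqrt j \<in> range ((^) 2)}"
    by (rule card_Un_le)
  finally have "real (card {j. j < N \<and> (j \<in> badw L \<or> floor_sqrt j \<in> range ((^) 2))}) \<le>
    real (card (badw L \<inter> {0..<N})) + real (card {j. j < N \<and> floor_sqrt j \<in> range ((^) 2)})"
    by linarith
  also have "\<dots> \<le> (2 * L + 2 * q + 1) * (sqrt N + 2) + 6 * (sqrt N + 1)"
    using card_badw_le[of 0 N L] card_two_power_blocks_le[of N] by (intro add_mono) auto
  also have "\<dots> \<le> (4 * L + 4 * q + 8) * (sqrt N + 1)"
  proof -
    have "0 \<le> real L * sqrt N" "0 \<le> real q * sqrt N" by simp_all
    then show ?thesis by (simp add: algebra_simps)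
  qed
  finally show ?thesis .
qed

lemma not_badw_cases:
  assumes "j \<notin> badw L"
  defines "m \<equiv> floor_sqrt j"
  shows "m > q" "m\<^sup>2 \<le> j" "j + L \<le> (Suc m)\<^sup>2"
    "j + L \<le> m\<^sup>2 + ell (even (epoch m)) m \<or> m\<^sup>2 + ell (even (epoch m)) m \<le> j"
  using assms(1) by (auto simp: badw_def m_def Let_def)

text \<open>The order of quantifiers matters: run boundaries do not depend on
  \<open>\<theta>\<close>, so one colour serves all itineraries. This allows two points to be
  compared position by position.\<close>

lemma pt_window:
  assumes "j \<notin> badw L" "floor_sqrt j \<notin> range ((^) 2)"
  defines "e \<equiv> epoch (floor_sqrt j)"
  shows "\<exists>c\<in>{lo (even e), hi (even e)}. \<forall>\<theta>. \<forall>i<L. pt \<theta> (j + i) = P c (j + i + \<theta> e)"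
  using not_badw_cases(4)[OF assms(1)]
proof
  assume "j + L \<le> (floor_sqrt j)\<^sup>2 + ell (even (epoch (floor_sqrt j))) (floor_sqrt j)"
  then show ?thesis using not_badw_cases(1-3)[OF assms(1)] pt_run_lo[OF _ assms(2)]
    by (intro bexI[of _ "lo (even e)"]) (auto simp: e_def trans_le_add1)
next
  assume "(floor_sqrt j)\<^sup>2 + ell (even (epoch (floor_sqrt j))) (floor_sqrt j) \<le> j"
  then show ?thesis using not_badw_cases(1-3)[OF assms(1)] pt_run_hi[OF _ assms(2)]
    by (intro bexI[of _ "hi (even e)"]) (auto simp: e_def)
qed

definition factor :: "(nat \<Rightarrow> nat) \<Rightarrow> nat \<Rightarrow> nat \<Rightarrow> bool" where
  "factor x L j \<longleftrightarrow> (\<exists>c\<in>cols. \<exists>d. \<forall>i<L. x (j + i) = P c (d + i))"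

text \<open>Before copying, run boundaries and the first blocks are the only obstructions; the
  sparse blocks are harmless, since \<open>cols\<close> contains the colour of \<open>sp\<close>.
  Discarding them would not give a bound uniform in the position of the window.\<close>

lemma base_factor:
  assumes "j \<notin> badw L" shows "factor (base \<theta>) L j"
proof -
  define m where "m = floor_sqrt j"
  define r where "r = even (epoch m)"
  note nb = not_badw_cases[OF assms, folded m_def]
  consider c n where "sp = Some c" "m = 2 * 4 ^ n" |
    "sp = None \<or> (\<forall>n. m \<noteq> 2 * 4 ^ n)" by fastforce
  then show ?thesis
  proof cases
    case 1
    then have "\<forall>i<L. base \<theta> (j + i) = P c (j + i)" using nb base_sparse[OF nb(1) 1(1)] 1(2) by auto
    then show ?thesis unfolding factor_def using sp_cols[OF 1(1)] by blast
  next
    case 2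
    from nb(4) show ?thesis
    proof
      assume "j + L \<le> m\<^sup>2 + ell (even (epoch m)) m"
      then have "\<forall>i<L. base \<theta> (j + i) = P (lo r) (j + \<theta> (epoch m) + i)"
        using nb base_run_lo[OF nb(1) 2] by (auto simp: r_def algebra_simps)
      then show ?thesis unfolding factor_def using lo_cols by blast
    next
      assume "m\<^sup>2 + ell (even (epoch m)) m \<le> j"
      then have "\<forall>i<L. base \<theta> (j + i) = P (hi r) (j + \<theta> (epoch m) + i)"
        using nb base_run_hi[OF nb(1) 2] by (auto simp: r_def algebra_simps)
      then show ?thesis unfolding factor_def using hi_cols by blast
    qed
  qed
qed

end

subsection \<open>Sparsity of defects and block averages\<close>

context shift_construction
begin

text \<open>The whole window has to fit between \<open>a\<close> and \<open>b\<close>; then an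
  interval inside a copy has no more defects than the original.\<close>

definition defects :: "(nat \<Rightarrow> nat) \<Rightarrow> nat \<Rightarrow> nat \<Rightarrow> nat \<Rightarrow> nat set" where
  "defects \<theta> L a b = {j. a \<le> j \<and> j + L \<le> b \<and> \<not> factor (pt \<theta>) L j}"

lemma finite_defects [simp]: "finite (defects \<theta> L a b)"
  by (rule finite_subset[of _ "{..b}"]) (auto simp: defects_def)

lemma card_defects_split:
  "card (defects \<theta> L a c) \<le> card (defects \<theta> L a b) + card (defects \<theta> L b c) + L"
proof -
  have "defects \<theta> L a c \<subseteq> (defects \<theta> L a b \<union> defects \<theta> L b c) \<union> {b - L..<b}"
    by (auto simp: defects_def)
  then have "card (defects \<theta> L a c) \<le> card ((defects \<theta> L a b \<union> defects \<theta> L b c) \<union> {b - L..<b})"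
    by (intro card_mono) auto
  also have "\<dots> \<le> card (defects \<theta> L a b \<union> defects \<theta> L b c) + card {b - L..<b}" by (rule card_Un_le)
  also have "\<dots> \<le> card (defects \<theta> L a b) + card (defects \<theta> L b c) + L"
    by (intro add_mono card_Un_le) simp
  finally show ?thesis .
qed

lemma card_defects_mono: "a' \<le> a \<Longrightarrow> b \<le> b' \<Longrightarrow> card (defects \<theta> L a b) \<le> card (defects \<theta> L a' b')"
  by (rule card_mono[OF finite_defects]) (auto simp: defects_def)

lemma card_defects_copy:
  assumes "n > q" "b \<le> 4 ^ n"
  shows "card (defects \<theta> L (16 ^ n + a) (16 ^ n + b)) \<le> card (defects \<theta> L a b)"
proof -
  have "defects \<theta> L (16 ^ n + a) (16 ^ n + b) \<subseteq> (+) (16 ^ n) ` defects \<theta> L a b"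
  proof
    fix j assume j: "j \<in> defects \<theta> L (16 ^ n + a) (16 ^ n + b)"
    then obtain j' where j': "j = 16 ^ n + j'" by (metis (no_types, lifting) CollectD add_leD1 defects_def le_Suc_ex)
    have b: "j' + L \<le> b" "a \<le> j'" using j by (auto simp: defects_def j')
    have "pt \<theta> (j + i) = pt \<theta> (j' + i)" if "i < L" for i
      using pt_copy[OF assms(1), of "j' + i"] that b assms(2) by (simp add: j' add.assoc)
    then have "factor (pt \<theta>) L j \<longleftrightarrow> factor (pt \<theta>) L j'" unfolding factor_def by simp
    then show "j \<in> (+) (16 ^ n) ` defects \<theta> L a b" using j b by (auto simp: defects_def j')
  qed
  then have "card (defects \<theta> L (16 ^ n + a) (16 ^ n + b)) \<le> card ((+) (16 ^ n) ` defects \<theta> L a b)"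
    by (intro card_mono) auto
  also have "\<dots> \<le> card (defects \<theta> L a b)" by (rule card_image_le) simp
  finally show ?thesis .
qed

lemma card_defects_free:
  assumes "{a..<b} \<inter> copied q = {}" "L > 0" "a \<le> b"
  shows "card (defects \<theta> L a b) \<le> (4 * L + 4 * q + 8) * (sqrt (real b - real a) + 1)"
proof -
  have "defects \<theta> L a b \<subseteq> badw L \<inter> {a..<b}"
  proof
    fix j assume j: "j \<in> defects \<theta> L a b"
    have "factor (pt \<theta>) L j" if "j \<notin> badw L"
    proof -
      have "pt \<theta> (j + i) = base \<theta> (j + i)" if "i < L" for i
      proof (rule pt_not_copied)
        have "j + i \<in> {a..<b}" using j that by (simp add: defects_def)
        then show "j + i \<notin> copied q" using assms(1) by blast
      qed
      then show ?thesis using base_factor[OF that, of \<theta>] by (simp add: factor_def)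
    qed
    then show "j \<in> badw L \<inter> {a..<b}" using j assms(2) by (auto simp: defects_def)
  qed
  then have "card (defects \<theta> L a b) \<le> card (badw L \<inter> {a..<b})" by (intro card_mono) auto
  then have "real (card (defects \<theta> L a b)) \<le> (2 * L + 2 * q + 1) * (sqrt (real b - real a) + 2)"
    using card_badw_le[OF assms(3), of L] by linarith
  also have "\<dots> \<le> (4 * L + 4 * q + 8) * (sqrt (real b - real a) + 1)"
  proof -
    have "0 \<le> sqrt (real b - real a)" using assms(3) by simp
    then have "0 \<le> real L * sqrt (real b - real a)" "0 \<le> real q * sqrt (real b - real a)"
      "0 \<le> sqrt (real b - real a)" by simp_all
    then show ?thesis by (simp add: algebra_simps)
  qed
  finally show ?thesis .
qed

lemma factor_of_good:
  assumes "j \<notin> badw L" "floor_sqrt j \<notin> range ((^) 2)"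
  shows "factor (pt \<theta>) L j"
proof -
  obtain c where c: "c \<in> cols" "\<forall>i<L. pt \<theta> (j + i) = P c (j + i + \<theta> (epoch (floor_sqrt j)))"
    using pt_window[OF assms] lo_cols hi_cols by blast
  then have "\<forall>i<L. pt \<theta> (j + i) = P c (j + \<theta> (epoch (floor_sqrt j)) + i)" by (simp add: add_ac)
  then show ?thesis using c(1) unfolding factor_def by blast
qed

text \<open>For intervals starting at 0 the power-of-two blocks may be thrown away entirely, which
  settles copies without looking inside them.\<close>

lemma card_defects_prefix:
  assumes "L > 0"
  shows "card (defects \<theta> L 0 b) \<le> (4 * L + 4 * q + 8) * (sqrt b + 1)"
proof -
  have "defects \<theta> L 0 b \<subseteq> {j. j < b \<and> (j \<in> badw L \<or> floor_sqrt j \<in> range ((^) 2))}"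
    using factor_of_good[of _ L \<theta>] assms by (auto simp: defects_def)
  then have "card (defects \<theta> L 0 b) \<le> card {j. j < b \<and> (j \<in> badw L \<or> floor_sqrt j \<in> range ((^) 2))}"
    by (intro card_mono) auto
  then show ?thesis using card_badw_two_powers_le[of b L] by linarith
qed

text \<open>An interval at least as long as its starting point is comparable to a prefix:
  \<open>b\<close> is at most \<open>2 * (b - a)\<close>. Rounding 2 up to the square 4 gives the
  clean factor in front of the root.\<close>

lemma card_defects_early:
  assumes "L > 0" "2 * a \<le> b"
  shows "card (defects \<theta> L a b) \<le> 2 * (4 * L + 4 * q + 8) * (sqrt (real b - real a) + 1)"
proof -
  have "sqrt b \<le> sqrt (4 * (real b - real a))"
    using of_nat_mono[OF assms(2), where 'a = real] by (intro real_sqrt_le_mono) simp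
  moreover have "sqrt (4 * (real b - real a)) = 2 * sqrt (real b - real a)"
    unfolding real_sqrt_mult by simp
  ultimately have "sqrt b \<le> 2 * sqrt (real b - real a)" by (rule ord_le_eq_trans)
  then have "sqrt b + 1 \<le> 2 * (sqrt (real b - real a) + 1)" by simp
  then have "(4 * L + 4 * q + 8) * (sqrt b + 1) \<le> (4 * L + 4 * q + 8) * (2 * (sqrt (real b - real a) + 1))"
    by (intro mult_left_mono) auto
  moreover have "card (defects \<theta> L a b) \<le> card (defects \<theta> L 0 b)" by (rule card_defects_mono) auto
  ultimately have "real (card (defects \<theta> L a b)) \<le> (4 * L + 4 * q + 8) * (2 * (sqrt (real b - real a) + 1))"
    using card_defects_prefix[OF assms(1), of \<theta> b] by linarith
  then show ?thesis by (simp only: mult.left_commute[of _ 2] mult.assoc)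
qed

text \<open>The proof splits \<open>{a..<b}\<close> at the single copied block it can meet when \<open>b \<le> 2 * a\<close>; an interval
  inside such a block is moved back to the original, which shortens \<open>b\<close>.\<close>

lemma card_defects_le:
  assumes "L > 0" "a \<le> b"
  shows "card (defects \<theta> L a b) \<le> (30 * L + 24 * q + 48) * (sqrt (real b - real a) + 1)"
  using assms(2)
proof (induction b arbitrary: a rule: less_induct)
  case (less b)
  \<comment> \<open>Three pieces of cost \<open>C * X\<close> each plus \<open>2 * L\<close> for two
    cuts stay below the constant of the statement. The induction hypothesis is used only where an
    interval is moved as a whole, so the constant does not accumulate along nested copies.\<close>
  define C where "C = real (2 * (4 * L + 4 * q + 8))"
  define X where "X = sqrt (real b - real a) + 1"
  have X: "1 \<le> X" using less.prems by (simp add: X_def)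
  have C: "C * X \<le> (30 * L + 24 * q + 48) * X"
    using X by (intro mult_right_mono) (auto simp: C_def)
  have free': "card (defects \<theta> L a' b') \<le> C * X"
    if "{a'..<b'} \<inter> copied q = {}" "a' \<le> b'" "b' + a \<le> b + a'" for a' b'
  proof -
    have "real b' - real a' \<le> real b - real a" using of_nat_mono[OF that(3), where 'a = real] by simp
    then have "sqrt (real b' - real a') + 1 \<le> X" by (simp add: X_def)
    then have "(4 * L + 4 * q + 8) * (sqrt (real b' - real a') + 1) \<le> (4 * L + 4 * q + 8) * X"
      by (intro mult_left_mono) auto
    also have "\<dots> \<le> C * X" using X by (intro mult_right_mono) (auto simp: C_def)
    finally show ?thesis using card_defects_free[OF that(1) assms(1) that(2), of \<theta>] by simp
  qed
  have free: "card (defects \<theta> L a' b') \<le> C * X"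
    if "{a'..<b'} \<inter> copied q = {}" "a' \<le> b'" "a \<le> a'" "b' \<le> b" for a' b'
    using free'[of a' b'] that by linarith
  have early: "card (defects \<theta> L a' b') \<le> C * X" if "2 * a' \<le> b'" "b' + a \<le> b + a'" for a' b'
  proof -
    have "real b' - real a' \<le> real b - real a" using of_nat_mono[OF that(2), where 'a = real] by simp
    then have "sqrt (real b' - real a') + 1 \<le> X" by (simp add: X_def)
    then have "C * (sqrt (real b' - real a') + 1) \<le> C * X"
      by (intro mult_left_mono) (auto simp: C_def)
    moreover have "card (defects \<theta> L a' b') \<le> C * (sqrt (real b' - real a') + 1)"
      using card_defects_early[OF assms(1) that(1), of \<theta>] by (simp add: C_def)
    ultimately show ?thesis by linarith
  qed
  show ?case
  proof (cases "2 * a \<le> b")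
    case True
    then show ?thesis using early[of a b] C by (simp add: X_def)
  next
    case late: False
    show ?thesis
    proof (cases "{a..<b} \<inter> copied q = {}")
      case True
      then show ?thesis using free[of a b] C less.prems by (simp add: X_def)
    next
      case False
      then obtain n where n: "n > q" and meet: "{a..<b} \<inter> {16 ^ n..<16 ^ n + 4 ^ n} \<noteq> {}"
        unfolding copied_def by blast
      define s e where "s = (16::nat) ^ n" and "e = (16::nat) ^ n + 4 ^ n"
      have se: "s < e" "e \<le> 2 * s" by (auto simp: s_def e_def power_mono)
      have ab: "s < b" "a < e" "a < b" using meet by (auto simp: s_def e_def)
      \<comment> \<open>Starting points of copied stretches grow by the factor 16, whereas here
        \<open>b < 2 * a\<close>; so the interval cannot reach a second stretch.\<close>
      have only: "j < s \<or> e \<le> j \<Longrightarrow> j \<notin> copied q" if "j \<in> {a..<b}" for j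
      proof
        assume j: "j < s \<or> e \<le> j" "j \<in> copied q"
        then obtain n' where n': "16 ^ n' \<le> j" "j < 16 ^ n' + 4 ^ n'" by (auto simp: copied_def)
        have "n' \<noteq> n" using n' j(1) by (auto simp: s_def e_def)
        moreover have False if "n' > n"
        proof -
          have "(16::nat) ^ Suc n \<le> 16 ^ n'" using that by (intro power_increasing) auto
          then have "16 * s \<le> j" using n' by (simp add: s_def)
          then show False using \<open>j \<in> {a..<b}\<close> late ab se by auto
        qed
        moreover have False if "n' < n"
        proof -
          have "(16::nat) ^ Suc n' \<le> 16 ^ n" using that by (intro power_increasing) auto
          moreover have "(4::nat) ^ n' \<le> 16 ^ n'" by (intro power_mono) auto
          ultimately have "8 * j \<le> s" using n' by (simp add: s_def)
          then show False using \<open>j \<in> {a..<b}\<close> late ab by auto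
        qed
        ultimately show False by linarith
      qed
      show ?thesis
      proof (cases "s \<le> a \<and> b \<le> e")
        case True
        \<comment> \<open>The interval lies inside the copy. Moving it back keeps its length and
          hence the bound, and decreases its right end.\<close>
        define a' b' where "a' = a - s" and "b' = b - s"
        have eq: "a = 16 ^ n + a'" "b = 16 ^ n + b'" using True ab by (auto simp: a'_def b'_def s_def)
        have "b' \<le> 4 ^ n" using True by (auto simp: b'_def s_def e_def)
        then have "card (defects \<theta> L a b) \<le> card (defects \<theta> L a' b')"
          unfolding eq by (rule card_defects_copy[OF n])
        moreover have "b' < b" "a' \<le> b'" using eq less.prems by auto
        ultimately have "card (defects \<theta> L a b) \<le> (30 * L + 24 * q + 48) * (sqrt (real b' - real a') + 1)"
          using less.IH[of b' a'] by linarith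
        then show ?thesis by (simp add: eq)
      next
        case notin: False
        define s' e' where "s' = max a s" and "e' = min b e"
        have s'e': "a \<le> s'" "s' < e'" "e' \<le> b" "s \<le> s'" "e' \<le> e"
          using ab se less.prems late by (auto simp: s'_def e'_def)
        have "card (defects \<theta> L a s') \<le> C * X"
          using only s'e' by (intro free) (auto simp: s'_def max_def split: if_splits)
        moreover have "card (defects \<theta> L e' b) \<le> C * X"
          using only s'e' by (intro free) (auto simp: e'_def min_def split: if_splits)
        moreover have "card (defects \<theta> L s' e') \<le> C * X"
        proof -
          define u v where "u = s' - s" and "v = e' - s"
          have eq: "s' = 16 ^ n + u" "e' = 16 ^ n + v" using s'e' by (auto simp: u_def v_def s_def)
          have v: "v \<le> 4 ^ n" using s'e' by (auto simp: v_def e_def s_def)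
          have "card (defects \<theta> L s' e') \<le> card (defects \<theta> L u v)"
            unfolding eq by (rule card_defects_copy[OF n v])
          moreover have "card (defects \<theta> L u v) \<le> C * X"
          proof (cases "2 * u \<le> v")
            case True
            then show ?thesis using s'e' by (intro early) (auto simp: u_def v_def)
          next
            case False
            then have "a \<ge> s" "u = a - s" by (auto simp: u_def s'_def max_def split: if_splits)
            then have "v = 4 ^ n" using notin by (auto simp: v_def e'_def e_def s_def)
            \<comment> \<open>Copied stretches starting below \<open>4 ^ n\<close> start at a power
              of 16 that is at most a quarter of it, because an even power of 4 below
              \<open>4 ^ n\<close> must drop a factor 4 in this situation or more; so they end
              before half of \<open>v\<close>, while \<open>u\<close> lies beyond that half.\<close>
            have "{u..<v} \<inter> copied q = {}"
            proof (rule ccontr)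
              assume "{u..<v} \<inter> copied q \<noteq> {}"
              then obtain j n' where j: "u \<le> j" "j < v" "16 ^ n' \<le> j" "j < 16 ^ n' + 4 ^ n'"
                by (auto simp: copied_def)
              have "(4::nat) ^ (2 * n') < 4 ^ n"
                using j \<open>v = 4 ^ n\<close> by (simp add: power_mult)
              then have "Suc (2 * n') \<le> n" by (simp add: power_strict_increasing_iff)
              then have "(4::nat) ^ Suc (2 * n') \<le> 4 ^ n" by (intro power_increasing) auto
              then have "4 * 16 ^ n' \<le> v" using \<open>v = 4 ^ n\<close> by (simp add: power_mult)
              moreover have "(4::nat) ^ n' \<le> 16 ^ n'" by (intro power_mono) auto
              ultimately have "2 * j \<le> v" using j by linarith
              then show False using j False by linarith
            qed
            then show ?thesis using s'e' by (intro free') (auto simp: u_def v_def)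
          qed
          ultimately show ?thesis by linarith
        qed
        moreover have "card (defects \<theta> L a b) \<le> card (defects \<theta> L a s') + card (defects \<theta> L s' e') + card (defects \<theta> L e' b) + 2 * L"
          using card_defects_split[of \<theta> L a b s'] card_defects_split[of \<theta> L s' b e'] by linarith
        ultimately have "real (card (defects \<theta> L a b)) \<le> 3 * (C * X) + 2 * L" by linarith
        also have "\<dots> \<le> 3 * (C * X) + 2 * L * X" using X mult_left_mono[of 1 X "real (2 * L)"] by simp
        also have "\<dots> \<le> (30 * L + 24 * q + 48) * X"
        proof -
          have "0 \<le> real L * X" using X by simp
          then show ?thesis by (simp add: C_def algebra_simps)
        qed
        finally show ?thesis by (simp add: X_def)
      qed
    qed
  qed
qed

text \<open>The number of defects grows like the square root of the window length, uniformly in the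
  position. It is applied to occurrences of a word that no orbit in \<open>cols\<close>
  contains.\<close>

lemma banach_upper_defects:
  assumes "L > 0" "S \<subseteq> {j. \<not> factor (pt \<theta>) L j}"
  shows "banach_upper S \<le> 0"
proof (rule banach_upper_le_0I)
  fix \<epsilon> :: real assume e: "\<epsilon> > 0"
  define C where "C = real (30 * L + 24 * q + 48)"
  have C: "C > 0" by (simp add: C_def)
  define K where "K = \<epsilon> * L + C * C / \<epsilon> + C"
  have "card (S \<inter> {m..<m + n}) \<le> \<epsilon> * n + K" for m n
  proof -
    define t where "t = sqrt (n + L)"
    have t: "t * t = real n + L" by (simp add: t_def)
    have "S \<inter> {m..<m + n} \<subseteq> defects \<theta> L m (m + n + L)" using assms(2) by (auto simp: defects_def)
    then have "card (S \<inter> {m..<m + n}) \<le> card (defects \<theta> L m (m + n + L))" by (intro card_mono) auto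
    then have "real (card (S \<inter> {m..<m + n})) \<le> C * (t + 1)"
      using card_defects_le[OF assms(1), of m "m + n + L" \<theta>] by (simp add: C_def t_def add_ac)
    \<comment> \<open>Sublinearity of the root: either \<open>t\<close> is at most
      \<open>C / \<epsilon>\<close>, and the constant pays, or \<open>C\<close> is at most
      \<open>\<epsilon> * t\<close>, and \<open>\<epsilon> * t * t\<close> pays.\<close>
    moreover have "C * t \<le> \<epsilon> * (n + L) + C * C / \<epsilon>"
    proof (cases "t \<le> C / \<epsilon>")
      case True
      then have "C * t \<le> C * (C / \<epsilon>)" using C by (intro mult_left_mono) auto
      moreover have "0 \<le> \<epsilon> * (real n + L)" using e by simp
      ultimately show ?thesis by simp
    next
      case False
      then have "C \<le> \<epsilon> * t" using e by (simp add: field_simps)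
      moreover have "0 \<le> t" by (simp add: t_def)
      ultimately have "C * t \<le> \<epsilon> * t * t" by (intro mult_right_mono)
      then have "C * t \<le> \<epsilon> * (n + L)" by (simp add: t[symmetric] mult.assoc)
      moreover have "0 \<le> C * C / \<epsilon>" using e C by simp
      ultimately show ?thesis by linarith
    qed
    ultimately show ?thesis by (simp add: K_def algebra_simps)
  qed
  then show "\<exists>K. \<forall>m n. card (S \<inter> {m..<m + n}) \<le> \<epsilon> * n + K" by blast
qed

text \<open>The integral of \<open>\<Phi>\<close> against the uniform invariant measure on the
  periodic orbit of \<open>P c\<close>.\<close>

definition orbit_mean :: "nat \<Rightarrow> ((nat \<Rightarrow> nat) \<Rightarrow> real) \<Rightarrow> real" where
  "orbit_mean c \<Phi> = (\<Sum>d<q. \<Phi> (\<lambda>i. P c (d + i))) / q"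

definition regime_mean :: "((nat \<Rightarrow> nat) \<Rightarrow> real) \<Rightarrow> bool \<Rightarrow> real" where
  "regime_mean \<Phi> r = lam r * orbit_mean (lo r) \<Phi> + (1 - lam r) * orbit_mean (hi r) \<Phi>"

lemma P_Sigma: "(\<lambda>i. P c (d + i)) \<in> Sigma_k k"
  using P_less by (simp add: Sigma_k_def)

lemma P_periodic': "P c (d + q + i) = P c (d + i)"
  using P_periodic[of c "d + i"] by (simp add: add_ac)

text \<open>Three errors: \<open>\<epsilon>\<close> at each position whose next \<open>J\<close>
  symbols stay in the run, \<open>2 * B\<close> at each of the last \<open>J\<close> positions, and
  an incomplete period. Only the first grows with the length of the run.\<close>

lemma run_sum:
  fixes \<epsilon> B :: real and J :: nat
  assumes x: "x \<in> Sigma_k k" and run: "\<And>j. u \<le> j \<Longrightarrow> j < u + n \<Longrightarrow> x j = P c (j + d)"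
    and J: "\<And>x y. x \<in> Sigma_k k \<Longrightarrow> y \<in> Sigma_k k \<Longrightarrow> (\<And>i. i < J \<Longrightarrow> x i = y i) \<Longrightarrow> \<bar>\<Phi> x - \<Phi> y\<bar> \<le> \<epsilon>"
    and B: "\<And>x. x \<in> Sigma_k k \<Longrightarrow> \<bar>\<Phi> x\<bar> \<le> B" and e: "\<epsilon> \<ge> 0"
  shows "\<bar>(\<Sum>j\<in>{u..<u + n}. \<Phi> (\<lambda>i. x (j + i))) - n * orbit_mean c \<Phi>\<bar> \<le> \<epsilon> * n + 2 * B * J + 2 * B * q"
proof -
  have B0: "0 \<le> B" using B[OF x] by linarith
  define f where "f j = \<Phi> (\<lambda>i. P c (j + d + i))" for j
  define g where "g j = \<Phi> (\<lambda>i. x (j + i))" for j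
  have fB: "\<bar>f j\<bar> \<le> B" for j unfolding f_def by (rule B[OF P_Sigma])
  have gB: "\<bar>g j\<bar> \<le> B" for j unfolding g_def using x by (intro B) (auto simp: Sigma_k_def)
  have per: "f (j + q) = f j" for j
    unfolding f_def using P_periodic'[of c "j + d"] by (simp add: add_ac)
  have mean: "(\<Sum>j<q. f j) / q = orbit_mean c \<Phi>"
  proof -
    have "(\<Sum>j\<in>{d..<d + q}. \<Phi> (\<lambda>i. P c (j + i))) = (\<Sum>j<q. \<Phi> (\<lambda>i. P c (j + i)))"
      by (rule sum_periodic_shift) (simp add: P_periodic')
    moreover have "(\<Sum>j\<in>{d..<d + q}. \<Phi> (\<lambda>i. P c (j + i))) = (\<Sum>j<q. f j)"
      using sum.shift_bounds_nat_ivl[of "\<lambda>j. \<Phi> (\<lambda>i. P c (j + i))" 0 d q]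
      by (simp add: f_def atLeast0LessThan add_ac)
    ultimately show ?thesis by (simp add: orbit_mean_def)
  qed
  have "\<bar>g j - f j\<bar> \<le> \<epsilon> + (if j + J \<le> u + n then 0 else 2 * B)" if "j \<in> {u..<u + n}" for j
  proof (cases "j + J \<le> u + n")
    case True
    have "\<bar>g j - f j\<bar> \<le> \<epsilon>" unfolding g_def f_def
    proof (rule J)
      show "(\<lambda>i. x (j + i)) \<in> Sigma_k k" using x by (auto simp: Sigma_k_def)
      show "x (j + i) = P c (j + d + i)" if "i < J" for i
        using run[of "j + i"] that True \<open>j \<in> _\<close> by (simp add: add_ac)
    qed (rule P_Sigma)
    then show ?thesis using True by simp
  next
    case False
    then show ?thesis using fB[of j] gB[of j] e by simp
  qed
  then have "(\<Sum>j\<in>{u..<u + n}. \<bar>g j - f j\<bar>) \<le> (\<Sum>j\<in>{u..<u + n}. \<epsilon> + (if j + J \<le> u + n then 0 else 2 * B))"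
    by (rule sum_mono)
  also have "\<dots> = \<epsilon> * n + (\<Sum>j\<in>{u..<u + n}. if j + J \<le> u + n then 0 else 2 * B)"
    by (simp add: sum.distrib)
  also have "(\<Sum>j\<in>{u..<u + n}. if j + J \<le> u + n then 0 else 2 * B) \<le> (\<Sum>j\<in>{u + n - J..<u + n}. 2 * B)"
  proof -
    have "(\<Sum>j\<in>{u..<u + n}. if j + J \<le> u + n then 0 else 2 * B) =
        (\<Sum>j\<in>{u..<u + n} \<inter> {j. \<not> j + J \<le> u + n}. 2 * B)"
      by (subst sum.inter_restrict) (auto intro: sum.cong)
    also have "\<dots> \<le> (\<Sum>j\<in>{u + n - J..<u + n}. 2 * B)"
      using B0 by (intro sum_mono2) auto
    finally show ?thesis .
  qed
  also have "\<dots> \<le> 2 * B * J"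
  proof -
    have "real (u + n - (u + n - J)) * (2 * B) \<le> real J * (2 * B)"
      using B0 by (intro mult_right_mono) auto
    then show ?thesis by (simp add: mult_ac)
  qed
  finally have "\<bar>(\<Sum>j\<in>{u..<u + n}. g j) - (\<Sum>j\<in>{u..<u + n}. f j)\<bar> \<le> \<epsilon> * n + 2 * B * J"
    using sum_abs[of "\<lambda>j. g j - f j" "{u..<u + n}"] by (simp add: sum_subtractf)
  moreover have "\<bar>(\<Sum>j\<in>{u..<u + n}. f j) - n * orbit_mean c \<Phi>\<bar> \<le> 2 * B * q"
    using sum_periodic_interval[of f q B u n] per fB q_pos by (simp add: mean)
  ultimately show ?thesis unfolding g_def by linarith
qed

lemma orbit_mean_bound:
  assumes B: "\<And>x. x \<in> Sigma_k k \<Longrightarrow> \<bar>\<Phi> x\<bar> \<le> B"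
  shows "\<bar>orbit_mean c \<Phi>\<bar> \<le> B"
proof -
  have "\<bar>\<Sum>d<q. \<Phi> (\<lambda>i. P c (d + i))\<bar> \<le> (\<Sum>d<q. \<bar>\<Phi> (\<lambda>i. P c (d + i))\<bar>)" by (rule sum_abs)
  also have "\<dots> \<le> (\<Sum>d<q. B)" by (intro sum_mono B P_Sigma)
  finally show ?thesis using q_pos by (simp add: orbit_mean_def divide_le_eq mult.commute)
qed

text \<open>The averages follow the regime of the current epoch. Uniform continuity is stated
  through common prefixes so that the lemma applies both to the given function and to indicators of
  cylinders, whose averages are occurrence frequencies.\<close>

lemma avg_pt_tendsto:
  assumes unif: "\<And>\<epsilon>::real. \<epsilon> > 0 \<Longrightarrow> \<exists>J. \<forall>x\<in>Sigma_k k. \<forall>y\<in>Sigma_k k. (\<forall>i<J. x i = y i) \<longrightarrow> \<bar>\<Phi> x - \<Phi> y\<bar> \<le> \<epsilon>"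
    and B: "\<And>x. x \<in> Sigma_k k \<Longrightarrow> \<bar>\<Phi> x\<bar> \<le> B"
  shows "avg (\<lambda>j. \<Phi> (\<lambda>i. pt \<theta> (j + i)) - regime_mean \<Phi> (even (epoch (floor_sqrt j)))) \<longlonglongrightarrow> 0"
proof (rule avg_tendsto_0_of_blocks)
  have oB: "\<bar>orbit_mean c \<Phi>\<bar> \<le> B" for c by (rule orbit_mean_bound[OF B])
  have B0: "0 \<le> B" using oB[of 0] by linarith
  have rB: "\<bar>regime_mean \<Phi> r\<bar> \<le> B" for r
  proof -
    have "\<bar>regime_mean \<Phi> r\<bar> \<le> lam r * \<bar>orbit_mean (lo r) \<Phi>\<bar> + (1 - lam r) * \<bar>orbit_mean (hi r) \<Phi>\<bar>"
      unfolding regime_mean_def using lam[of r]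
      by (intro order_trans[OF abs_triangle_ineq]) (simp add: abs_mult)
    also have "\<dots> \<le> lam r * B + (1 - lam r) * B"
      using lam[of r] by (intro add_mono mult_left_mono oB) auto
    finally show ?thesis by (simp add: algebra_simps)
  qed
  have gB: "\<bar>\<Phi> (\<lambda>i. pt \<theta> (j + i))\<bar> \<le> B" for j
    using pt_Sigma[of \<theta>] by (intro B) (auto simp: Sigma_k_def)
  show "\<bar>\<Phi> (\<lambda>i. pt \<theta> (j + i)) - regime_mean \<Phi> (even (epoch (floor_sqrt j)))\<bar> \<le> 2 * B" for j
    using gB[of j] rB[of "even (epoch (floor_sqrt j))"] by linarith
  fix \<epsilon> :: real assume e: "\<epsilon> > 0"
  obtain J where J: "\<And>x y. x \<in> Sigma_k k \<Longrightarrow> y \<in> Sigma_k k \<Longrightarrow> (\<And>i. i < J \<Longrightarrow> x i = y i) \<Longrightarrow> \<bar>\<Phi> x - \<Phi> y\<bar> \<le> \<epsilon> / 2"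
    using unif[OF half_gt_zero[OF e]] by blast
  \<comment> \<open>Errors per block that do not grow with \<open>m\<close>: those of the two runs,
    and \<open>2 * B\<close> for rounding the length of the low run.\<close>
  define D where "D = 2 * (2 * B * J + 2 * B * q) + 2 * B"
  obtain M where M: "D / (\<epsilon> / 2) \<le> real M" using real_arch_simple by blast
  show "\<exists>M. \<forall>m\<ge>M. m \<notin> range ((^) 2) \<longrightarrow>
    \<bar>\<Sum>j\<in>{m\<^sup>2..<(Suc m)\<^sup>2}. \<Phi> (\<lambda>i. pt \<theta> (j + i)) - regime_mean \<Phi> (even (epoch (floor_sqrt j)))\<bar> \<le> \<epsilon> * (2 * real m + 1)"
  proof (intro exI[of _ "M + Suc q"] allI impI)
    fix m assume m: "m \<ge> M + Suc q" "m \<notin> range ((^) 2)"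
    then have mq: "m > q" by simp
    define r l u where "r = even (epoch m)" and "l = ell r m" and "u = m\<^sup>2"
    define g where "g j = \<Phi> (\<lambda>i. pt \<theta> (j + i))" for j
    have l: "l \<le> 2 * m + 1" unfolding l_def by (rule ell_le)
    define h where "h = 2 * m + 1 - l"
    have hl: "h + l = 2 * m + 1" using l by (simp add: h_def)
    have end_eq: "(Suc m)\<^sup>2 = u + l + h" using hl by (simp add: u_def power2_eq_square)
    have "(\<Sum>j\<in>{m\<^sup>2..<(Suc m)\<^sup>2}. g j - regime_mean \<Phi> (even (epoch (floor_sqrt j)))) =
        (\<Sum>j\<in>{m\<^sup>2..<(Suc m)\<^sup>2}. g j - regime_mean \<Phi> r)"
    proof (rule sum.cong[OF refl])
      fix j assume "j \<in> {m\<^sup>2..<(Suc m)\<^sup>2}"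
      then have "floor_sqrt j = m" unfolding floor_sqrt_eq_iff .
      then show "g j - regime_mean \<Phi> (even (epoch (floor_sqrt j))) = g j - regime_mean \<Phi> r" by (simp add: r_def)
    qed
    also have "\<dots> = (\<Sum>j\<in>{m\<^sup>2..<(Suc m)\<^sup>2}. g j) - (2 * real m + 1) * regime_mean \<Phi> r"
      unfolding sum_subtractf sum_constant card_sqrt_block by simp
    also have "(\<Sum>j\<in>{m\<^sup>2..<(Suc m)\<^sup>2}. g j) = (\<Sum>j\<in>{u..<u + l}. g j) + (\<Sum>j\<in>{u + l..<u + l + h}. g j)"
      unfolding end_eq u_def[symmetric] by (subst sum.atLeastLessThan_concat) auto
    also have "\<dots> - (2 * real m + 1) * regime_mean \<Phi> r =
        ((\<Sum>j\<in>{u..<u + l}. g j) - l * orbit_mean (lo r) \<Phi>) +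
        ((\<Sum>j\<in>{u + l..<u + l + h}. g j) - h * orbit_mean (hi r) \<Phi>) +
        (l - lam r * (2 * real m + 1)) * (orbit_mean (lo r) \<Phi> - orbit_mean (hi r) \<Phi>)"
    proof -
      have S: "2 * real m + 1 = real l + real h" using hl by linarith
      show ?thesis unfolding S regime_mean_def by (simp add: algebra_simps)
    qed
    also have "\<bar>\<dots>\<bar> \<le> (\<epsilon> / 2 * l + 2 * B * J + 2 * B * q) + (\<epsilon> / 2 * h + 2 * B * J + 2 * B * q) + 2 * B"
    proof -
      have "\<bar>(\<Sum>j\<in>{u..<u + l}. g j) - l * orbit_mean (lo r) \<Phi>\<bar> \<le> \<epsilon> / 2 * l + 2 * B * J + 2 * B * q"
        unfolding g_def
      proof (rule run_sum[where d = "\<theta> (epoch m)"])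
        show "pt \<theta> j = P (lo r) (j + \<theta> (epoch m))" if "u \<le> j" "j < u + l" for j
          using pt_run_lo[OF mq m(2)] that by (simp add: r_def l_def u_def)
      qed (use J B pt_Sigma e in auto)
      moreover have "\<bar>(\<Sum>j\<in>{u + l..<u + l + h}. g j) - h * orbit_mean (hi r) \<Phi>\<bar> \<le> \<epsilon> / 2 * h + 2 * B * J + 2 * B * q"
        unfolding g_def
      proof (rule run_sum[where d = "\<theta> (epoch m)"])
        show "pt \<theta> j = P (hi r) (j + \<theta> (epoch m))" if "u + l \<le> j" "j < u + l + h" for j
          using pt_run_hi[OF mq m(2)] that by (simp add: r_def l_def u_def[symmetric] end_eq)
      qed (use J B pt_Sigma e in auto)
      moreover have "\<bar>(l - lam r * (2 * real m + 1)) * (orbit_mean (lo r) \<Phi> - orbit_mean (hi r) \<Phi>)\<bar> \<le> 1 * (2 * B)"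
        unfolding abs_mult
      proof (rule mult_mono)
        show "\<bar>l - lam r * (2 * real m + 1)\<bar> \<le> 1" unfolding l_def by (rule ell_real)
        show "\<bar>orbit_mean (lo r) \<Phi> - orbit_mean (hi r) \<Phi>\<bar> \<le> 2 * B"
          using oB[of "lo r"] oB[of "hi r"] by linarith
      qed auto
      ultimately show ?thesis by linarith
    qed
    also have "\<dots> = \<epsilon> / 2 * (2 * real m + 1) + D"
    proof -
      have "real l + real h = 2 * real m + 1" using hl by linarith
      then have "\<epsilon> / 2 * (2 * real m + 1) = \<epsilon> / 2 * l + \<epsilon> / 2 * h" by (metis distrib_left)
      then show ?thesis by (simp add: D_def)
    qed
    also have "D \<le> \<epsilon> / 2 * (2 * real m + 1)"
    proof -
      have "D / (\<epsilon> / 2) \<le> 2 * real m + 1" using M m(1) by linarith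
      then show ?thesis using e by (simp add: field_simps)
    qed
    finally show "\<bar>\<Sum>j\<in>{m\<^sup>2..<(Suc m)\<^sup>2}. \<Phi> (\<lambda>i. pt \<theta> (j + i)) - regime_mean \<Phi> (even (epoch (floor_sqrt j)))\<bar> \<le> \<epsilon> * (2 * real m + 1)"
      by (simp add: g_def)
  qed
qed

end

subsection \<open>Limit sets and scrambled pairs of the construction\<close>

lemma liminf_leI:
  fixes f :: "nat \<Rightarrow> ereal"
  assumes "\<And>N. \<exists>n\<ge>N. f n \<le> c" shows "liminf f \<le> c"
  unfolding liminf_SUP_INF
proof (rule SUP_least)
  fix N :: nat
  obtain n where "n \<ge> N" "f n \<le> c" using assms by blast
  then show "(INF m\<in>{N..}. f m) \<le> c" by (intro INF_lower2[of n]) auto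
qed

lemma limsup_geI:
  fixes f :: "nat \<Rightarrow> ereal"
  assumes "\<And>N. \<exists>n\<ge>N. c \<le> f n" shows "c \<le> limsup f"
  unfolding limsup_INF_SUP
proof (rule INF_greatest)
  fix N :: nat
  obtain n where "n \<ge> N" "c \<le> f n" using assms by blast
  then show "c \<le> (SUP m\<in>{N..}. f m)" by (intro SUP_upper2[of n]) auto
qed

lemma avg_diff: "avg (\<lambda>j. s j - t j) n = avg s n - avg t n"
  by (simp add: avg_def sum_subtractf diff_divide_distrib)

lemma birkhoff_avg_eq: "birkhoff_avg \<Phi> x = avg (\<lambda>j. \<Phi> (\<lambda>i. x (j + i)))"
  by (rule ext) (simp add: birkhoff_avg_def avg_def shift_funpow)

section \<open>Occurrence frequencies as averages of cylinder indicators\<close>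

definition cyl :: "(nat \<Rightarrow> nat) \<Rightarrow> nat \<Rightarrow> (nat \<Rightarrow> nat) \<Rightarrow> real" where
  "cyl y L z = (if \<forall>i<L. z i = y i then 1 else 0)"

text \<open>Densities count the positions 1 to n, Birkhoff sums the positions 0 to n - 1; the two
  counts differ in one term at each end.\<close>

lemma card_occ_cyl:
  "\<bar>real (card (occ x y L \<inter> {1..n})) - (\<Sum>j<n. cyl y L (\<lambda>i. x (j + i)))\<bar> \<le> 1"
proof -
  define f where "f j = cyl y L (\<lambda>i. x (j + i))" for j
  have f: "0 \<le> f j" "f j \<le> 1" for j by (auto simp: f_def cyl_def)
  have "real (card (occ x y L \<inter> {1..n})) = (\<Sum>j\<in>occ x y L \<inter> {1..n}. 1)" by simp
  also have "\<dots> = (\<Sum>j\<in>occ x y L \<inter> {1..n}. f j)"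
    by (rule sum.cong) (auto simp: f_def cyl_def occ_def)
  also have "\<dots> = (\<Sum>j\<in>{1..n}. f j)"
    by (rule sum.mono_neutral_left) (auto simp: f_def cyl_def occ_def)
  finally have 1: "real (card (occ x y L \<inter> {1..n})) = (\<Sum>j\<in>{1..n}. f j)" .
  have "(\<Sum>j\<in>{1..n}. f j) + f 0 = (\<Sum>j<Suc n. f j)"
  proof -
    have "{..<Suc n} = insert 0 {1..n}" by auto
    then show ?thesis by simp
  qed
  then have "(\<Sum>j\<in>{1..n}. f j) - (\<Sum>j<n. f j) = f n - f 0" by simp
  then show ?thesis using 1 f[of 0] f[of n] unfolding f_def by linarith
qed

lemma epoch_error_tendsto:
  fixes C :: real
  shows "(\<lambda>e. epoch_start e / epoch_start (Suc e) + C * (sqrt (epoch_start (Suc e)) + 1) / epoch_start (Suc e)) \<longlonglongrightarrow> 0"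
proof -
  have "filterlim (\<lambda>e. epoch_start (Suc e)) at_top sequentially"
    by (rule filterlim_at_top_mono[OF filterlim_Suc])
       (use le_epoch_start in \<open>auto intro!: always_eventually\<close>)
  moreover have "(\<lambda>n. C * (sqrt (real n) + 1) / real n) \<longlonglongrightarrow> 0" by real_asymp
  ultimately have "(\<lambda>e. C * (sqrt (epoch_start (Suc e)) + 1) / epoch_start (Suc e)) \<longlonglongrightarrow> 0"
    by (rule filterlim_compose[rotated])
  from tendsto_add[OF epoch_ratio_tendsto this] show ?thesis by simp
qed

text \<open>The first condition makes a displacement by one position visible, as DC1 requires; the
  second lets limit sets be told apart by colours.\<close>

locale separated_construction = shift_construction +
  assumes no_fixed: "c \<in> cols \<Longrightarrow> (\<lambda>i. P c (d + i)) \<noteq> (\<lambda>i. P c (Suc d + i))"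
    and disjoint_orbits: "c \<in> cols \<Longrightarrow> c' \<in> cols \<Longrightarrow> c \<noteq> c' \<Longrightarrow> (\<lambda>i. P c (d + i)) \<noteq> (\<lambda>i. P c' (d' + i))"
begin

lemma P_mod: "P c (d + i) = P c (d + i mod q)"
proof -
  have "P c (d + (i mod q + q * n)) = P c (d + i mod q)" for n
  proof (induction n)
    case (Suc n)
    then show ?case using P_periodic[of c "d + (i mod q + q * n)"] by (simp add: add_ac)
  qed simp
  then show ?thesis by (metis mod_mult_div_eq)
qed

lemma P_window_ext:
  assumes "\<And>i. i < q \<Longrightarrow> P c (d + i) = P c' (d' + i)"
  shows "(\<lambda>i. P c (d + i)) = (\<lambda>i. P c' (d' + i))"
proof
  fix i
  show "P c (d + i) = P c' (d' + i)"
    using assms[of "i mod q"] q_pos by (simp add: P_mod[of c d i] P_mod[of c' d' i])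
qed

text \<open>Both frequencies are measured at the end of an epoch, where this epoch makes up almost
  all positions. With equal displacements the windows agree; with displacements 0 and 1 they would
  exhibit a fixed point if they agreed.\<close>

lemma DC1_pair_pt:
  assumes agree: "\<And>N. \<exists>e\<ge>N. \<theta> e = \<theta>' e"
    and differ: "\<And>N. \<exists>e\<ge>N. {\<theta> e, \<theta>' e} = {0, 1}"
  shows "DC1_pair (pt \<theta>) (pt \<theta>')"
proof -
  let ?close = "\<lambda>s n. {i. i < n \<and> sdist ((shift ^^ i) (pt \<theta>)) ((shift ^^ i) (pt \<theta>')) < s}"
  let ?bad = "\<lambda>L n. {j. j < n \<and> (j \<in> badw L \<or> floor_sqrt j \<in> range ((^) 2))}"
  \<comment> \<open>Bounds the share of positions that belong to earlier epochs or whose window of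
    length \<open>L\<close> is not known to follow one run.\<close>
  define err where "err L e = epoch_start e / epoch_start (Suc e) +
    real (4 * L + 4 * q + 8) * (sqrt (epoch_start (Suc e)) + 1) / epoch_start (Suc e)" for L e
  have bad: "(real (epoch_start e) + real (card (?bad L (epoch_start (Suc e))))) / epoch_start (Suc e) \<le> err L e" for L e
    unfolding err_def add_divide_distrib[symmetric]
    using card_badw_two_powers_le[of "epoch_start (Suc e)" L] by (intro divide_right_mono) auto
  have err_small: "\<exists>E. \<forall>e\<ge>E. err L e \<le> \<epsilon>" if "\<epsilon> > 0" for L \<epsilon>
  proof -
    have "eventually (\<lambda>e. err L e < \<epsilon>) sequentially"
      unfolding err_def by (rule order_tendstoD(2)[OF epoch_error_tendsto that])
    then show ?thesis by (meson eventually_sequentially less_imp_le)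
  qed
  have window: "\<exists>c\<in>cols. \<forall>\<theta>. \<forall>i<L. pt \<theta> (j + i) = P c (j + i + \<theta> e)"
    if j: "epoch_start e \<le> j" "j < epoch_start (Suc e)" "j \<notin> ?bad L (epoch_start (Suc e))" for e j L
  proof -
    have "j \<notin> badw L" "floor_sqrt j \<notin> range ((^) 2)" using j by auto
    from pt_window[OF this] show ?thesis unfolding epoch_eq[OF j(1,2)]
      using lo_cols hi_cols by blast
  qed
  \<comment> \<open>Distance below \<open>1 / 2 ^ q\<close> forces agreement on a full period, which
    \<open>P_window_ext\<close> extends to the whole periodic sequence.\<close>
  have le: "liminf (close_freq (pt \<theta>) (pt \<theta>') (1 / 2 ^ q)) \<le> ereal \<epsilon>" if e0: "\<epsilon> > 0" for \<epsilon>
  proof (rule liminf_leI)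
    fix N
    obtain E where E: "\<And>e. e \<ge> E \<Longrightarrow> err q e \<le> \<epsilon>" using err_small[OF e0] by blast
    obtain e where e: "e \<ge> max N E" "{\<theta> e, \<theta>' e} = {0, 1}" using differ[of "max N E"] by blast
    let ?n = "epoch_start (Suc e)"
    have "?close (1 / 2 ^ q) ?n \<subseteq> {..<epoch_start e} \<union> ?bad q ?n"
    proof
      fix j assume j: "j \<in> ?close (1 / 2 ^ q) ?n"
      show "j \<in> {..<epoch_start e} \<union> ?bad q ?n"
      proof (rule ccontr)
        assume nj: "j \<notin> {..<epoch_start e} \<union> ?bad q ?n"
        then obtain c where c: "c \<in> cols" "\<And>\<theta> i. i < q \<Longrightarrow> pt \<theta> (j + i) = P c (j + i + \<theta> e)"
          using window[of e j q] j by auto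
        have "P c (j + i + \<theta> e) = P c (j + i + \<theta>' e)" if "i < q" for i
          using j agree_of_sdist_less[of "(shift ^^ j) (pt \<theta>)" "(shift ^^ j) (pt \<theta>')" q i] that c(2)
          by (simp add: shift_funpow)
        moreover have "\<theta> e = 0 \<and> \<theta>' e = 1 \<or> \<theta> e = 1 \<and> \<theta>' e = 0" using e(2) by (auto simp: doubleton_eq_iff)
        ultimately have "P c (j + i) = P c (Suc j + i)" if "i < q" for i
          using that by fastforce
        then show False using P_window_ext[of c j c "Suc j"] no_fixed[OF c(1), of j] by blast
      qed
    qed
    then have "card (?close (1 / 2 ^ q) ?n) \<le> card ({..<epoch_start e} \<union> ?bad q ?n)"
      by (intro card_mono) auto
    also have "\<dots> \<le> card {..<epoch_start e} + card (?bad q ?n)" by (rule card_Un_le)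
    finally have "real (card (?close (1 / 2 ^ q) ?n)) \<le> real (epoch_start e) + real (card (?bad q ?n))"
      by simp
    then have "real (card (?close (1 / 2 ^ q) ?n)) / ?n \<le> (real (epoch_start e) + real (card (?bad q ?n))) / ?n"
      by (intro divide_right_mono) auto
    also have "\<dots> \<le> err q e" by (rule bad)
    finally have "real (card (?close (1 / 2 ^ q) ?n)) / ?n \<le> err q e" .
    moreover have "err q e \<le> \<epsilon>" using E e by simp
    ultimately have "close_freq (pt \<theta>) (pt \<theta>') (1 / 2 ^ q) ?n \<le> ereal \<epsilon>"
      by (simp add: close_freq_def)
    moreover have "?n \<ge> N" using le_epoch_start[of "Suc e"] e(1) by linarith
    ultimately show "\<exists>n\<ge>N. close_freq (pt \<theta>) (pt \<theta>') (1 / 2 ^ q) n \<le> ereal \<epsilon>" by blast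
  qed
  have "liminf (close_freq (pt \<theta>) (pt \<theta>') (1 / 2 ^ q)) \<le> 0"
    by (rule ereal_le_epsilon2) (simp add: le)
  moreover have "0 \<le> liminf (close_freq (pt \<theta>) (pt \<theta>') (1 / 2 ^ q))"
    by (intro Liminf_bounded always_eventually) (auto simp: close_freq_def)
  ultimately have l: "liminf (close_freq (pt \<theta>) (pt \<theta>') (1 / 2 ^ q)) = 0" by simp
  have u: "limsup (close_freq (pt \<theta>) (pt \<theta>') t) = 1" if "t > 0" for t
  proof -
    obtain L where L: "1 / 2 ^ L < t" using ex_half_pow_less \<open>t > 0\<close> by blast
    have "ereal (1 - \<epsilon>) \<le> limsup (close_freq (pt \<theta>) (pt \<theta>') t)" if e0: "\<epsilon> > 0" for \<epsilon>
    proof (rule limsup_geI)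
      fix N
      obtain E where E: "\<And>e. e \<ge> E \<Longrightarrow> err L e \<le> \<epsilon>" using err_small[OF e0] by blast
      obtain e where e: "e \<ge> max N E" "\<theta> e = \<theta>' e" using agree[of "max N E"] by blast
      let ?n = "epoch_start (Suc e)"
      have "{..<?n} \<subseteq> (?close t ?n \<union> {..<epoch_start e}) \<union> ?bad L ?n"
      proof
        fix j assume j: "j \<in> {..<?n}"
        have "sdist ((shift ^^ j) (pt \<theta>)) ((shift ^^ j) (pt \<theta>')) < t"
          if nj: "j \<notin> {..<epoch_start e} \<union> ?bad L ?n"
        proof -
          obtain c where c: "\<And>\<theta> i. i < L \<Longrightarrow> pt \<theta> (j + i) = P c (j + i + \<theta> e)"
            using window[of e j L] j nj by auto
          have "sdist ((shift ^^ j) (pt \<theta>)) ((shift ^^ j) (pt \<theta>')) \<le> 1 / 2 ^ L"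
            by (rule sdist_le_of_agree) (simp add: shift_funpow c e(2))
          then show ?thesis using L by linarith
        qed
        then show "j \<in> (?close t ?n \<union> {..<epoch_start e}) \<union> ?bad L ?n" using j by blast
      qed
      then have "card {..<?n} \<le> card ((?close t ?n \<union> {..<epoch_start e}) \<union> ?bad L ?n)"
        by (intro card_mono) auto
      also have "\<dots> \<le> card (?close t ?n \<union> {..<epoch_start e}) + card (?bad L ?n)" by (rule card_Un_le)
      also have "\<dots> \<le> card (?close t ?n) + card {..<epoch_start e} + card (?bad L ?n)"
        by (intro add_right_mono card_Un_le)
      finally have "real ?n - (real (epoch_start e) + real (card (?bad L ?n))) \<le> real (card (?close t ?n))"
        by simp
      then have "(real ?n - (real (epoch_start e) + real (card (?bad L ?n)))) / ?n \<le> real (card (?close t ?n)) / ?n"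
        by (intro divide_right_mono) auto
      moreover have "real ?n > 0" using epoch_start_pos by simp
      ultimately have "1 - err L e \<le> real (card (?close t ?n)) / ?n"
        using bad[of e L] by (simp add: diff_divide_distrib)
      moreover have "err L e \<le> \<epsilon>" using E e by simp
      ultimately have "ereal (1 - \<epsilon>) \<le> close_freq (pt \<theta>) (pt \<theta>') t ?n"
        by (simp add: close_freq_def)
      moreover have "?n \<ge> N" using le_epoch_start[of "Suc e"] e(1) by linarith
      ultimately show "\<exists>n\<ge>N. ereal (1 - \<epsilon>) \<le> close_freq (pt \<theta>) (pt \<theta>') t n" by blast
    qed
    then have ge: "1 \<le> limsup (close_freq (pt \<theta>) (pt \<theta>') t) + ereal \<epsilon>" if "\<epsilon> > 0" for \<epsilon>
      using add_right_mono[of "ereal (1 - \<epsilon>)" _ "ereal \<epsilon>"] that by (fastforce simp: one_ereal_def)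
    have "1 \<le> limsup (close_freq (pt \<theta>) (pt \<theta>') t)"
      by (rule ereal_le_epsilon2) (simp add: ge)
    moreover have "limsup (close_freq (pt \<theta>) (pt \<theta>') t) \<le> 1"
    proof (intro Limsup_bounded always_eventually allI)
      fix n
      have "card (?close t n) \<le> card {..<n}" by (intro card_mono) auto
      then show "close_freq (pt \<theta>) (pt \<theta>') t n \<le> 1"
        by (simp add: close_freq_def one_ereal_def divide_le_eq)
    qed
    ultimately show ?thesis by simp
  qed
  show ?thesis unfolding DC1_pair_def using l u by (intro conjI exI[of _ "1 / 2 ^ q"]) auto
qed

section \<open>Frequencies along epochs and the membership of orbits in limit sets\<close>

definition orb :: "nat \<Rightarrow> (nat \<Rightarrow> nat) set" where
  "orb c = range (\<lambda>d i. P c (d + i))"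

lemma orb_Sigma: "y \<in> orb c \<Longrightarrow> y \<in> Sigma_k k"
  using P_Sigma by (auto simp: orb_def)

lemma frequently_avg_close:
  assumes unif: "\<And>\<epsilon>::real. \<epsilon> > 0 \<Longrightarrow> \<exists>J. \<forall>x\<in>Sigma_k k. \<forall>y\<in>Sigma_k k. (\<forall>i<J. x i = y i) \<longrightarrow> \<bar>\<Phi> x - \<Phi> y\<bar> \<le> \<epsilon>"
    and B: "\<And>x. x \<in> Sigma_k k \<Longrightarrow> \<bar>\<Phi> x\<bar> \<le> B" and "\<epsilon> > 0"
  shows "\<exists>n\<ge>N. \<bar>avg (\<lambda>j. \<Phi> (\<lambda>i. pt \<theta> (j + i))) n - regime_mean \<Phi> r\<bar> < \<epsilon>"
proof -
  have "eventually (\<lambda>n. \<bar>avg (\<lambda>j. \<Phi> (\<lambda>i. pt \<theta> (j + i))) n - avg (\<lambda>j. regime_mean \<Phi> (even (epoch (floor_sqrt j)))) n\<bar> < \<epsilon> / 2) sequentially"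
    using tendstoD[OF avg_pt_tendsto[OF unif B, of \<theta>], of "\<epsilon> / 2"] assms(3) by (simp add: avg_diff dist_real_def)
  then obtain M where M: "\<And>n. n \<ge> M \<Longrightarrow> \<bar>avg (\<lambda>j. \<Phi> (\<lambda>i. pt \<theta> (j + i))) n - avg (\<lambda>j. regime_mean \<Phi> (even (epoch (floor_sqrt j)))) n\<bar> < \<epsilon> / 2"
    by (auto simp: eventually_sequentially)
  obtain n where "n \<ge> max M N" "\<bar>avg (\<lambda>j. regime_mean \<Phi> (even (epoch (floor_sqrt j)))) n - regime_mean \<Phi> r\<bar> < \<epsilon> / 2"
    using frequently_avg_epoch_close[of "\<epsilon> / 2"] assms(3) half_gt_zero by blast
  moreover from this(1) have "n \<ge> N"
    "\<bar>avg (\<lambda>j. \<Phi> (\<lambda>i. pt \<theta> (j + i))) n - avg (\<lambda>j. regime_mean \<Phi> (even (epoch (floor_sqrt j)))) n\<bar> < \<epsilon> / 2"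
    using M[of n] by simp_all
  ultimately have "\<bar>avg (\<lambda>j. \<Phi> (\<lambda>i. pt \<theta> (j + i))) n - regime_mean \<Phi> r\<bar> < \<epsilon>" by linarith
  with \<open>n \<ge> N\<close> show ?thesis by blast
qed

lemma avg_pt_convergent:
  assumes unif: "\<And>\<epsilon>::real. \<epsilon> > 0 \<Longrightarrow> \<exists>J. \<forall>x\<in>Sigma_k k. \<forall>y\<in>Sigma_k k. (\<forall>i<J. x i = y i) \<longrightarrow> \<bar>\<Phi> x - \<Phi> y\<bar> \<le> \<epsilon>"
    and B: "\<And>x. x \<in> Sigma_k k \<Longrightarrow> \<bar>\<Phi> x\<bar> \<le> B"
    and a: "\<And>r. regime_mean \<Phi> r = a"
  shows "avg (\<lambda>j. \<Phi> (\<lambda>i. pt \<theta> (j + i))) \<longlonglongrightarrow> a"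
proof -
  have "(\<lambda>n. avg (\<lambda>j. \<Phi> (\<lambda>i. pt \<theta> (j + i))) n - avg (\<lambda>j. a) n) \<longlonglongrightarrow> 0"
    using avg_pt_tendsto[OF unif B, of \<theta>] by (simp add: a avg_diff[abs_def])
  moreover have "avg (\<lambda>j. a) \<longlonglongrightarrow> a"
    by (rule tendsto_eventually, rule eventually_sequentiallyI[of 1]) (simp add: avg_def)
  ultimately have "(\<lambda>n. avg (\<lambda>j. \<Phi> (\<lambda>i. pt \<theta> (j + i))) n - avg (\<lambda>j. a) n + avg (\<lambda>j. a) n) \<longlonglongrightarrow> 0 + a"
    by (rule tendsto_add)
  then show ?thesis by simp
qed

lemma avg_pt_divergent:
  assumes unif: "\<And>\<epsilon>::real. \<epsilon> > 0 \<Longrightarrow> \<exists>J. \<forall>x\<in>Sigma_k k. \<forall>y\<in>Sigma_k k. (\<forall>i<J. x i = y i) \<longrightarrow> \<bar>\<Phi> x - \<Phi> y\<bar> \<le> \<epsilon>"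
    and B: "\<And>x. x \<in> Sigma_k k \<Longrightarrow> \<bar>\<Phi> x\<bar> \<le> B"
    and ne: "regime_mean \<Phi> True \<noteq> regime_mean \<Phi> False"
  shows "\<not> convergent (avg (\<lambda>j. \<Phi> (\<lambda>i. pt \<theta> (j + i))))"
proof
  assume "convergent (avg (\<lambda>j. \<Phi> (\<lambda>i. pt \<theta> (j + i))))"
  then obtain l where l: "avg (\<lambda>j. \<Phi> (\<lambda>i. pt \<theta> (j + i))) \<longlonglongrightarrow> l" by (auto simp: convergent_def)
  have "regime_mean \<Phi> r = l" for r
  proof (rule ccontr)
    assume "regime_mean \<Phi> r \<noteq> l"
    then have e: "\<bar>regime_mean \<Phi> r - l\<bar> / 2 > 0" by simp
    from LIMSEQ_D[OF l e] obtain N where N: "\<And>n. n \<ge> N \<Longrightarrow>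
        \<bar>avg (\<lambda>j. \<Phi> (\<lambda>i. pt \<theta> (j + i))) n - l\<bar> < \<bar>regime_mean \<Phi> r - l\<bar> / 2" by auto
    obtain n where "n \<ge> N" "\<bar>avg (\<lambda>j. \<Phi> (\<lambda>i. pt \<theta> (j + i))) n - regime_mean \<Phi> r\<bar> < \<bar>regime_mean \<Phi> r - l\<bar> / 2"
      using frequently_avg_close[OF unif B e] by blast
    then show False using N[of n] by argo
  qed
  with ne show False by metis
qed

lemma cyl_unif:
  "\<epsilon> > 0 \<Longrightarrow> \<exists>J. \<forall>x\<in>Sigma_k k. \<forall>z\<in>Sigma_k k. (\<forall>i<J. x i = z i) \<longrightarrow> \<bar>cyl y L x - cyl y L z\<bar> \<le> \<epsilon>"
  by (rule exI[of _ L]) (auto simp: cyl_def)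

lemma cyl_bound: "\<bar>cyl y L x\<bar> \<le> 1" by (simp add: cyl_def)

lemma frequently_occ_density:
  assumes "\<epsilon> > 0"
  shows "\<exists>n\<ge>N. \<bar>real (card (occ (pt \<theta>) y L \<inter> {1..n})) / n - regime_mean (cyl y L) r\<bar> < \<epsilon>"
proof -
  obtain M where M: "2 / \<epsilon> < real M" using reals_Archimedean2 by blast
  have e2: "\<epsilon> / 2 > 0" using assms by simp
  obtain n where n: "n \<ge> max (max M 1) N" "\<bar>avg (\<lambda>j. cyl y L (\<lambda>i. pt \<theta> (j + i))) n - regime_mean (cyl y L) r\<bar> < \<epsilon> / 2"
    using frequently_avg_close[OF cyl_unif cyl_bound e2] by blast
  have "2 / \<epsilon> < real n" using M n(1) by linarith
  then have n1: "1 / real n < \<epsilon> / 2" using assms n(1) by (auto simp: field_simps)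
  have "\<bar>real (card (occ (pt \<theta>) y L \<inter> {1..n})) / n - avg (\<lambda>j. cyl y L (\<lambda>i. pt \<theta> (j + i))) n\<bar> \<le> 1 / n"
    using divide_right_mono[OF card_occ_cyl[of "pt \<theta>" y L n], of "real n"]
    by (simp add: avg_def diff_divide_distrib[symmetric] abs_divide)
  then have "\<bar>real (card (occ (pt \<theta>) y L \<inter> {1..n})) / n - regime_mean (cyl y L) r\<bar> < \<epsilon>"
    using n(2) n1 by linarith
  then show ?thesis using n(1) by auto
qed

lemma upper_dens_pos:
  assumes "regime_mean (cyl y L) r > 0" shows "upper_dens (occ (pt \<theta>) y L) > 0"
proof -
  let ?c = "regime_mean (cyl y L) r"
  have "ereal (?c / 2) \<le> upper_dens (occ (pt \<theta>) y L)" unfolding upper_dens_def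
  proof (rule limsup_geI)
    fix N
    obtain n where "n \<ge> N" "\<bar>real (card (occ (pt \<theta>) y L \<inter> {1..n})) / n - ?c\<bar> < ?c / 2"
      using frequently_occ_density[of "?c / 2"] assms half_gt_zero by blast
    moreover from this(2) have "?c / 2 \<le> real (card (occ (pt \<theta>) y L \<inter> {1..n})) / n" by linarith
    ultimately show "\<exists>n\<ge>N. ereal (?c / 2) \<le> ereal (real (card (occ (pt \<theta>) y L \<inter> {1..n})) / n)"
      unfolding ereal_less_eq by blast
  qed
  moreover have "0 < ereal (?c / 2)" using assms by simp
  ultimately show ?thesis by (rule less_le_trans[rotated])
qed

text \<open>One regime suffices: at the ends of its epochs the frequency comes arbitrarily close to
  0.\<close>

lemma lower_dens_nonpos:
  assumes "regime_mean (cyl y L) r = 0" shows "lower_dens (occ (pt \<theta>) y L) \<le> 0"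
proof (rule ereal_le_epsilon2)
  fix \<epsilon> :: real assume e: "\<epsilon> > 0"
  have "lower_dens (occ (pt \<theta>) y L) \<le> ereal \<epsilon>" unfolding lower_dens_def
  proof (rule liminf_leI)
    fix N
    obtain n where "n \<ge> N" "\<bar>real (card (occ (pt \<theta>) y L \<inter> {1..n})) / n - 0\<bar> < \<epsilon>"
      using frequently_occ_density[OF e, of N \<theta> y L r] assms by auto
    then show "\<exists>n\<ge>N. ereal (real (card (occ (pt \<theta>) y L \<inter> {1..n})) / n) \<le> ereal \<epsilon>"
      by (intro exI[of _ n]) auto
  qed
  then show "lower_dens (occ (pt \<theta>) y L) \<le> 0 + ereal \<epsilon>" by simp
qed

lemma occ_density_eventually:
  assumes "\<epsilon> > 0"
  shows "\<exists>N. \<forall>n\<ge>N. \<bar>real (card (occ (pt \<theta>) y L \<inter> {1..n})) / n -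
    avg (\<lambda>j. regime_mean (cyl y L) (even (epoch (floor_sqrt j)))) n\<bar> < \<epsilon>"
proof -
  obtain M where M: "2 / \<epsilon> < real M" using reals_Archimedean2 by blast
  have e2: "\<epsilon> / 2 > 0" using assms by simp
  obtain K where K: "\<And>n. n \<ge> K \<Longrightarrow> \<bar>avg (\<lambda>j. cyl y L (\<lambda>i. pt \<theta> (j + i))) n -
      avg (\<lambda>j. regime_mean (cyl y L) (even (epoch (floor_sqrt j)))) n\<bar> < \<epsilon> / 2"
    using LIMSEQ_D[OF avg_pt_tendsto[OF cyl_unif cyl_bound, of y L \<theta>] e2] by (auto simp: avg_diff)
  show ?thesis
  proof (intro exI[of _ "max (max M 1) K"] allI impI)
    fix n assume n: "n \<ge> max (max M 1) K"
    have "2 / \<epsilon> < real n" using M n by linarith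
    then have n1: "1 / real n < \<epsilon> / 2" using assms n(1) by (auto simp: field_simps)
    have "\<bar>real (card (occ (pt \<theta>) y L \<inter> {1..n})) / n - avg (\<lambda>j. cyl y L (\<lambda>i. pt \<theta> (j + i))) n\<bar> \<le> 1 / n"
      using divide_right_mono[OF card_occ_cyl[of "pt \<theta>" y L n], of "real n"]
      by (simp add: avg_def diff_divide_distrib[symmetric] abs_divide)
    then show "\<bar>real (card (occ (pt \<theta>) y L \<inter> {1..n})) / n -
      avg (\<lambda>j. regime_mean (cyl y L) (even (epoch (floor_sqrt j)))) n\<bar> < \<epsilon>"
      using K[of n] n n1 by linarith
  qed
qed

lemma lower_dens_pos:
  assumes "\<And>r. regime_mean (cyl y L) r > 0" shows "lower_dens (occ (pt \<theta>) y L) > 0"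
proof -
  define c where "c = min (regime_mean (cyl y L) True) (regime_mean (cyl y L) False)"
  have c: "c > 0" using assms by (simp add: c_def)
  have cr: "c \<le> regime_mean (cyl y L) r" for r by (cases r) (auto simp: c_def)
  obtain N where N: "\<forall>n\<ge>N. \<bar>real (card (occ (pt \<theta>) y L \<inter> {1..n})) / n -
    avg (\<lambda>j. regime_mean (cyl y L) (even (epoch (floor_sqrt j)))) n\<bar> < c / 2"
    using occ_density_eventually[OF half_gt_zero[OF c]] by blast
  have "ereal (c / 2) \<le> lower_dens (occ (pt \<theta>) y L)" unfolding lower_dens_def
  proof (rule Liminf_bounded, rule eventually_sequentiallyI[of "max N 1"])
    fix n assume n: "n \<ge> max N 1"
    then have "c \<le> avg (\<lambda>j. regime_mean (cyl y L) (even (epoch (floor_sqrt j)))) n"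
      by (intro avg_epoch_ge cr) auto
    moreover have "\<bar>real (card (occ (pt \<theta>) y L \<inter> {1..n})) / n -
      avg (\<lambda>j. regime_mean (cyl y L) (even (epoch (floor_sqrt j)))) n\<bar> < c / 2" using N n by auto
    ultimately show "ereal (c / 2) \<le> ereal (real (card (occ (pt \<theta>) y L \<inter> {1..n})) / n)"
      unfolding ereal_less_eq by argo
  qed
  moreover have "0 < ereal (c / 2)" using c by simp
  ultimately show ?thesis by (rule less_le_trans[rotated])
qed

lemma upper_dens_nonpos:
  assumes "\<And>r. regime_mean (cyl y L) r = 0" shows "upper_dens (occ (pt \<theta>) y L) \<le> 0"
proof (rule ereal_le_epsilon2)
  fix \<epsilon> :: real assume e: "\<epsilon> > 0"
  obtain N where N: "\<forall>n\<ge>N. \<bar>real (card (occ (pt \<theta>) y L \<inter> {1..n})) / n -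
    avg (\<lambda>j. regime_mean (cyl y L) (even (epoch (floor_sqrt j)))) n\<bar> < \<epsilon>"
    using occ_density_eventually[OF e] by blast
  have "upper_dens (occ (pt \<theta>) y L) \<le> ereal \<epsilon>" unfolding upper_dens_def
  proof (rule Limsup_bounded, rule eventually_sequentiallyI[of N])
    fix n assume "n \<ge> N"
    then show "ereal (real (card (occ (pt \<theta>) y L \<inter> {1..n})) / n) \<le> ereal \<epsilon>"
      using N by (force simp: assms avg_def)
  qed
  then show "upper_dens (occ (pt \<theta>) y L) \<le> 0 + ereal \<epsilon>" by simp
qed

lemma orbit_mean_cyl_nonneg: "0 \<le> orbit_mean c (cyl y L)"
  unfolding orbit_mean_def by (intro divide_nonneg_nonneg sum_nonneg) (auto simp: cyl_def)

lemma orbit_mean_cyl_pos: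
  assumes "y \<in> orb c" shows "0 < orbit_mean c (cyl y L)"
proof -
  obtain d where y: "y = (\<lambda>i. P c (d + i))" using assms by (auto simp: orb_def)
  have "P c (d mod q + i) = y i" for i
    using P_mod[of c i d] by (simp add: y add.commute)
  then have "0 < cyl y L (\<lambda>i. P c (d mod q + i))" by (simp add: cyl_def)
  then have "0 < (\<Sum>d<q. cyl y L (\<lambda>i. P c (d + i)))"
    using q_pos by (intro sum_pos2[of _ "d mod q"]) (auto simp: cyl_def)
  then show ?thesis using q_pos by (simp add: orbit_mean_def)
qed

lemma orbit_mean_cyl_zero:
  assumes "y \<in> orb c" "c \<in> cols" "c' \<in> cols" "c \<noteq> c'" shows "orbit_mean c' (cyl y q) = 0"
proof -
  obtain d where y: "y = (\<lambda>i. P c (d + i))" using assms by (auto simp: orb_def)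
  have "cyl y q (\<lambda>i. P c' (d' + i)) = 0" for d'
    using P_window_ext[of c d c' d'] disjoint_orbits[OF assms(2-4), of d d'] by (force simp: cyl_def y)
  then show ?thesis by (simp add: orbit_mean_def)
qed

lemma regime_mean_cyl_pos:
  assumes "y \<in> orb c" "c = lo r \<or> c = hi r" shows "0 < regime_mean (cyl y L) r"
proof -
  have nn: "0 \<le> lam r * orbit_mean (lo r) (cyl y L)" "0 \<le> (1 - lam r) * orbit_mean (hi r) (cyl y L)"
    using lam[of r] orbit_mean_cyl_nonneg by (simp_all add: mult_nonneg_nonneg)
  have "0 < lam r * orbit_mean c (cyl y L)" "0 < (1 - lam r) * orbit_mean c (cyl y L)"
    using lam[of r] orbit_mean_cyl_pos[OF assms(1)] by simp_all
  with nn assms(2) show ?thesis unfolding regime_mean_def by (auto intro: add_pos_nonneg add_nonneg_pos)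
qed

lemma regime_mean_cyl_zero:
  assumes "y \<in> orb c" "c \<in> cols" "c \<noteq> lo r" "c \<noteq> hi r" shows "regime_mean (cyl y q) r = 0"
  using orbit_mean_cyl_zero[OF assms(1,2)] assms lo_cols hi_cols by (simp add: regime_mean_def)

lemma orb_in_ud: "y \<in> orb c \<Longrightarrow> c = lo r \<or> c = hi r \<Longrightarrow> y \<in> omega_ud k (pt \<theta>)"
  using omega_ud_iff[OF pt_Sigma] orb_Sigma upper_dens_pos regime_mean_cyl_pos by blast

lemma orb_in_ld: "y \<in> orb c \<Longrightarrow> (\<And>r. c = lo r \<or> c = hi r) \<Longrightarrow> y \<in> omega_ld k (pt \<theta>)"
  using omega_ld_iff[OF pt_Sigma] orb_Sigma lower_dens_pos regime_mean_cyl_pos by blast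

lemma orb_notin_ld:
  assumes "y \<in> orb c" "c \<in> cols" "c \<noteq> lo r" "c \<noteq> hi r" shows "y \<notin> omega_ld k (pt \<theta>)"
  using omega_ld_iff[OF pt_Sigma] lower_dens_nonpos[OF regime_mean_cyl_zero[OF assms]] not_less by blast

lemma orb_notin_ud:
  assumes "y \<in> orb c" "c \<in> cols" "\<And>r. c \<noteq> lo r \<and> c \<noteq> hi r" shows "y \<notin> omega_ud k (pt \<theta>)"
proof -
  have "upper_dens (occ (pt \<theta>) y q) \<le> 0"
    using assms by (intro upper_dens_nonpos regime_mean_cyl_zero) auto
  then show ?thesis using omega_ud_iff[OF pt_Sigma] not_less by blast
qed

text \<open>Every prefix of \<open>y\<close> must be a word of some orbit, since otherwise its
  occurrences are defects. Colour and phase may vary with the length of the prefix, so periodicity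
  of \<open>y\<close> is derived first from long prefixes; then a single prefix of length
  \<open>q\<close> fixes the orbit.\<close>

lemma Bu_subset_orb:
  assumes "y \<in> omega_Bu k (pt \<theta>)" shows "\<exists>c\<in>cols. y \<in> orb c"
proof -
  have fac: "\<exists>c\<in>cols. \<exists>d. \<forall>i<L. y i = P c (d + i)" if "L > 0" for L
  proof (rule ccontr)
    assume *: "\<not> ?thesis"
    have "occ (pt \<theta>) y L \<subseteq> {j. \<not> factor (pt \<theta>) L j}"
    proof
      fix j assume "j \<in> occ (pt \<theta>) y L"
      then have j: "\<forall>i<L. pt \<theta> (j + i) = y i" by (simp add: occ_def)
      have "\<not> factor (pt \<theta>) L j"
      proof
        assume "factor (pt \<theta>) L j"
        then obtain c d where "c \<in> cols" "\<forall>i<L. pt \<theta> (j + i) = P c (d + i)" unfolding factor_def by blast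
        with j have "c \<in> cols" "\<forall>i<L. y i = P c (d + i)" by simp_all
        with * show False by blast
      qed
      then show "j \<in> {j. \<not> factor (pt \<theta>) L j}" by simp
    qed
    from banach_upper_defects[OF that this] show False
      using assms omega_Bu_iff[OF pt_Sigma] not_less by blast
  qed
  have per: "y (i + q) = y i" for i
  proof -
    obtain c d where "\<forall>i'<i + q + 1. y i' = P c (d + i')" using fac[of "i + q + 1"] by auto
    then show ?thesis using P_periodic'[of c d i] by (simp add: add_ac)
  qed
  have ymod: "y i = y (i mod q)" for i
  proof -
    have "y (i mod q + q * n) = y (i mod q)" for n
    proof (induction n)
      case (Suc n)
      then show ?case using per[of "i mod q + q * n"] by (simp add: add_ac)
    qed simp
    then show ?thesis by (metis mod_mult_div_eq)
  qed
  obtain c d where c: "c \<in> cols" "\<forall>i<q. y i = P c (d + i)" using fac[OF q_pos] by blast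
  have "y i = P c (d + i)" for i
    using c(2) q_pos ymod[of i] P_mod[of c d i] by simp
  then have "y = (\<lambda>i. P c (d + i))" by auto
  then show ?thesis using c(1) by (auto simp: orb_def)
qed

lemma pt_notin_Bu: "pt \<theta> \<notin> omega_Bu k (pt \<theta>)"
proof
  assume "pt \<theta> \<in> omega_Bu k (pt \<theta>)"
  then obtain c where "pt \<theta> \<in> orb c" using Bu_subset_orb by blast
  then obtain d where "pt \<theta> = (\<lambda>i. P c (d + i))" unfolding orb_def by blast
  then have "pt \<theta> q = pt \<theta> 0" using P_periodic'[of c d 0] by simp
  then show False using pt_start[of 0 \<theta>] pt_start[of q \<theta>] q_pos by simp
qed

lemma pt_occ_infinite: "infinite (occ (pt \<theta>) (pt \<theta>) L)"
  unfolding infinite_nat_iff_unbounded_le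
proof
  fix N
  define n where "n = q + N + L + 1"
  have n4: "n < 4 ^ n" by (rule less_le_trans[OF less_exp[of n]]) (simp add: power_mono)
  have "(4::nat) ^ n \<le> 16 ^ n" by (rule power_mono) auto
  with n4 have "N \<le> 16 ^ n" by (simp add: n_def)
  moreover have "16 ^ n \<in> occ (pt \<theta>) (pt \<theta>) L"
    unfolding occ_def using pt_copy[of n] n4 by (auto simp: n_def)
  ultimately show "\<exists>n\<ge>N. n \<in> occ (pt \<theta>) (pt \<theta>) L" by blast
qed

lemma pt_Rec: "pt \<theta> \<in> Rec k"
  unfolding Rec_iff using pt_Sigma pt_occ_infinite by (metis finite.emptyI)

lemma pt_notin_BR: "pt \<theta> \<notin> BR k"
  using pt_notin_Bu BR_iff by blast

lemma Bu_psubset_lim: "omega_Bu k (pt \<theta>) \<subset> omega_lim k (pt \<theta>)"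
proof -
  have "pt \<theta> \<in> omega_lim k (pt \<theta>)" using omega_lim_iff[OF pt_Sigma] pt_Sigma pt_occ_infinite by blast
  then show ?thesis using pt_notin_Bu omega_Bu_subset_lim[OF pt_Sigma] by blast
qed

text \<open>Runs of this orbit are never displaced by \<open>\<theta>\<close>, so inside them
  \<open>P c\<close> restarts at each multiple of \<open>q\<close>. This gives upper Banach density
  at least \<open>1 / q\<close>.\<close>

lemma sparse_in_Bu:
  assumes "sp = Some c" shows "P c \<in> omega_Bu k (pt \<theta>)"
proof -
  have "0 < banach_upper (occ (pt \<theta>) (P c) L)" for L
  proof -
    have "1 / q \<le> banach_upper (occ (pt \<theta>) (P c) L)"
    proof (rule ccontr)
      assume "\<not> ?thesis"
      then obtain z where z: "banach_upper (occ (pt \<theta>) (P c) L) < z" "z < 1 / q" using dense by (meson not_le)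
      obtain N where N: "\<forall>m\<ge>1. \<forall>n\<ge>max N 1. card (occ (pt \<theta>) (P c) L \<inter> {m..<m + n}) \<le> z * n"
        using banach_upper_lessD[OF z(1)] by blast
      define t where "t = Suc N"
      \<comment> \<open>Large enough that the block of index \<open>2 * 4 ^ s\<close> holds a window
        of length \<open>q * t\<close> together with the \<open>L\<close> symbols following
        it.\<close>
      define s where "s = q * t + L + q"
      define m where "m = (2::nat) * 4 ^ s"
      have "s < 4 ^ s" by (rule less_le_trans[OF less_exp[of s]]) (simp add: power_mono)
      then have ms: "m > s" "m > q" by (auto simp: m_def s_def)
      \<comment> \<open>An odd power of two is not a power of four: copies do not touch the sparse
        blocks.\<close>
      have m4: "m \<notin> range ((^) 4)"
      proof
        assume "m \<in> range ((^) 4)"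
        then obtain n where "m = 2 ^ (2 * n)" using four_power_eq by auto
        moreover have "m = 2 ^ (2 * s + 1)" by (simp add: m_def power_mult)
        ultimately have "2 * n = 2 * s + 1" by (metis floor_log_power)
        then show False by presburger
      qed
      have run: "pt \<theta> j = P c j" if "m\<^sup>2 \<le> j" "j < (Suc m)\<^sup>2" for j
      proof -
        have "floor_sqrt j = m" using that unfolding floor_sqrt_eq_iff by simp
        then have "j \<notin> copied q" using not_copied_of_block m4 by simp
        then show ?thesis using base_sparse[OF ms(2) assms _ that, of \<theta>] by (auto simp: pt_not_copied m_def)
      qed
      have "{j \<in> {m\<^sup>2..<m\<^sup>2 + q * t}. q dvd j} \<subseteq> occ (pt \<theta>) (P c) L \<inter> {m\<^sup>2..<m\<^sup>2 + q * t}"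
      proof
        fix j assume j: "j \<in> {j \<in> {m\<^sup>2..<m\<^sup>2 + q * t}. q dvd j}"
        have "m\<^sup>2 \<ge> 1" using ms(2) by (simp add: Suc_le_eq)
        moreover have "m\<^sup>2 \<le> j" using j by simp
        ultimately have "j \<ge> 1" by linarith
        moreover have "pt \<theta> (j + i) = P c i" if "i < L" for i
        proof -
          have "m\<^sup>2 + q * t + L \<le> (Suc m)\<^sup>2" using ms(1) by (simp add: power2_eq_square s_def)
          then have "pt \<theta> (j + i) = P c (j + i)" using j that by (intro run) auto
          moreover have "P c (i + j) = P c i" using P_mod[of c i j] j by auto
          ultimately show ?thesis by (simp add: add.commute)
        qed
        ultimately show "j \<in> occ (pt \<theta>) (P c) L \<inter> {m\<^sup>2..<m\<^sup>2 + q * t}" using j by (auto simp: occ_def)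
      qed
      then have "card {j \<in> {m\<^sup>2..<m\<^sup>2 + q * t}. q dvd j} \<le> card (occ (pt \<theta>) (P c) L \<inter> {m\<^sup>2..<m\<^sup>2 + q * t})"
        by (intro card_mono) auto
      then have "t \<le> card (occ (pt \<theta>) (P c) L \<inter> {m\<^sup>2..<m\<^sup>2 + q * t})"
        using multiple_in_window[OF q_pos, of t "m\<^sup>2"] by linarith
      moreover have "card (occ (pt \<theta>) (P c) L \<inter> {m\<^sup>2..<m\<^sup>2 + q * t}) \<le> z * (q * t)"
      proof -
        have "1 * t \<le> q * t" using q_pos by (intro mult_le_mono1) auto
        then have "q * t \<ge> max N 1" by (auto simp: t_def)
        moreover have "m\<^sup>2 \<ge> 1" using ms by simp
        ultimately show ?thesis using N by (metis of_nat_mult)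
      qed
      ultimately have "real t \<le> z * (q * t)" by linarith
      moreover have "z * (q * t) < 1 / q * (q * t)"
        using q_pos by (intro mult_strict_right_mono z(2)) (simp add: t_def add_pos_nonneg)
      ultimately show False using q_pos by simp
    qed
    moreover have "0 < 1 / real q" using q_pos by simp
    ultimately show ?thesis by linarith
  qed
  moreover have "P c \<in> Sigma_k k" using P_Sigma[of c 0] by simp
  ultimately show ?thesis using omega_Bu_iff[OF pt_Sigma] by blast
qed

text \<open>High runs of arbitrary length contain no window of length \<open>q\<close> from the low
  orbit, so its occurrences leave arbitrarily long gaps.\<close>

lemma lo_notin_Bl:
  assumes "y \<in> orb (lo r)" "lo r \<noteq> hi r" shows "y \<notin> omega_Bl k (pt \<theta>)"
proof
  assume "y \<in> omega_Bl k (pt \<theta>)"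
  then have pos: "0 < banach_lower (occ (pt \<theta>) y q)" using omega_Bl_iff[OF pt_Sigma] by blast
  then obtain z where z: "0 < z" "z < banach_lower (occ (pt \<theta>) y q)" using dense by blast
  obtain N where N: "\<forall>m\<ge>1. \<forall>n\<ge>max N 1. z * n \<le> card (occ (pt \<theta>) y q \<inter> {m..<m + n})"
    using banach_lower_lessD[OF z(2)] by blast
  define n where "n = max N 1"
  \<comment> \<open>A block beyond \<open>K\<close> has a high run of length at least
    \<open>n + q\<close>; the summand 1 pays for rounding the low run.\<close>
  obtain K where K: "(real n + q + 1) / (1 - lam r) < real K" using reals_Archimedean2 by blast
  define e where "e = (if r then 2 * (K + q + 1) else 2 * (K + q + 1) + 1)"
  have e: "even e = r" "e \<ge> 1" "e \<ge> K" "e \<ge> q" by (auto simp: e_def)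
  \<comment> \<open>The second block of epoch \<open>e\<close>. Its index is odd and larger than 1,
    hence not a power of two, so the block is an ordinary pair of runs.\<close>
  define m where "m = (2::nat) ^ e\<^sup>2 + 1"
  have "e \<le> e\<^sup>2" by (simp add: power2_eq_square)
  then have em: "e < m" unfolding m_def using less_exp[of "e\<^sup>2"] by linarith
  have "(2::nat) ^ e\<^sup>2 + 1 < 2 * 2 ^ e\<^sup>2" using one_less_power[of "2::nat" "e\<^sup>2"] e(2) by simp
  also have "\<dots> = 2 ^ (e\<^sup>2 + 1)" by simp
  also have "\<dots> \<le> 2 ^ (Suc e)\<^sup>2" by (intro power_increasing) (auto simp: power2_eq_square)
  finally have mlt: "m < 2 ^ (Suc e)\<^sup>2" by (simp add: m_def)
  have "epoch (floor_sqrt (m\<^sup>2)) = e"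
    using mlt by (intro epoch_eq) (auto simp: epoch_start_def m_def power_mono power_strict_mono)
  then have ep: "epoch m = e" by simp
  have np: "m \<notin> range ((^) 2)"
  proof
    assume "m \<in> range ((^) 2)"
    then obtain s where s: "m = 2 ^ s" by auto
    have "odd m" using e(2) by (simp add: m_def)
    then have "s = 0" using s by (cases s) auto
    then show False using s by (simp add: m_def)
  qed
  define u where "u = m\<^sup>2 + ell r m"
  have run: "pt \<theta> j = P (hi r) (j + \<theta> e)" if "u \<le> j" "j < (Suc m)\<^sup>2" for j
    using pt_run_hi[of m j \<theta>] np that em e by (simp add: ep u_def)
  have long: "u + n + q \<le> (Suc m)\<^sup>2"
  proof -
    have "(real n + q + 1) / (1 - lam r) < real m" using K e em by linarith
    then have "real n + q + 1 < real m * (1 - lam r)" using lam[of r] by (simp add: divide_less_eq)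
    also have "\<dots> \<le> (2 * real m + 1) * (1 - lam r)" using lam[of r] by (intro mult_right_mono) auto
    finally have "real n + q + 1 + lam r * (2 * real m + 1) < 2 * real m + 1" by (simp add: algebra_simps)
    then have "real (ell r m) + n + q < 2 * real m + 1" using ell_real[of r m] by linarith
    then have "ell r m + n + q \<le> 2 * m + 1" by linarith
    then show ?thesis by (simp add: u_def power2_eq_square)
  qed
  obtain d where y: "y = (\<lambda>i. P (lo r) (d + i))" using assms(1) by (auto simp: orb_def)
  have "occ (pt \<theta>) y q \<inter> {u..<u + n} = {}"
  proof (rule ccontr)
    assume "occ (pt \<theta>) y q \<inter> {u..<u + n} \<noteq> {}"
    then obtain j where "j \<in> occ (pt \<theta>) y q" and j: "u \<le> j" "j < u + n" by auto
    then have "pt \<theta> (j + i) = P (lo r) (d + i)" if "i < q" for i using that by (simp add: occ_def y)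
    note j = j this
    have "P (lo r) (d + i) = P (hi r) (j + \<theta> e + i)" if "i < q" for i
      using run[of "j + i"] j that long by (simp add: add_ac)
    then show False
      using P_window_ext[of "lo r" d "hi r" "j + \<theta> e"] disjoint_orbits[OF lo_cols hi_cols assms(2)] by blast
  qed
  moreover have "m\<^sup>2 \<ge> 1" using em by (simp add: Suc_le_eq)
  then have "u \<ge> 1" by (simp add: u_def)
  ultimately have "z * n \<le> 0" using N by (metis card.empty le_refl n_def of_nat_0)
  moreover have "real n > 0" by (simp add: n_def)
  ultimately show False using z(1) by (simp add: mult_le_0_iff)
qed

end

subsection \<open>Periodic orbits with prescribed averages and the main theorem\<close>

context separated_construction
begin

section \<open>Limit sets as unions of orbits and the relations between them\<close>

lemma P_in_orb: "P c \<in> orb c"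
  unfolding orb_def by (rule range_eqI[of _ _ 0]) simp

lemma ld_eq: "omega_ld k (pt \<theta>) = (\<Union>c\<in>{c. \<forall>r. c = lo r \<or> c = hi r}. orb c)"
proof safe
  fix y assume y: "y \<in> omega_ld k (pt \<theta>)"
  then have "y \<in> omega_Bu k (pt \<theta>)" using omega_ld_subset_ud omega_ud_subset_Bu by blast
  then obtain c where c: "c \<in> cols" "y \<in> orb c" using Bu_subset_orb by blast
  have "c = lo r \<or> c = hi r" for r using orb_notin_ld[OF c(2,1)] y by blast
  then show "y \<in> (\<Union>c\<in>{c. \<forall>r. c = lo r \<or> c = hi r}. orb c)" using c by blast
next
  fix y c assume "y \<in> orb c" "\<forall>r. c = lo r \<or> c = hi r"
  then show "y \<in> omega_ld k (pt \<theta>)" by (intro orb_in_ld) auto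
qed

lemma ud_eq: "omega_ud k (pt \<theta>) = (\<Union>c\<in>{c. \<exists>r. c = lo r \<or> c = hi r}. orb c)"
proof
  show "omega_ud k (pt \<theta>) \<subseteq> (\<Union>c\<in>{c. \<exists>r. c = lo r \<or> c = hi r}. orb c)"
  proof
    fix y assume y: "y \<in> omega_ud k (pt \<theta>)"
    then have "y \<in> omega_Bu k (pt \<theta>)" using omega_ud_subset_Bu by blast
    then obtain c where c: "c \<in> cols" "y \<in> orb c" using Bu_subset_orb by blast
    then have "\<exists>r. c = lo r \<or> c = hi r" using orb_notin_ud[OF c(2,1)] y by blast
    then show "y \<in> (\<Union>c\<in>{c. \<exists>r. c = lo r \<or> c = hi r}. orb c)" using c by blast
  qed
  show "(\<Union>c\<in>{c. \<exists>r. c = lo r \<or> c = hi r}. orb c) \<subseteq> omega_ud k (pt \<theta>)"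
    using orb_in_ud by blast
qed

lemma ld_eq_ud: "(\<And>r c. c = lo r \<or> c = hi r \<Longrightarrow> \<forall>r. c = lo r \<or> c = hi r) \<Longrightarrow> omega_ld k (pt \<theta>) = omega_ud k (pt \<theta>)"
  unfolding ld_eq ud_eq by blast

lemma ld_psubset_ud:
  assumes "c \<in> cols" "c = lo r \<or> c = hi r" "c \<noteq> lo r'" "c \<noteq> hi r'"
  shows "omega_ld k (pt \<theta>) \<subset> omega_ud k (pt \<theta>)"
  using orb_in_ud[OF P_in_orb assms(2)] orb_notin_ld[OF P_in_orb assms(1,3,4)] omega_ld_subset_ud by blast

lemma ud_eq_Bu:
  assumes "\<And>c. c \<in> cols \<Longrightarrow> \<exists>r. c = lo r \<or> c = hi r"
  shows "omega_ud k (pt \<theta>) = omega_Bu k (pt \<theta>)"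
proof
  show "omega_ud k (pt \<theta>) \<subseteq> omega_Bu k (pt \<theta>)" by (rule omega_ud_subset_Bu)
  show "omega_Bu k (pt \<theta>) \<subseteq> omega_ud k (pt \<theta>)"
    using Bu_subset_orb assms orb_in_ud by blast
qed

lemma ud_psubset_Bu:
  assumes "sp = Some c" "\<And>r. c \<noteq> lo r \<and> c \<noteq> hi r"
  shows "omega_ud k (pt \<theta>) \<subset> omega_Bu k (pt \<theta>)"
  using sparse_in_Bu[OF assms(1)] orb_notin_ud[OF P_in_orb sp_cols[OF assms(1)] assms(2)] omega_ud_subset_Bu by blast

lemma Bl_psubset_ld:
  assumes "lo r \<noteq> hi r" "\<And>r'. lo r = lo r' \<or> lo r = hi r'"
  shows "omega_Bl k (pt \<theta>) \<subset> omega_ld k (pt \<theta>)"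
  using lo_notin_Bl[OF P_in_orb assms(1)] orb_in_ld[OF P_in_orb assms(2)] omega_Bl_subset_ld by blast

text \<open>Equality because both sets are empty: no orbit is common to the two regimes.\<close>

lemma Bl_eq_ld:
  assumes "\<And>c. \<exists>r. c \<noteq> lo r \<and> c \<noteq> hi r" shows "omega_Bl k (pt \<theta>) = omega_ld k (pt \<theta>)"
  using omega_Bl_subset_ld[of k "pt \<theta>"] assms unfolding ld_eq by blast

text \<open>Component \<open>0\<close> of the decoding yields infinitely many epochs in which all itineraries agree.\<close>

definition itinerary :: "nat set \<Rightarrow> nat \<Rightarrow> nat" where
  "itinerary A e = (case fst (prod_decode e) of 0 \<Rightarrow> 0 | Suc n \<Rightarrow> if n \<in> A then 1 else 0)"

lemma DC1_pair_itinerary: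
  assumes "A \<noteq> A'" shows "DC1_pair (pt (itinerary A)) (pt (itinerary A'))"
proof (rule DC1_pair_pt)
  fix N
  show "\<exists>e\<ge>N. itinerary A e = itinerary A' e"
    by (rule exI[of _ "prod_encode (0, N)"]) (simp add: itinerary_def le_prod_encode_2)
  obtain n where "(n \<in> A) \<noteq> (n \<in> A')" using assms by blast
  then show "\<exists>e\<ge>N. {itinerary A e, itinerary A' e} = {0, 1}"
    by (intro exI[of _ "prod_encode (Suc n, N)"]) (auto simp: itinerary_def le_prod_encode_2)
qed

end

text \<open>Serves injectivity of the coding: distinct codes give DC1 pairs, hence distinct points,
  and the family is as large as the power set of the naturals.\<close>

lemma not_DC1_pair_refl: "\<not> DC1_pair x x"
proof
  assume "DC1_pair x x"
  then obtain s where s: "s > 0" "liminf (close_freq x x s) = 0" by (auto simp: DC1_pair_def)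
  have "1 \<le> liminf (close_freq x x s)"
  proof (rule Liminf_bounded, rule eventually_sequentiallyI[of 1])
    fix n :: nat assume n: "n \<ge> 1"
    have "{i. i < n \<and> sdist ((shift ^^ i) x) ((shift ^^ i) x) < s} = {..<n}"
      using s(1) by (auto simp: sdist_def)
    then show "1 \<le> close_freq x x s n" using n by (simp add: close_freq_def one_ereal_def)
  qed
  with s(2) show False by simp
qed

lemma uncountable_nat_sets: "uncountable (UNIV :: nat set set)"
proof
  assume "countable (UNIV :: nat set set)"
  then obtain f :: "nat \<Rightarrow> nat set" where "range f = UNIV"
    using uncountable_def by (metis UNIV_not_empty)
  then show False using Cantors_theorem[of "UNIV :: nat set"] by auto
qed

lemma (in separated_construction) scrambled_family:
  defines "S \<equiv> range (\<lambda>A. pt (itinerary A))"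
  shows "uncountable S" "DC1_scrambled S"
proof -
  have inj: "inj (\<lambda>A. pt (itinerary A))"
    by (rule injI) (metis DC1_pair_itinerary not_DC1_pair_refl)
  show "uncountable S"
    unfolding S_def using countable_image_inj_on[OF _ inj] uncountable_nat_sets by blast
  have "pt (itinerary {}) \<noteq> pt (itinerary {0})"
    using injD[OF inj, of "{}" "{0}"] by blast
  then have "\<exists>x\<in>S. \<exists>y\<in>S. x \<noteq> y" unfolding S_def by blast
  moreover have "DC1_pair x y" if "x \<in> S" "y \<in> S" "x \<noteq> y" for x y
  proof -
    obtain A A' where "x = pt (itinerary A)" "y = pt (itinerary A')" using \<open>x \<in> S\<close> \<open>y \<in> S\<close> unfolding S_def by blast
    then show ?thesis using DC1_pair_itinerary[of A A'] \<open>x \<noteq> y\<close> by auto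
  qed
  ultimately show "DC1_scrambled S" unfolding DC1_scrambled_def by blast
qed

section \<open>Compactness of the full shift: uniform continuity and boundedness\<close>

lemma s_continuous_uniform:
  assumes cont: "s_continuous k \<phi>" and "\<epsilon> > 0"
  shows "\<exists>J. \<forall>x\<in>Sigma_k k. \<forall>y\<in>Sigma_k k. (\<forall>i<J. x i = y i) \<longrightarrow> \<bar>\<phi> x - \<phi> y\<bar> \<le> \<epsilon>"
proof (rule ccontr)
  assume "\<not> ?thesis"
  then have "\<forall>J. \<exists>x y. x \<in> Sigma_k k \<and> y \<in> Sigma_k k \<and> (\<forall>i<J. x i = y i) \<and> \<bar>\<phi> x - \<phi> y\<bar> > \<epsilon>"
    by (meson not_le)
  then obtain X Y where XY: "\<And>J. X J \<in> Sigma_k k" "\<And>J. Y J \<in> Sigma_k k"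
    "\<And>J i. i < J \<Longrightarrow> X J i = Y J i" "\<And>J. \<bar>\<phi> (X J) - \<phi> (Y J)\<bar> > \<epsilon>"
    by metis
  \<comment> \<open>Koenig's argument: each word shared by infinitely many \<open>X J\<close> has an
    extension by one of the \<open>k\<close> symbols with the same property. The limit
    \<open>z\<close> of these words is where continuity fails.\<close>
  let ?I = "\<lambda>w. {J. \<forall>i<length w. X J i = w ! i}"
  have "\<exists>f. \<forall>n. (length (f n) = n \<and> infinite (?I (f n))) \<and> (\<exists>c. f (Suc n) = f n @ [c])"
  proof (rule dependent_nat_choice)
    show "\<exists>w. length w = 0 \<and> infinite (?I w)" by (rule exI[of _ "[]"]) simp
    fix w :: "nat list" and n assume w: "length w = n \<and> infinite (?I w)"
    have "?I w \<subseteq> (\<Union>c<k. ?I (w @ [c]))"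
    proof
      fix J assume J: "J \<in> ?I w"
      have "X J n < k" using XY(1) by (simp add: Sigma_k_def)
      moreover have "J \<in> ?I (w @ [X J n])" using J w by (auto simp: nth_append less_Suc_eq)
      ultimately show "J \<in> (\<Union>c<k. ?I (w @ [c]))" by blast
    qed
    then have "infinite (\<Union>c<k. ?I (w @ [c]))" using w infinite_super by blast
    then obtain c where "infinite (?I (w @ [c]))" by blast
    then show "\<exists>w'. (length w' = Suc n \<and> infinite (?I w')) \<and> (\<exists>c. w' = w @ [c])"
      using w by (intro exI[of _ "w @ [c]"]) auto
  qed
  then obtain f where f: "\<And>n. length (f n) = n" "\<And>n. infinite (?I (f n))" "\<And>n. \<exists>c. f (Suc n) = f n @ [c]"
    by blast
  define z where "z i = f (Suc i) ! i" for i
  have fz: "f n ! i = z i" if "i < n" for n i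
    using that
  proof (induction n)
    case (Suc n)
    obtain c where c: "f (Suc n) = f n @ [c]" using f(3) by blast
    show ?case
    proof (cases "i = n")
      case False
      then have "i < n" using Suc.prems by simp
      then show ?thesis using Suc.IH f(1)[of n] by (simp add: c nth_append)
    qed (simp add: z_def)
  qed simp
  have agree: "\<exists>J\<ge>L. \<forall>i<L. X J i = z i" for L
  proof -
    obtain J where "J \<in> ?I (f L)" "J \<ge> L" using f(2)[of L] by (meson infinite_nat_iff_unbounded_le)
    then show ?thesis using fz[of _ L] f(1)[of L] by auto
  qed
  have z: "z \<in> Sigma_k k" unfolding Sigma_k_def
  proof (intro CollectI allI)
    fix n
    obtain J where "\<forall>i<Suc n. X J i = z i" using agree by blast
    then have "z n = X J n" by simp
    then show "z n < k" using XY(1)[of J] by (simp add: Sigma_k_def)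
  qed
  obtain \<delta> where \<delta>: "\<delta> > 0" "\<And>y. y \<in> Sigma_k k \<Longrightarrow> sdist z y < \<delta> \<Longrightarrow> \<bar>\<phi> y - \<phi> z\<bar> < \<epsilon> / 2"
    using cont z half_gt_zero[OF assms(2)] unfolding s_continuous_def by blast
  obtain L where L: "1 / 2 ^ L < \<delta>" using ex_half_pow_less[OF \<delta>(1)] by blast
  obtain J where J: "J \<ge> L" "\<forall>i<L. X J i = z i" using agree by blast
  have "sdist z (X J) \<le> 1 / 2 ^ L" "sdist z (Y J) \<le> 1 / 2 ^ L"
    using J XY(3)[of _ J] by (auto intro!: sdist_le_of_agree)
  then have "\<bar>\<phi> (X J) - \<phi> z\<bar> < \<epsilon> / 2" "\<bar>\<phi> (Y J) - \<phi> z\<bar> < \<epsilon> / 2"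
    using \<delta>(2) XY(1,2) L by (meson le_less_trans)+
  then show False using XY(4)[of J] by linarith
qed

text \<open>Up to an error of 1, the function takes only the finitely many values determined by
  prefixes of length \<open>J\<close>.\<close>

lemma s_continuous_bounded:
  assumes "s_continuous k \<phi>" "k > 0"
  shows "\<exists>B. \<forall>x\<in>Sigma_k k. \<bar>\<phi> x\<bar> \<le> B"
proof -
  obtain J where J: "\<And>x y. x \<in> Sigma_k k \<Longrightarrow> y \<in> Sigma_k k \<Longrightarrow> (\<And>i. i < J \<Longrightarrow> x i = y i) \<Longrightarrow> \<bar>\<phi> x - \<phi> y\<bar> \<le> 1"
    using s_continuous_uniform[OF assms(1), of 1] by auto
  define T where "T x = (\<lambda>i. if i < J then x i else 0 :: nat)" for x
  have "T ` Sigma_k k \<subseteq> {f. \<forall>i. (i \<in> {..<J} \<longrightarrow> f i \<in> {..<k}) \<and> (i \<notin> {..<J} \<longrightarrow> f i = 0)}"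
    by (auto simp: T_def Sigma_k_def)
  then have fin: "finite (T ` Sigma_k k)"
    by (rule finite_subset) (rule finite_set_of_finite_funs, auto)
  define B where "B = (\<Sum>x\<in>T ` Sigma_k k. \<bar>\<phi> x\<bar>) + 1"
  have "\<bar>\<phi> x\<bar> \<le> B" if x: "x \<in> Sigma_k k" for x
  proof -
    have "\<bar>\<phi> x - \<phi> (T x)\<bar> \<le> 1" using x assms(2) by (intro J) (auto simp: T_def Sigma_k_def)
    moreover have "\<bar>\<phi> (T x)\<bar> \<le> (\<Sum>x\<in>T ` Sigma_k k. \<bar>\<phi> x\<bar>)"
      using x fin by (intro member_le_sum) auto
    ultimately show ?thesis by (simp add: B_def)
  qed
  then show ?thesis by blast
qed

section \<open>Invariant measures and finite Birkhoff sums\<close>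

lemma space_borel_k: "space (borel_k k) = Sigma_k k"
  unfolding borel_k_def by (rule space_measure_of) (auto simp: s_open_def)

lemma s_open_sets: "s_open k U \<Longrightarrow> U \<in> sets (borel_k k)"
  unfolding borel_k_def by (subst sets_measure_of) (auto simp: s_open_def)

lemma s_continuous_measurable:
  assumes "s_continuous k \<phi>" shows "\<phi> \<in> borel_measurable (borel_k k)"
proof (rule borel_measurableI)
  fix S :: "real set" assume S: "open S"
  have "s_open k (\<phi> -` S \<inter> Sigma_k k)" unfolding s_open_def
  proof (intro conjI ballI)
    fix x assume x: "x \<in> \<phi> -` S \<inter> Sigma_k k"
    then obtain e where e: "e > 0" "\<And>y. \<bar>y - \<phi> x\<bar> < e \<Longrightarrow> y \<in> S"
      using S unfolding open_dist dist_real_def by auto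
    then obtain \<delta> where "\<delta> > 0" "\<forall>y\<in>Sigma_k k. sdist x y < \<delta> \<longrightarrow> \<bar>\<phi> y - \<phi> x\<bar> < e"
      using assms x unfolding s_continuous_def by blast
    then show "\<exists>e>0. sball k x e \<subseteq> \<phi> -` S \<inter> Sigma_k k"
      using e(2) by (intro exI[of _ \<delta>]) (auto simp: sball_def)
  qed auto
  then show "\<phi> -` S \<inter> space (borel_k k) \<in> sets (borel_k k)"
    unfolding space_borel_k by (rule s_open_sets)
qed

lemma shift_Sigma: "x \<in> Sigma_k k \<Longrightarrow> shift x \<in> Sigma_k k"
  by (auto simp: Sigma_k_def shift_def)

lemma shift_measurable: "shift \<in> measurable (borel_k k) (borel_k k)"
proof -
  have "shift \<in> measurable (borel_k k) (sigma (Sigma_k k) {U. s_open k U})"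
  proof (rule measurable_measure_of)
    show "{U. s_open k U} \<subseteq> Pow (Sigma_k k)" by (auto simp: s_open_def)
    show "shift \<in> space (borel_k k) \<rightarrow> Sigma_k k" using shift_Sigma by (auto simp: space_borel_k)
    fix U assume "U \<in> {U. s_open k U}"
    then have U: "U \<subseteq> Sigma_k k" "\<And>x. x \<in> U \<Longrightarrow> \<exists>e>0. sball k x e \<subseteq> U" by (auto simp: s_open_def)
    have "s_open k (shift -` U \<inter> Sigma_k k)" unfolding s_open_def
    proof (intro conjI ballI)
      fix x assume x: "x \<in> shift -` U \<inter> Sigma_k k"
      then obtain e where e: "e > 0" "sball k (shift x) e \<subseteq> U" using U(2) by auto
      obtain L where L: "1 / 2 ^ L < e" using ex_half_pow_less[OF e(1)] by blast
      have "sball k x (1 / 2 ^ Suc L) \<subseteq> shift -` U \<inter> Sigma_k k"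
      proof
        fix y assume "y \<in> sball k x (1 / 2 ^ Suc L)"
        then have y: "y \<in> Sigma_k k" "sdist x y < 1 / 2 ^ Suc L" by (auto simp: sball_def)
        have "sdist (shift x) (shift y) \<le> 1 / 2 ^ L"
          using agree_of_sdist_less[OF y(2)] by (intro sdist_le_of_agree) (auto simp: shift_def)
        then have "shift y \<in> sball k (shift x) e" using L shift_Sigma[OF y(1)] by (simp add: sball_def)
        then show "y \<in> shift -` U \<inter> Sigma_k k" using e(2) y(1) by auto
      qed
      then show "\<exists>e>0. sball k x e \<subseteq> shift -` U \<inter> Sigma_k k"
        by (intro exI[of _ "1 / 2 ^ Suc L"]) simp
    qed auto
    then show "shift -` U \<inter> space (borel_k k) \<in> sets (borel_k k)"
      unfolding space_borel_k by (rule s_open_sets)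
  qed
  then show ?thesis by (simp add: borel_k_def)
qed

text \<open>The point mass at the fixed point 000... is invariant. Nonemptiness is needed to extract
  measures from the infimum and supremum of integrals.\<close>

lemma inv_measures_nonempty:
  assumes "k > 0" shows "inv_measures k \<noteq> {}"
proof -
  define z :: "nat \<Rightarrow> nat" where "z = (\<lambda>_. 0)"
  have z: "z \<in> space (borel_k k)" using assms by (simp add: space_borel_k Sigma_k_def z_def)
  have sz: "shift z = z" by (simp add: shift_def z_def)
  have "return (borel_k k) z \<in> inv_measures k" unfolding inv_measures_def
  proof (intro CollectI conjI)
    show "prob_space (return (borel_k k) z)" using z by (rule prob_space_return)
    show "shift \<in> measurable (return (borel_k k) z) (return (borel_k k) z)"
      using shift_measurable by (simp cong: measurable_cong_sets)
    have "distr (return (borel_k k) z) (return (borel_k k) z) shift = distr (return (borel_k k) z) (borel_k k) shift"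
      by (rule distr_cong) auto
    also have "\<dots> = return (borel_k k) (shift z)" by (rule distr_return[OF shift_measurable z])
    finally show "distr (return (borel_k k) z) (return (borel_k k) z) shift = return (borel_k k) z"
      by (simp add: sz)
  qed simp
  then show ?thesis by blast
qed

text \<open>By invariance the integral of the Birkhoff sum is \<open>n\<close> times that of
  \<open>\<phi>\<close>, so the sum cannot exceed \<open>n * a\<close> everywhere. No ergodic
  theorem is involved, and the length \<open>n\<close> is arbitrary.\<close>

lemma ex_low_birkhoff_sum:
  fixes a :: real
  assumes \<mu>: "\<mu> \<in> inv_measures k" and cont: "s_continuous k \<phi>" and "k > 0"
    and less: "integral\<^sup>L \<mu> \<phi> < a" and "n > 0"
  shows "\<exists>z\<in>Sigma_k k. (\<Sum>d<n. \<phi> (\<lambda>i. z (d + i))) \<le> n * a"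
proof (rule ccontr)
  assume contra: "\<not> ?thesis"
  have sets: "sets \<mu> = sets (borel_k k)" and "prob_space \<mu>"
    and sh: "shift \<in> measurable \<mu> \<mu>" and inv: "distr \<mu> \<mu> shift = \<mu>"
    using \<mu> by (auto simp: inv_measures_def)
  interpret prob_space \<mu> by fact
  have space: "space \<mu> = Sigma_k k" using sets_eq_imp_space_eq[OF sets] space_borel_k by simp
  have meas: "\<phi> \<in> borel_measurable \<mu>"
    using s_continuous_measurable[OF cont] sets by (simp cong: measurable_cong_sets)
  obtain B where B: "\<forall>x\<in>Sigma_k k. \<bar>\<phi> x\<bar> \<le> B" using s_continuous_bounded[OF cont \<open>k > 0\<close>] by blast
  have shn: "(shift ^^ d) \<in> measurable \<mu> \<mu>" for d
  proof (induction d)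
    case (Suc d)
    show ?case using measurable_comp[OF Suc.IH sh] by (simp add: comp_def)
  qed simp
  have dn: "distr \<mu> \<mu> (shift ^^ d) = \<mu>" for d
  proof (induction d)
    case 0
    have "distr \<mu> \<mu> (\<lambda>x. x) = \<mu>" by (rule distr_id)
    then show ?case by (simp add: id_def)
  next
    case (Suc d)
    have "distr \<mu> \<mu> (shift \<circ> (shift ^^ d)) = distr (distr \<mu> \<mu> (shift ^^ d)) \<mu> shift"
      by (rule distr_distr[OF sh shn, symmetric])
    then show ?case using Suc inv by (simp add: comp_def)
  qed
  have int: "integrable \<mu> (\<lambda>x. \<phi> ((shift ^^ d) x))" for d
  proof (rule integrable_const_bound[of _ B])
    show "(\<lambda>x. \<phi> ((shift ^^ d) x)) \<in> borel_measurable \<mu>"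
      by (rule measurable_compose[OF shn meas])
    show "AE x in \<mu>. norm (\<phi> ((shift ^^ d) x)) \<le> B"
      using B measurable_space[OF shn] by (intro AE_I2) (simp add: space)
  qed
  have eq: "integral\<^sup>L \<mu> (\<lambda>x. \<phi> ((shift ^^ d) x)) = integral\<^sup>L \<mu> \<phi>" for d
    using integral_distr[OF shn meas, of d] by (simp add: dn)
  have "real n * a = integral\<^sup>L \<mu> (\<lambda>x. real n * a)" by (simp add: prob_space)
  also have "\<dots> \<le> integral\<^sup>L \<mu> (\<lambda>x. \<Sum>d<n. \<phi> ((shift ^^ d) x))"
  proof (rule integral_mono)
    show "integrable \<mu> (\<lambda>x. \<Sum>d<n. \<phi> ((shift ^^ d) x))" using int by (intro Bochner_Integration.integrable_sum)
    fix x assume "x \<in> space \<mu>"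
    then show "real n * a \<le> (\<Sum>d<n. \<phi> ((shift ^^ d) x))"
      using contra by (force simp: space shift_funpow)
  qed simp
  also have "\<dots> = (\<Sum>d<n. integral\<^sup>L \<mu> (\<lambda>x. \<phi> ((shift ^^ d) x)))"
    using int by (rule Bochner_Integration.integral_sum)
  also have "\<dots> = real n * integral\<^sup>L \<mu> \<phi>" by (simp add: eq)
  finally show False using less \<open>n > 0\<close> by simp
qed

text \<open>Overwriting the last six symbols of the period by \<open>1\<dots>10\<dots>0\<close> hardly changes the average, while the number
  of ones in a period tells the orbits apart.\<close>

lemma ex_periodic_low:
  fixes k :: nat and \<alpha> a B :: real and \<phi> :: "(nat \<Rightarrow> nat) \<Rightarrow> real"
  assumes k: "k \<ge> 2"
    and unif: "\<And>\<epsilon>::real. \<epsilon> > 0 \<Longrightarrow> \<exists>J. \<forall>x\<in>Sigma_k k. \<forall>y\<in>Sigma_k k. (\<forall>i<J. x i = y i) \<longrightarrow> \<bar>\<phi> x - \<phi> y\<bar> \<le> \<epsilon>"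
    and B: "\<And>x. x \<in> Sigma_k k \<Longrightarrow> \<bar>\<phi> x\<bar> \<le> B"
    and low: "\<And>n. n > 0 \<Longrightarrow> \<exists>z\<in>Sigma_k k. (\<Sum>d<n. \<phi> (\<lambda>i. z (d + i))) \<le> n * \<alpha>"
    and "\<alpha> < a"
  shows "\<exists>Q. \<forall>q\<ge>Q. q > 0 \<and> (\<exists>N. \<forall>t\<in>{1..5::nat}. \<exists>p::nat \<Rightarrow> nat. (\<forall>i. p i < k) \<and> (\<forall>i. p (i + q) = p i) \<and>
    (\<exists>i. p i = 0) \<and> (\<exists>i. p i = 1) \<and> card {i. i < q \<and> p i = 1} = N + t \<and>
    (\<Sum>d<q. \<phi> (\<lambda>i. p (d + i))) / q < a)"
proof -
  \<comment> \<open>One third goes to uniform continuity, one to the last \<open>J + 6\<close>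
    positions, whose next \<open>J\<close> symbols may reach the overwritten end of the period; the
    last third keeps the inequality strict.\<close>
  define \<epsilon> where "\<epsilon> = (a - \<alpha>) / 3"
  have e: "\<epsilon> > 0" using \<open>\<alpha> < a\<close> by (simp add: \<epsilon>_def)
  obtain J where J: "\<And>x y. x \<in> Sigma_k k \<Longrightarrow> y \<in> Sigma_k k \<Longrightarrow> (\<And>i. i < J \<Longrightarrow> x i = y i) \<Longrightarrow> \<bar>\<phi> x - \<phi> y\<bar> \<le> \<epsilon>"
    using unif[OF e] by blast
  have B0: "0 \<le> B"
  proof -
    have "(\<lambda>_. 0) \<in> Sigma_k k" using k by (simp add: Sigma_k_def)
    from B[OF this] show ?thesis by linarith
  qed
  obtain M where M: "2 * B * (J + 6) / \<epsilon> < real M" using reals_Archimedean2 by blast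
  show ?thesis
  proof (rule exI[of _ "M + 6"], intro allI impI conjI)
    fix q assume q: "q \<ge> M + 6"
    then show q0: "q > 0" by simp
    obtain z where z: "z \<in> Sigma_k k" "(\<Sum>d<q. \<phi> (\<lambda>i. z (d + i))) \<le> q * \<alpha>" using low[OF q0] by blast
    define N where "N = card {i. i < q - 6 \<and> z i = 1}"
    show "\<exists>N. \<forall>t\<in>{1..5::nat}. \<exists>p::nat \<Rightarrow> nat. (\<forall>i. p i < k) \<and> (\<forall>i. p (i + q) = p i) \<and>
      (\<exists>i. p i = 0) \<and> (\<exists>i. p i = 1) \<and> card {i. i < q \<and> p i = 1} = N + t \<and>
      (\<Sum>d<q. \<phi> (\<lambda>i. p (d + i))) / q < a"
    proof (intro exI[of _ N] ballI)
      fix t :: nat assume t: "t \<in> {1..5}"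
      define w where "w i = (if i < q - 6 then z i else if i < q - 6 + t then 1 else 0)" for i
      define p where "p i = w (i mod q)" for i
      have pw: "p i = w i" if "i < q" for i using that by (simp add: p_def)
      have pk: "p i < k" for i using z(1) k by (auto simp: p_def w_def Sigma_k_def)
      then have pS: "(\<lambda>i. p (d + i)) \<in> Sigma_k k" for d by (simp add: Sigma_k_def)
      have zS: "(\<lambda>i. z (d + i)) \<in> Sigma_k k" for d using z(1) by (simp add: Sigma_k_def)
      have "{i. i < q \<and> p i = 1} = {i. i < q - 6 \<and> z i = 1} \<union> {q - 6..<q - 6 + t}"
        using t q by (auto simp: pw w_def split: if_splits)
      then have "card {i. i < q \<and> p i = 1} = card ({i. i < q - 6 \<and> z i = 1} \<union> {q - 6..<q - 6 + t})" by simp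
      also have "\<dots> = N + t" unfolding N_def by (subst card_Un_disjoint) auto
      finally have cnt: "card {i. i < q \<and> p i = 1} = N + t" .
      have "\<phi> (\<lambda>i. p (d + i)) \<le> \<phi> (\<lambda>i. z (d + i)) + (\<epsilon> + (if d + J \<le> q - 6 then 0 else 2 * B))" if "d < q" for d
      proof (cases "d + J \<le> q - 6")
        case True
        have "\<bar>\<phi> (\<lambda>i. p (d + i)) - \<phi> (\<lambda>i. z (d + i))\<bar> \<le> \<epsilon>"
        proof (rule J[OF pS zS])
          show "p (d + i) = z (d + i)" if "i < J" for i
          proof -
            have "d + i < q - 6" using that True by linarith
            then show ?thesis using pw[of "d + i"] by (simp add: w_def)
          qed
        qed
        then show ?thesis using True by simp
      next
        case False
        then show ?thesis using B[OF pS, of d] B[OF zS, of d] e by simp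
      qed
      then have "(\<Sum>d<q. \<phi> (\<lambda>i. p (d + i))) \<le> (\<Sum>d<q. \<phi> (\<lambda>i. z (d + i)) + (\<epsilon> + (if d + J \<le> q - 6 then 0 else 2 * B)))"
        by (intro sum_mono) simp
      also have "\<dots> = (\<Sum>d<q. \<phi> (\<lambda>i. z (d + i))) + (q * \<epsilon> + (\<Sum>d<q. if d + J \<le> q - 6 then 0 else 2 * B))"
        by (simp add: sum.distrib)
      also have "(\<Sum>d<q. if d + J \<le> q - 6 then 0 else 2 * B) \<le> 2 * B * (J + 6)"
      proof -
        have "(\<Sum>d<q. if d + J \<le> q - 6 then 0 else 2 * B) = (\<Sum>d\<in>{..<q} \<inter> {d. \<not> d + J \<le> q - 6}. 2 * B)"
          by (subst sum.inter_restrict) (auto intro: sum.cong)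
        also have "\<dots> \<le> (\<Sum>d\<in>{q - 6 - J..<q}. 2 * B)"
          using B0 by (intro sum_mono2) auto
        also have "\<dots> = real (q - (q - 6 - J)) * (2 * B)" by simp
        also have "\<dots> \<le> real (J + 6) * (2 * B)" using B0 by (intro mult_right_mono) auto
        finally show ?thesis by (simp add: mult_ac)
      qed
      also have "2 * B * (J + 6) \<le> \<epsilon> * q"
      proof -
        have "2 * B * (J + 6) / \<epsilon> \<le> real q" using M q by linarith
        then show ?thesis using e by (simp add: field_simps)
      qed
      finally have "(\<Sum>d<q. \<phi> (\<lambda>i. p (d + i))) \<le> q * \<alpha> + 2 * (\<epsilon> * q)" using z(2) by (simp add: mult_ac)
      also have "\<dots> = q * (\<alpha> + 2 * \<epsilon>)" by (simp add: algebra_simps)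
      also have "\<dots> < q * a" using q0 \<open>\<alpha> < a\<close> by (intro mult_strict_left_mono) (auto simp: \<epsilon>_def field_simps)
      finally have "(\<Sum>d<q. \<phi> (\<lambda>i. p (d + i))) / q < a" using q0 by (simp add: divide_less_eq mult.commute)
      \<comment> \<open>With \<open>t\<close> between 1 and 5, six overwritten symbols contain at
        least one 1 and at least one 0, so the orbit is not a fixed point.\<close>
      moreover have "p (q - 1) = 0" "p (q - 6) = 1" using pw[of "q - 1"] pw[of "q - 6"] q t
        by (simp_all add: w_def less_diff_conv)
      moreover have "p (i + q) = p i" for i by (simp add: p_def)
      ultimately show "\<exists>p::nat \<Rightarrow> nat. (\<forall>i. p i < k) \<and> (\<forall>i. p (i + q) = p i) \<and>
        (\<exists>i. p i = 0) \<and> (\<exists>i. p i = 1) \<and> card {i. i < q \<and> p i = 1} = N + t \<and>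
        (\<Sum>d<q. \<phi> (\<lambda>i. p (d + i))) / q < a" using pk cnt by blast
    qed
  qed
qed

text \<open>The low and high families, the latter obtained from the negated function, exist for all
  large periods, so one period serves both. Colour 5 carries no condition on its average because it
  only fills the rare runs.\<close>

lemma ex_five_periodic:
  fixes k :: nat and \<alpha> \<beta> a b B :: real and \<phi> :: "(nat \<Rightarrow> nat) \<Rightarrow> real"
  assumes k: "k \<ge> 2"
    and unif: "\<And>\<epsilon>::real. \<epsilon> > 0 \<Longrightarrow> \<exists>J. \<forall>x\<in>Sigma_k k. \<forall>y\<in>Sigma_k k. (\<forall>i<J. x i = y i) \<longrightarrow> \<bar>\<phi> x - \<phi> y\<bar> \<le> \<epsilon>"
    and B: "\<And>x. x \<in> Sigma_k k \<Longrightarrow> \<bar>\<phi> x\<bar> \<le> B"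
    and low: "\<And>n. n > 0 \<Longrightarrow> \<exists>z\<in>Sigma_k k. (\<Sum>d<n. \<phi> (\<lambda>i. z (d + i))) \<le> n * \<alpha>" and "\<alpha> < a"
    and high: "\<And>n. n > 0 \<Longrightarrow> \<exists>z\<in>Sigma_k k. (\<Sum>d<n. - \<phi> (\<lambda>i. z (d + i))) \<le> n * - \<beta>" and "b < \<beta>"
  obtains q and P :: "nat \<Rightarrow> nat \<Rightarrow> nat" where "q > 0" "\<And>c i. P c i < k" "\<And>c i. P c (i + q) = P c i"
    "\<And>c d. (\<lambda>i. P c (d + i)) \<noteq> (\<lambda>i. P c (Suc d + i))"
    "\<And>c c' d d'. c \<in> {1..5} \<Longrightarrow> c' \<in> {1..5} \<Longrightarrow> c \<noteq> c' \<Longrightarrow> (\<lambda>i. P c (d + i)) \<noteq> (\<lambda>i. P c' (d' + i))"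
    "\<And>c. c = 1 \<or> c = 4 \<Longrightarrow> (\<Sum>d<q. \<phi> (\<lambda>i. P c (d + i))) / q < a"
    "\<And>c. c = 2 \<or> c = 3 \<Longrightarrow> b < (\<Sum>d<q. \<phi> (\<lambda>i. P c (d + i))) / q"
proof -
  let ?ok = "\<lambda>q p. (\<forall>i. p i < k) \<and> (\<forall>i. p (i + q) = p i) \<and> (\<exists>i. p i = 0) \<and> (\<exists>i. p i = (1::nat))"
  let ?ones = "\<lambda>q p. card {i. i < q \<and> p i = (1::nat)}"
  let ?mean = "\<lambda>q p. (\<Sum>d<q. \<phi> (\<lambda>i. p (d + i))) / real q"
  obtain Q1 where Q1: "\<forall>q\<ge>Q1. q > 0 \<and> (\<exists>N. \<forall>t\<in>{1..5::nat}. \<exists>p::nat \<Rightarrow> nat. (\<forall>i. p i < k) \<and> (\<forall>i. p (i + q) = p i) \<and>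
    (\<exists>i. p i = 0) \<and> (\<exists>i. p i = 1) \<and> card {i. i < q \<and> p i = 1} = N + t \<and> (\<Sum>d<q. \<phi> (\<lambda>i. p (d + i))) / q < a)"
    using ex_periodic_low[OF k unif B low \<open>\<alpha> < a\<close>] by blast
  have unif': "\<exists>J. \<forall>x\<in>Sigma_k k. \<forall>y\<in>Sigma_k k. (\<forall>i<J. x i = y i) \<longrightarrow> \<bar>- \<phi> x - - \<phi> y\<bar> \<le> \<epsilon>" if "\<epsilon> > 0" for \<epsilon>
    using unif[OF that] by (simp add: abs_minus_commute)
  have B': "\<bar>- \<phi> x\<bar> \<le> B" if "x \<in> Sigma_k k" for x using B[OF that] by simp
  have "- \<beta> < - b" using \<open>b < \<beta>\<close> by simp
  from ex_periodic_low[OF k unif' B' high this]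
  obtain Q2 where Q2: "\<forall>q\<ge>Q2. q > 0 \<and> (\<exists>N. \<forall>t\<in>{1..5::nat}. \<exists>p::nat \<Rightarrow> nat. (\<forall>i. p i < k) \<and> (\<forall>i. p (i + q) = p i) \<and>
    (\<exists>i. p i = 0) \<and> (\<exists>i. p i = 1) \<and> card {i. i < q \<and> p i = 1} = N + t \<and> (\<Sum>d<q. - \<phi> (\<lambda>i. p (d + i))) / q < - b)"
    by blast
  define q where "q = max Q1 Q2"
  have q0: "q > 0" using Q1 by (simp add: q_def)
  obtain N1 where "\<forall>t\<in>{1..5}. \<exists>p. ?ok q p \<and> ?ones q p = N1 + t \<and> ?mean q p < a"
    using Q1[rule_format, of q] by (auto simp: q_def)
  from bchoice[OF this] obtain pl where "\<forall>t\<in>{1..5}. ?ok q (pl t) \<and> ?ones q (pl t) = N1 + t \<and> ?mean q (pl t) < a" ..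
  note pl = bspec[OF this]
  obtain N2 where "\<forall>t\<in>{1..5}. \<exists>p. ?ok q p \<and> ?ones q p = N2 + t \<and> b < ?mean q p"
    using Q2[rule_format, of q] by (auto simp: q_def sum_negf)
  from bchoice[OF this] obtain ph where "\<forall>t\<in>{1..5}. ?ok q (ph t) \<and> ?ones q (ph t) = N2 + t \<and> b < ?mean q (ph t)" ..
  note ph = bspec[OF this]
  \<comment> \<open>The ranges of counts of ones above \<open>N1\<close> and above \<open>N2\<close>
    may overlap. The family with the smaller offset therefore takes the smallest values of
    \<open>t\<close>, the other one the values beyond them. The default branches give every other
    colour a valid sequence too.\<close>
  define P where "P c = (if N1 \<le> N2
    then (if c = 2 then ph 4 else if c = 3 then ph 5 else if c = 4 then pl 2 else if c = 5 then pl 3 else pl 1)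
    else (if c = 2 then ph 1 else if c = 3 then ph 2 else if c = 4 then pl 4 else if c = 5 then pl 5 else pl 3))"
    for c :: nat
  have P_cases: "R (P c)" if "\<And>t. t \<in> {1..5} \<Longrightarrow> R (pl t) \<and> R (ph t)" for R c
    using that[of 1] that[of 2] that[of 3] that[of 4] that[of 5] by (simp add: P_def)
  have ok: "?ok q (P c)" for c
    by (rule P_cases[of "?ok q"], rule conjI, erule conjunct1[OF pl], erule conjunct1[OF ph])
  have ones: "?ones q (P c) \<noteq> ?ones q (P c')" if "c \<in> {1..5}" "c' \<in> {1..5}" "c \<noteq> c'" for c c'
  proof -
    have "?ones q (pl t) = N1 + t" "?ones q (ph t) = N2 + t" if "t \<in> {1..5}" for t
      by (rule conjunct1[OF conjunct2[OF pl[OF that]]], rule conjunct1[OF conjunct2[OF ph[OF that]]])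
    then have "?ones q (P c) = (if N1 \<le> N2
      then (if c = 2 then N2 + 4 else if c = 3 then N2 + 5 else if c = 4 then N1 + 2 else if c = 5 then N1 + 3 else N1 + 1)
      else (if c = 2 then N2 + 1 else if c = 3 then N2 + 2 else if c = 4 then N1 + 4 else if c = 5 then N1 + 5 else N1 + 3))"
      for c by (simp add: P_def)
    moreover have "\<And>c::nat. c \<in> {1..5} \<longleftrightarrow> c = 1 \<or> c = 2 \<or> c = 3 \<or> c = 4 \<or> c = 5" by auto
    ultimately show ?thesis using that by (simp only:) (elim disjE; simp)
  qed
  \<comment> \<open>The number of ones in a window of length \<open>q\<close> does not depend on its
    phase, so it is an invariant of the orbit.\<close>
  have shifted: "(\<Sum>j<q. if P c (d + j) = 1 then 1 else 0) = real (?ones q (P c))" for c d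
  proof -
    have "(\<Sum>j<q. if P c (d + j) = 1 then 1 else (0::real)) = (\<Sum>j\<in>{d..<d + q}. if P c j = 1 then 1 else 0)"
      using sum.shift_bounds_nat_ivl[of "\<lambda>j. if P c j = 1 then 1 else (0::real)" 0 d q]
      by (simp add: atLeast0LessThan add.commute)
    also have "\<dots> = (\<Sum>j<q. if P c j = 1 then 1 else 0)"
      by (rule sum_periodic_shift) (simp add: ok)
    also have "\<dots> = real (?ones q (P c))"
      by (simp add: sum.If_cases Int_def conj_commute)
    finally show ?thesis .
  qed
  show ?thesis
  proof (rule that[of q P])
    show "(\<lambda>i. P c (d + i)) \<noteq> (\<lambda>i. P c' (d' + i))" if "c \<in> {1..5}" "c' \<in> {1..5}" "c \<noteq> c'" for c c' d d'
    proof
      assume eq: "(\<lambda>i. P c (d + i)) = (\<lambda>i. P c' (d' + i))"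
      then have "P c (d + i) = P c' (d' + i)" for i by (rule fun_cong)
      then have "real (?ones q (P c)) = real (?ones q (P c'))"
        using shifted[of c d] shifted[of c' d'] by simp
      then show False using ones[OF that] by simp
    qed
    show "(\<lambda>i. P c (d + i)) \<noteq> (\<lambda>i. P c (Suc d + i))" for c d
    proof
      assume eq: "(\<lambda>i. P c (d + i)) = (\<lambda>i. P c (Suc d + i))"
      \<comment> \<open>Invariance under one step makes the sequence constant from \<open>d\<close>
        on, and by periodicity everywhere, although it takes both values 0 and 1.\<close>
      have const: "P c (d + i) = P c d" for i
      proof (induction i)
        case (Suc i)
        then show ?case using fun_cong[OF eq, of i] by simp
      qed simp
      have per: "P c (i + q * n) = P c i" for i n
      proof (induction n)
        case (Suc n)
        have "P c (i + q * n + q) = P c (i + q * n)" using ok by blast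
        then show ?case using Suc by (simp add: add_ac)
      qed simp
      have "P c i = P c d" for i
      proof -
        have "d \<le> i + q * d" using q0 by (simp add: trans_le_add2)
        then have "P c (i + q * d) = P c d" using const[of "i + q * d - d"] by simp
        then show ?thesis using per[of i d] by simp
      qed
      then show False using ok[of c] by (metis zero_neq_one)
    qed
    show "?mean q (P c) < a" if "c = 1 \<or> c = 4" for c
      using that pl[of 1] pl[of 2] pl[of 3] pl[of 4] by (auto simp: P_def)
    show "b < ?mean q (P c)" if "c = 2 \<or> c = 3" for c
      using that ph[of 1] ph[of 2] ph[of 4] ph[of 5] by (auto simp: P_def)
  qed (use q0 ok in auto)
qed

lemma ex_convex_weight:
  fixes x y t :: real
  assumes "x < t" "t < y" shows "\<exists>l. 0 < l \<and> l < 1 \<and> l * x + (1 - l) * y = t"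
proof (intro exI conjI)
  show "0 < (y - t) / (y - x)" "(y - t) / (y - x) < 1" using assms by auto
  have "l * x + (1 - l) * y = y - l * (y - x)" for l by (simp add: algebra_simps)
  from this[of "(y - t) / (y - x)"]
  show "(y - t) / (y - x) * x + (1 - (y - t) / (y - x)) * y = t" using assms by simp
qed

text \<open>Prescribing the two regime averages separately covers both conclusions: equal averages
  give convergence to the common value, different ones give two limit points.\<close>

lemma scrambled_with_averages:
  fixes \<phi> :: "(nat \<Rightarrow> nat) \<Rightarrow> real" and t :: "bool \<Rightarrow> real"
  assumes k: "k \<ge> 2" and cont: "s_continuous k \<phi>"
    and t: "\<And>r. Lmin k \<phi> < t r" "\<And>r. t r < Lmax k \<phi>" and i: "i \<in> {1..6}"
  shows "\<exists>S. S \<subseteq> {x \<in> Rec k - BR k. case_prop k i x} \<and> uncountable S \<and> DC1_scrambled S \<and>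
    (t True = t False \<longrightarrow> S \<subseteq> R_phi_at k \<phi> (t True)) \<and> (t True \<noteq> t False \<longrightarrow> S \<subseteq> I_phi k \<phi>)"
proof -
  have unif: "\<exists>J. \<forall>x\<in>Sigma_k k. \<forall>y\<in>Sigma_k k. (\<forall>i<J. x i = y i) \<longrightarrow> \<bar>\<phi> x - \<phi> y\<bar> \<le> \<epsilon>" if "\<epsilon> > 0" for \<epsilon>
    using s_continuous_uniform[OF cont that] .
  obtain B where B: "\<And>x. x \<in> Sigma_k k \<Longrightarrow> \<bar>\<phi> x\<bar> \<le> B"
    using s_continuous_bounded[OF cont] k by auto
  have ne: "(\<lambda>\<mu>. integral\<^sup>L \<mu> \<phi>) ` inv_measures k \<noteq> {}" using inv_measures_nonempty[of k] k by simp
  define a b where "a = min (t True) (t False)" and "b = max (t True) (t False)"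
  have ab: "a \<le> t r" "t r \<le> b" for r by (cases r; simp add: a_def b_def)+
  have "Lmin k \<phi> < a" "b < Lmax k \<phi>" using t by (auto simp: a_def b_def)
  then obtain \<mu> \<nu> where \<mu>: "\<mu> \<in> inv_measures k" "integral\<^sup>L \<mu> \<phi> < a"
    and \<nu>: "\<nu> \<in> inv_measures k" "b < integral\<^sup>L \<nu> \<phi>"
    using cInf_lessD[OF ne] less_cSupD[OF ne] unfolding Lmin_def Lmax_def by blast
  \<comment> \<open>The thresholds leave room twice: once for passing from the measure to a finite
    orbit segment, once for closing that segment up into a periodic orbit.\<close>
  obtain \<alpha> where \<alpha>: "integral\<^sup>L \<mu> \<phi> < \<alpha>" "\<alpha> < a" using dense[OF \<mu>(2)] by blast
  obtain \<beta> where \<beta>: "\<beta> < integral\<^sup>L \<nu> \<phi>" "b < \<beta>" using dense[OF \<nu>(2)] by blast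
  have k0: "k > 0" using k by simp
  have low: "\<exists>z\<in>Sigma_k k. (\<Sum>d<n. \<phi> (\<lambda>i. z (d + i))) \<le> n * \<alpha>" if "n > 0" for n
    using ex_low_birkhoff_sum[OF \<mu>(1) cont k0 \<alpha>(1) that] .
  have cont': "s_continuous k (\<lambda>x. - \<phi> x)"
    using cont unfolding s_continuous_def by (simp add: abs_minus_commute)
  have high: "\<exists>z\<in>Sigma_k k. (\<Sum>d<n. - \<phi> (\<lambda>i. z (d + i))) \<le> n * - \<beta>" if "n > 0" for n
    using ex_low_birkhoff_sum[OF \<nu>(1) cont' k0 _ that, of "- \<beta>"] \<beta>(1) by simp
  show ?thesis
  proof (rule ex_five_periodic[OF k unif B low \<alpha>(2) high \<beta>(2)])
    fix q and P :: "nat \<Rightarrow> nat \<Rightarrow> nat"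
    assume q: "q > 0" and P: "\<And>c i. P c i < k" "\<And>c i. P c (i + q) = P c i"
      "\<And>c d. (\<lambda>i. P c (d + i)) \<noteq> (\<lambda>i. P c (Suc d + i))"
      "\<And>c c' d d'. c \<in> {1..5} \<Longrightarrow> c' \<in> {1..5} \<Longrightarrow> c \<noteq> c' \<Longrightarrow> (\<lambda>i. P c (d + i)) \<noteq> (\<lambda>i. P c' (d' + i))"
      and mlow: "\<And>c. c = 1 \<or> c = 4 \<Longrightarrow> (\<Sum>d<q. \<phi> (\<lambda>i. P c (d + i))) / q < a"
      and mhigh: "\<And>c. c = 2 \<or> c = 3 \<Longrightarrow> b < (\<Sum>d<q. \<phi> (\<lambda>i. P c (d + i))) / q"
    \<comment> \<open>Colours 1, 4 have averages below \<open>a\<close> and colours 2, 3 averages above \<open>b\<close>. The lower density limit set consists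
      of the orbits common to both regimes, the upper density one of those used in some regime.\<close>
    define lo hi where "lo r = (if r \<or> i \<in> {1, 2, 4, 6} then 1 else 4 :: nat)"
      and "hi r = (if r \<or> i \<in> {1, 2} then 2 else 3 :: nat)" for r
    define sp where "sp = (if i \<in> {2, 5, 6} then Some 5 else None :: nat option)"
    define cols where "cols = range lo \<union> range hi \<union> set_option sp"
    have lo: "lo r = 1 \<or> lo r = 4" and hi: "hi r = 2 \<or> hi r = 3" for r by (simp_all add: lo_def hi_def)
    have "lo r \<in> {1..5}" "hi r \<in> {1..5}" for r using lo[of r] hi[of r] by auto
    moreover have "set_option sp \<subseteq> {1..5}" by (simp add: sp_def)
    ultimately have cols5: "cols \<subseteq> {1..5}" unfolding cols_def by blast
    have "\<exists>l. 0 < l \<and> l < 1 \<and> l * ((\<Sum>d<q. \<phi> (\<lambda>i. P (lo r) (d + i))) / q) +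
        (1 - l) * ((\<Sum>d<q. \<phi> (\<lambda>i. P (hi r) (d + i))) / q) = t r" for r
      by (rule ex_convex_weight[OF less_le_trans[OF mlow[OF lo] ab(1)] le_less_trans[OF ab(2) mhigh[OF hi]]])
    then obtain lam where weight: "\<And>r. 0 < lam r" "\<And>r. lam r < 1"
      "\<And>r. lam r * ((\<Sum>d<q. \<phi> (\<lambda>i. P (lo r) (d + i))) / q) +
        (1 - lam r) * ((\<Sum>d<q. \<phi> (\<lambda>i. P (hi r) (d + i))) / q) = t r"
      by metis
    interpret separated_construction k q P cols lo hi lam sp
    proof unfold_locales
      show "(\<lambda>i. P c (d + i)) \<noteq> (\<lambda>i. P c' (d' + i))" if "c \<in> cols" "c' \<in> cols" "c \<noteq> c'" for c c' d d'
        using P(4) cols5 that by blast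
      show "(\<lambda>i. P c (d + i)) \<noteq> (\<lambda>i. P c (Suc d + i))" for c d by (rule P(3))
    qed (use k q P(1,2) weight(1,2) in \<open>simp_all add: cols_def\<close>)
    have mean: "regime_mean \<phi> r = t r" for r
      using weight(3)[of r] by (simp add: regime_mean_def orbit_mean_def)
    have cprop: "case_prop k i (pt \<theta>)" for \<theta>
    proof -
      have "i = 1 \<or> i = 2 \<or> i = 3 \<or> i = 4 \<or> i = 5 \<or> i = 6" using i by auto
      moreover have "omega_ld k (pt \<theta>) = omega_ud k (pt \<theta>)" if "i = 1 \<or> i = 2"
        using that by (intro ld_eq_ud) (auto simp: lo_def hi_def)
      moreover have "omega_ld k (pt \<theta>) \<subset> omega_ud k (pt \<theta>)" if "i \<noteq> 1" "i \<noteq> 2"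
        using that by (intro ld_psubset_ud[of 2 True False]) (auto simp: lo_def hi_def cols_def intro!: range_eqI[of _ _ True])
      moreover have "omega_ud k (pt \<theta>) = omega_Bu k (pt \<theta>)" if "i = 1 \<or> i = 3 \<or> i = 4"
        using that by (intro ud_eq_Bu) (auto simp: cols_def sp_def)
      moreover have "omega_ud k (pt \<theta>) \<subset> omega_Bu k (pt \<theta>)" if "i = 2 \<or> i = 5 \<or> i = 6"
        using that by (intro ud_psubset_Bu[of 5]) (auto simp: sp_def lo_def hi_def)
      moreover have "omega_Bl k (pt \<theta>) \<subset> omega_ld k (pt \<theta>)" if "i = 1 \<or> i = 2 \<or> i = 4 \<or> i = 6"
        using that by (intro Bl_psubset_ld[of True]) (auto simp: lo_def hi_def)
      moreover have "omega_Bl k (pt \<theta>) = omega_ld k (pt \<theta>)" if "i = 3 \<or> i = 5"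
      proof (rule Bl_eq_ld)
        fix c :: nat
        show "\<exists>r. c \<noteq> lo r \<and> c \<noteq> hi r"
          \<comment> \<open>In these cases the even regime uses colours 1 and 2 and the odd one
            colours 4 and 3, so a colour is missing from whichever regime this witness
            names.\<close>
          using that by (intro exI[of _ "c \<noteq> 1 \<and> c \<noteq> 2"]) (auto simp: lo_def hi_def)
      qed
      moreover note Bu_psubset_lim[of \<theta>]
      ultimately show ?thesis unfolding case_prop_def Let_def by (elim disjE) simp_all
    qed
    define S where "S = range (\<lambda>A. pt (itinerary A))"
    have "S \<subseteq> {x \<in> Rec k - BR k. case_prop k i x}"
      using pt_Rec pt_notin_BR cprop by (auto simp: S_def)
    moreover have "S \<subseteq> R_phi_at k \<phi> (t True)" if eq: "t True = t False"
    proof -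
      have m: "regime_mean \<phi> r = t True" for r using mean eq by (cases r) auto
      have "birkhoff_avg \<phi> (pt \<theta>) \<longlonglongrightarrow> t True" for \<theta>
        unfolding birkhoff_avg_eq by (rule avg_pt_convergent[OF unif B m])
      then show ?thesis using pt_Sigma by (auto simp: S_def R_phi_at_def)
    qed
    moreover have "S \<subseteq> I_phi k \<phi>" if ne: "t True \<noteq> t False"
    proof -
      have "\<not> convergent (birkhoff_avg \<phi> (pt \<theta>))" for \<theta>
        unfolding birkhoff_avg_eq using ne mean by (intro avg_pt_divergent[OF unif B]) auto
      then show ?thesis using pt_Sigma by (auto simp: S_def I_phi_def)
    qed
    moreover have "uncountable S" "DC1_scrambled S" unfolding S_def by (rule scrambled_family)+
    ultimately show ?thesis by blast
  qed
qed

theorem theoremC: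
  fixes k :: nat and \<phi> :: "(nat \<Rightarrow> nat) \<Rightarrow> real" and a :: real and i :: nat
  assumes "k \<ge> 2"
    and "s_continuous k \<phi>"
    and "I_phi k \<phi> \<noteq> {}"
    and "Lmin k \<phi> < a" and "a < Lmax k \<phi>"
    and "i \<in> {1..6}"
  shows "(\<exists>S. S \<subseteq> {x \<in> Rec k - BR k. case_prop k i x} \<and> uncountable S \<and>
            DC1_scrambled S \<and> S \<subseteq> I_phi k \<phi>)
       \<and> (\<exists>S. S \<subseteq> {x \<in> Rec k - BR k. case_prop k i x} \<and> uncountable S \<and>
            DC1_scrambled S \<and> S \<subseteq> R_phi_at k \<phi> a)
       \<and> (\<exists>S. S \<subseteq> {x \<in> Rec k - BR k. case_prop k i x} \<and> uncountable S \<and>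
            DC1_scrambled S \<and> S \<subseteq> R_phi k \<phi>)"
proof -
  \<comment> \<open>A second admissible average; alternating between \<open>a\<close> and
    \<open>b\<close> makes the Birkhoff averages diverge.\<close>
  obtain b where b: "a < b" "b < Lmax k \<phi>" using dense[OF assms(5)] by blast
  have 1: "\<exists>S. S \<subseteq> {x \<in> Rec k - BR k. case_prop k i x} \<and> uncountable S \<and> DC1_scrambled S \<and> S \<subseteq> I_phi k \<phi>"
    using scrambled_with_averages[OF assms(1,2) _ _ assms(6), of "\<lambda>r. if r then a else b"] assms(4,5) b by auto
  have 2: "\<exists>S. S \<subseteq> {x \<in> Rec k - BR k. case_prop k i x} \<and> uncountable S \<and> DC1_scrambled S \<and> S \<subseteq> R_phi_at k \<phi> a"
    using scrambled_with_averages[OF assms(1,2) _ _ assms(6), of "\<lambda>_. a"] assms(4,5) by auto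
  have "R_phi_at k \<phi> a \<subseteq> R_phi k \<phi>" using assms(4,5) unfolding R_phi_def by (intro UN_upper) auto
  then show ?thesis using 1 2 by (meson order_trans)
qed

end
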